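(* Fix $r\in\mathbb{N}$ and consider the Gaussian model: for $n\ge r$ let $X_1,\ldots,X_{r+1}$ be i.i.d. standard Gaussian points in $\mathbb{R}^n$, let $\mathcal V_{n,r}$ be the $r$-dimensional volume of the simplex with these vertices and $\mathcal L_{n,r}=\log(r!\,\mathcal V_{n,r})$. Then, as $n\to\infty$, the sequence $n\big(\mathcal L_{n,r}-\frac r2\log n-\frac12\log(r+1)\big)$ converges in the mod-$\phi$ sense with $\eta(t)=\frac12\big((t+1)\log(t+1)-t\big)$ and parameter $w_n=rn$, namely $$\lim_{n\to\infty}\frac{\mathbb{E}\,e^{tn(\mathcal L_{n,r}-\frac r2\log n-\frac12\log(r+1))}}{e^{rn\,\eta(t)}}=(t+1)^{-\frac{r(r+1)}{4}}$$ uniformly as long as $t$ stays in any compact subset of $\mathbb{C}\setminus(-\infty,-1]$.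
   Context: Mod-$\phi$ convergence: real random variables $Y_n$ converge in the mod-$\phi$ sense with $\eta$ and parameters $w_n\to+\infty$ if $\phi$ is an infinitely divisible distribution with $\int e^{tx}\phi(dx)=e^{\eta(t)}$ on an open strip $S=\{c_-<\operatorname{Re}t<c_+\}$ of the complex plane, and $\mathbb{E}e^{tY_n}/e^{w_n\eta(t)}$ converges, locally uniformly on $S$, to an analytic limit function. Logarithms and powers are principal branches. For complex $t$ at which the expectation does not converge absolutely, $\mathbb{E}e^{tY_n}$ is understood as the meromorphic continuation in $t$ of the moment generating function. *)

theory Defs
  imports "HOL-Probability.Probability" "HOL-Complex_Analysis.Complex_Analysis"
begin

subsection \<open>Moment generating functions and mod-phi convergence\<close>

text \<open>
  The continuation is sought on the whole complex plane.  Functions that are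
  \<open>nicely_meromorphic_on\<close> have no removable singularities and take the value 0 at
  their poles, which makes the continuation a unique total function as soon as the
  expectation converges on a nonempty open set.
\<close>

definition mgf_continuation :: "'a measure \<Rightarrow> ('a \<Rightarrow> real) \<Rightarrow> (complex \<Rightarrow> complex) \<Rightarrow> bool" where
  "mgf_continuation M Y F \<longleftrightarrow>
     F nicely_meromorphic_on UNIV \<and>
     (\<forall>t. integrable M (\<lambda>\<omega>. exp (t * complex_of_real (Y \<omega>))) \<longrightarrow>
          F t = (LINT \<omega>|M. exp (t * complex_of_real (Y \<omega>))))"

definition mgf :: "'a measure \<Rightarrow> ('a \<Rightarrow> real) \<Rightarrow> complex \<Rightarrow> complex" where
  "mgf M Y t =
     (if integrable M (\<lambda>\<omega>. exp (t * complex_of_real (Y \<omega>)))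
      then (LINT \<omega>|M. exp (t * complex_of_real (Y \<omega>)))
      else (THE F. mgf_continuation M Y F) t)"

definition infinitely_divisible :: "real measure \<Rightarrow> bool" where
  "infinitely_divisible \<phi> \<longleftrightarrow>
     real_distribution \<phi> \<and>
     (\<forall>m::nat. m \<ge> 1 \<longrightarrow> (\<exists>\<nu>. real_distribution \<nu> \<and>
        \<phi> = distr (PiM {..<m} (\<lambda>_. \<nu>)) borel (\<lambda>x. \<Sum>i<m. x i)))"

definition open_strip :: "ereal \<Rightarrow> ereal \<Rightarrow> complex set" where
  "open_strip a b = {t. a < ereal (Re t) \<and> ereal (Re t) < b}"

text \<open>
  The law \<open>\<phi>\<close> is determined by \<open>\<eta>\<close> and hence is not a separate parameter; \<open>a\<close> and
  \<open>b\<close> bound the strip, and \<open>\<psi>\<close> is the limit function.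
\<close>

definition mod_phi_convergent ::
  "(nat \<Rightarrow> 'a measure) \<Rightarrow> (nat \<Rightarrow> 'a \<Rightarrow> real) \<Rightarrow> (complex \<Rightarrow> complex) \<Rightarrow> (nat \<Rightarrow> real) \<Rightarrow>
   ereal \<Rightarrow> ereal \<Rightarrow> (complex \<Rightarrow> complex) \<Rightarrow> bool" where
  "mod_phi_convergent M Y \<eta> w a b \<psi> \<longleftrightarrow>
     (\<forall>\<^sub>F n in sequentially. prob_space (M n) \<and> Y n \<in> borel_measurable (M n)) \<and>
     filterlim w at_top sequentially \<and>
     a < b \<and>
     (\<exists>\<phi>. infinitely_divisible \<phi> \<and>
        (\<forall>t\<in>open_strip a b.
           integrable \<phi> (\<lambda>x. exp (t * complex_of_real x)) \<and>
           (LINT x|\<phi>. exp (t * complex_of_real x)) = exp (\<eta> t))) \<and>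
     \<psi> analytic_on open_strip a b \<and>
     (\<forall>t\<in>open_strip a b. \<exists>U. open U \<and> t \<in> U \<and> U \<subseteq> open_strip a b \<and>
        uniform_limit U (\<lambda>n s. mgf (M n) (Y n) s / exp (complex_of_real (w n) * \<eta> s))
          \<psi> sequentially)"

subsection \<open>Gaussian simplices\<close>

text \<open>
  Since the ambient dimension \<open>n\<close> varies, $\mathbb{R}^n$ is modelled by the functions
  in \<open>extensional {..<n}\<close>, which is the space of the following product measure.
\<close>

definition std_gaussian :: "nat \<Rightarrow> (nat \<Rightarrow> real) measure" where
  "std_gaussian n = PiM {..<n} (\<lambda>_. std_normal_distribution)"

definition simplex_hull :: "nat \<Rightarrow> nat \<Rightarrow> (nat \<Rightarrow> nat \<Rightarrow> real) \<Rightarrow> (nat \<Rightarrow> real) set" where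
  "simplex_hull n r x =
     {(\<lambda>j\<in>{..<n}. \<Sum>i\<le>r. u i * x i j) | u. (\<forall>i\<le>r. 0 \<le> u i) \<and> (\<Sum>i\<le>r. u i) = 1}"

definition isometric_chart :: "nat \<Rightarrow> (real^'r \<Rightarrow> nat \<Rightarrow> real) \<Rightarrow> bool" where
  "isometric_chart n f \<longleftrightarrow>
     range f \<subseteq> extensional {..<n} \<and>
     (\<forall>p q. L2_set (\<lambda>j. f p j - f q j) {..<n} = dist p q)"

text \<open>
  For a subset \<open>S\<close> of some \<open>r\<close>-dimensional affine subspace of $\mathbb{R}^n$, where
  \<open>r = CARD('r)\<close>, the \<open>r\<close>-dimensional volume is the Lebesgue measure transported along
  an isometric (hence affine) parametrisation of that subspace by $\mathbb{R}^r$.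
  Isometry invariance of Lebesgue measure makes the choice of chart immaterial.  The
  vertices of a simplex in $\mathbb{R}^n$ always lie in such a subspace when \<open>r \<le> n\<close>.
\<close>

definition flat_volume :: "'r::finite itself \<Rightarrow> nat \<Rightarrow> (nat \<Rightarrow> real) set \<Rightarrow> real" where
  "flat_volume _ n S =
     (let f = (SOME f :: real^'r \<Rightarrow> nat \<Rightarrow> real. isometric_chart n f \<and> S \<subseteq> range f)
      in measure lebesgue (f -` S))"

definition log_volume :: "'r::finite itself \<Rightarrow> nat \<Rightarrow> (nat \<Rightarrow> nat \<Rightarrow> real) \<Rightarrow> real" where
  "log_volume T n x = ln (fact CARD('r) * flat_volume T n (simplex_hull n CARD('r) x))"

end

theory Submission
  imports Defs
begin

text \<open>
  Up to the factor \<open>sqrt (r + 1)\<close>, the quantity \<open>r! * V\<close> has the law of a product of independent chi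
  variables with \<open>n, \<dots>, n - r + 1\<close> degrees of freedom.  A rotation of the vertices that sends
  \<open>(1, \<dots>, 1)\<close> to a multiple of a coordinate vector turns the edge vectors into \<open>A ** Z\<close> with
  \<open>Z\<close> consisting of \<open>r\<close> independent Gaussian vectors and \<open>det A ^ 2 = r + 1\<close>; rotating the ambient
  space so that the first of these vectors lies on an axis splits off one chi-square factor from the
  Gram determinant.  Hence the moment generating function is a quotient of Gamma functions, and its
  asymptotics follow from Gudermann's series for the remainder in Stirling's formula.  The law with
  cumulant function \<open>\<eta>\<close> is a weak limit of finite sums of independent centred Gamma variables, since
  \<open>(1 + t) * ln (1 + t) - t\<close> is the integral of \<open>t / u - ln (1 + t / u)\<close> over \<open>u \<ge> 1\<close>.
\<close>


subsection \<open>Stirling asymptotics of Gamma quotients\<close>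

text \<open>The claim reaches beyond the half plane where the expectation converges; there only the
  meromorphic continuation is available, so the asymptotics must be those of the Gamma quotients
  themselves, uniformly away from the cut. With \<open>a = n / 2\<close> and
  \<open>w = t + 1\<close> every factor has the form Gamma (a * w + b) / Gamma (a + b) with
  \<open>b\<close> independent of \<open>n\<close>. Its leading exponential, with exponent a * (w *
  Ln w - w + 1), is exp (n * \<eta> t), and \<open>r\<close> factors give the parameter
  \<open>r * n\<close>. The correction is the power \<open>b - 1 / 2\<close> of \<open>w\<close>;
  summing over b = (j + 1 - r) / 2 for j < r yields the exponent - r * (r + 1) / 4. Since only
  quotients occur, the constant in Stirling's formula cancels and need not be determined. Local
  uniformity in \<open>w\<close> is expressed by limits along a product filter of
  \<open>at_top\<close> and \<open>nhds w0\<close>. Laws are identified through their moment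
  generating functions on a real half line, continued analytically to the imaginary axis, where the
  characteristic function determines the law.\<close>

lemma norm_Ln_quadratic_remainder:
  fixes x :: complex
  assumes "norm x < 1"
  shows "norm (Ln (1 + x) - x + x\<^sup>2 / 2) \<le> norm x ^ 3 / (1 - norm x)"
proof -
  define g where "g = (\<lambda>z::complex. Ln (1 + z) - z + z\<^sup>2 / 2)"
  \<comment> \<open>The derivative of the remainder collapses to \<open>z\<^sup>2 / (1 + z)\<close>,
    so the mean value inequality on the disc of radius \<open>norm x\<close> gives a cubic
    bound.\<close>
  have "norm (g x - g 0) \<le> (norm x ^ 2 / (1 - norm x)) * norm (x - 0)"
  proof (rule field_differentiable_bound[where S = "cball 0 (norm x)" and f' = "\<lambda>z. z\<^sup>2 / (1 + z)"])
    fix z :: complex assume z: "z \<in> cball 0 (norm x)"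
    hence nz: "norm z \<le> norm x" by simp
    have re: "Re (1 + z) > 0"
      using abs_Re_le_cmod[of z] nz assms by simp
    hence z1: "1 + z \<notin> \<real>\<^sub>\<le>\<^sub>0" by (auto simp: complex_nonpos_Reals_iff)
    hence z0: "1 + z \<noteq> 0" by auto
    have "1 / (1 + z) - 1 + z = z\<^sup>2 / (1 + z)"
      using z0 by (simp add: field_simps power2_eq_square)
    moreover have "(g has_field_derivative (1 / (1 + z) - 1 + z)) (at z within cball 0 (norm x))"
      unfolding g_def using z1 by (auto intro!: derivative_eq_intros simp: field_simps)
    ultimately show "(g has_field_derivative z\<^sup>2 / (1 + z)) (at z within cball 0 (norm x))" by simp
    have "norm (1 + z) \<ge> 1 - norm x"
      using norm_triangle_ineq2[of 1 "-z"] nz by simp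
    thus "norm (z\<^sup>2 / (1 + z)) \<le> norm x ^ 2 / (1 - norm x)"
      using nz assms unfolding norm_divide norm_power by (intro frac_le power_mono) auto
  qed auto
  thus ?thesis by (simp add: g_def power3_eq_cube power2_eq_square)
qed

text \<open>The summand of Gudermann's series: the amount by which the increment of the Stirling
  main term from \<open>s\<close> to \<open>s + 1\<close> exceeds \<open>Ln s\<close>.\<close>

definition gudermann :: "complex \<Rightarrow> complex" where
  "gudermann s = (s + 1 / 2) * Ln (1 + 1 / s) - 1"

text \<open>The shift \<open>1 / 2\<close> makes the terms of order \<open>1 / s\<close> cancel; the
  quadratic decay that remains is what makes the series over \<open>s + k\<close> converge.\<close>

lemma norm_gudermann_le:
  assumes "norm s \<ge> 2"
  shows "norm (gudermann s) \<le> 3 / norm s ^ 2"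
proof -
  define x where "x = 1 / s"
  have s0: "s \<noteq> 0" using assms by auto
  have nx: "norm x \<le> 1 / 2" unfolding x_def norm_divide using frac_le[of 1 1 2 "norm s"] assms by simp
  define R where "R = Ln (1 + x) - x + x\<^sup>2 / 2"
  have R: "norm R \<le> 2 * norm x ^ 3"
  proof -
    have "norm R \<le> norm x ^ 3 / (1 - norm x)"
      unfolding R_def using nx by (intro norm_Ln_quadratic_remainder) auto
    also have "\<dots> \<le> norm x ^ 3 / (1 / 2)" using nx by (intro divide_left_mono) auto
    finally show ?thesis by simp
  qed
  have xs: "s * x = 1" using s0 by (simp add: x_def)
  have "gudermann s = (s + 1 / 2) * (R + x - x\<^sup>2 / 2) - 1"
    unfolding gudermann_def R_def x_def by simp
  also have "\<dots> = s * R + R / 2 - x\<^sup>2 / 4 + (s * x) * (1 - x / 2) + x / 2 - 1"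
    by (simp add: algebra_simps power2_eq_square add_divide_distrib)
  also have "\<dots> = s * R + R / 2 - x\<^sup>2 / 4" unfolding xs by simp
  finally have "gudermann s = s * R + R / 2 - x\<^sup>2 / 4" .
  hence T: "norm (gudermann s) \<le> norm (s * R) + norm (R / 2) + norm (x\<^sup>2 / 4)"
    using norm_triangle_ineq4[of "s * R + R / 2" "x\<^sup>2 / 4"] norm_triangle_ineq[of "s * R" "R / 2"]
    by simp
  have A: "norm (s * R) \<le> 2 * norm x ^ 2"
  proof -
    have "norm s * norm R \<le> norm s * (2 * norm x ^ 3)" by (intro mult_left_mono R) auto
    also have "\<dots> = 2 * norm (s * x) * norm x ^ 2" by (simp add: norm_mult power3_eq_cube power2_eq_square)
    finally show ?thesis unfolding xs by (simp add: norm_mult)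
  qed
  have B: "norm (R / 2) \<le> norm x ^ 2 / 2"
  proof -
    have "norm R \<le> 2 * norm x * norm x ^ 2" using R by (simp add: power3_eq_cube power2_eq_square)
    also have "\<dots> \<le> 1 * norm x ^ 2" using nx by (intro mult_right_mono) auto
    finally show ?thesis by (simp add: norm_divide)
  qed
  have "norm (x\<^sup>2 / 4) = norm x ^ 2 / 4" by (simp add: norm_divide norm_power)
  hence "norm (gudermann s) \<le> 3 * norm x ^ 2" using T A B zero_le_power2[of "norm x"] by linarith
  thus ?thesis by (simp add: x_def norm_divide power_divide)
qed

text \<open>The bound \<open>1 / (A + k)\<^sup>2\<close> is dominated by the telescoping differences
  of \<open>T\<close>. Assuming only linear growth of \<open>norm (z + of_nat k)\<close> lets one
  estimate serve both a fixed point shifted far to the right and the scaled points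
  \<open>a * w + b\<close> uniformly in \<open>w\<close>.\<close>

lemma norm_gudermann_tail_bound:
  assumes A: "A \<ge> 2" and c: "c > 0" and cA: "c * A \<ge> 2"
    and z: "\<And>k::nat. norm (z + of_nat k) \<ge> c * (A + real k)"
  shows "summable (\<lambda>k. norm (gudermann (z + of_nat k)))"
    and "norm (\<Sum>k. gudermann (z + of_nat k)) \<le> 3 / (c\<^sup>2 * (A - 1))"
proof -
  define T where "T k = 1 / (A - 1 + real k)" for k :: nat
  have le: "norm (gudermann (z + of_nat k)) \<le> 3 / c\<^sup>2 * (T k - T (Suc k))" for k
  proof -
    have cz: "c * (A + real k) \<ge> c * A" using c by simp
    have "norm (gudermann (z + of_nat k)) \<le> 3 / norm (z + of_nat k) ^ 2"
      using z[of k] cA cz by (intro norm_gudermann_le) linarith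
    also have "\<dots> \<le> 3 / (c * (A + real k))\<^sup>2"
    proof (intro divide_left_mono power_mono)
      have pos: "c * (A + real k) > 0" using c A by simp
      hence "norm (z + of_nat k) > 0" using z[of k] by linarith
      moreover have "(c * (A + real k))\<^sup>2 > 0" by (rule zero_less_power[OF pos])
      moreover have "(norm (z + of_nat k))\<^sup>2 > 0" by (rule zero_less_power) fact
      ultimately show "0 < (norm (z + of_nat k))\<^sup>2 * (c * (A + real k))\<^sup>2"
        by (intro mult_pos_pos)
    qed (use z[of k] c A in auto)
    also have "\<dots> = 3 / c\<^sup>2 * (1 / (A + real k)\<^sup>2)" by (simp add: power_mult_distrib)
    also have "\<dots> \<le> 3 / c\<^sup>2 * (T k - T (Suc k))"
    proof (intro mult_left_mono)
      have "T k - T (Suc k) = 1 / ((A - 1 + real k) * (A + real k))"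
        using A unfolding T_def by (simp add: field_simps)
      also have "\<dots> \<ge> 1 / (A + real k)\<^sup>2"
        unfolding power2_eq_square using A by (intro divide_left_mono mult_mono mult_pos_pos) auto
      finally show "1 / (A + real k)\<^sup>2 \<le> T k - T (Suc k)" .
    qed auto
    finally show ?thesis .
  qed
  have "T \<longlonglongrightarrow> 0" unfolding T_def by real_asymp
  hence "(\<lambda>k. T k - T (Suc k)) sums (T 0 - 0)" by (rule telescope_sums')
  hence s: "(\<lambda>k. 3 / c\<^sup>2 * (T k - T (Suc k))) sums (3 / c\<^sup>2 * T 0)"
    using sums_mult by fastforce
  show sm: "summable (\<lambda>k. norm (gudermann (z + of_nat k)))"
    by (rule summable_comparison_test'[OF sums_summable[OF s], of 0]) (use le in auto)
  have "norm (\<Sum>k. gudermann (z + of_nat k)) \<le> (\<Sum>k. norm (gudermann (z + of_nat k)))"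
    by (rule summable_norm[OF sm])
  also have "\<dots> \<le> 3 / c\<^sup>2 * T 0"
    unfolding sums_unique[OF s] by (intro suminf_le le sm sums_summable[OF s])
  finally show "norm (\<Sum>k. gudermann (z + of_nat k)) \<le> 3 / (c\<^sup>2 * (A - 1))" by (simp add: T_def)
qed

text \<open>For large \<open>x\<close> the modulus is comparable to \<open>x\<close>, and for
  bounded \<open>x\<close> it is at least the distance of \<open>w0\<close> from the closed cut.
  Halving the resulting constant leaves room to move \<open>w0\<close> to a nearby
  \<open>w\<close>.\<close>

lemma norm_add_nonneg_real_ge:
  fixes w0 :: complex
  assumes "w0 \<notin> \<real>\<^sub>\<le>\<^sub>0"
  obtains c where "c > 0" "\<And>w x. \<lbrakk>dist w w0 < c; x \<ge> 0\<rbrakk> \<Longrightarrow> norm (w + of_real x) \<ge> c * (1 + x)"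
proof -
  obtain d where d: "d > 0" "ball w0 d \<subseteq> - \<real>\<^sub>\<le>\<^sub>0"
    using assms openE[of "- \<real>\<^sub>\<le>\<^sub>0 :: complex set" w0] closed_nonpos_Reals_complex open_Compl
    by (metis ComplI)
  have 1: "norm (w0 + of_real x) \<ge> d" if "x \<ge> 0" for x
  proof (rule ccontr)
    assume "\<not> ?thesis"
    hence "of_real (-x) \<in> ball w0 d" by (simp add: dist_norm)
    moreover have "complex_of_real (-x) \<in> \<real>\<^sub>\<le>\<^sub>0"
      using that by (subst nonpos_Reals_of_real_iff) auto
    ultimately show False using d by blast
  qed
  \<comment> \<open>The value \<open>1/2\<close> serves \<open>x \<ge> 2 * norm w0 + 1\<close>,
    where \<open>(1 + x) / 2 \<le> x - norm w0\<close>; the other value serves smaller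
    \<open>x\<close>, where \<open>1 + x\<close> is at most \<open>2 * norm w0 + 2\<close>.\<close>
  define b where "b = min (1/2) (d / (2 * norm w0 + 2))"
  have b: "b > 0" using d by (auto simp: b_def add_nonneg_pos)
  have 2: "norm (w0 + of_real x) \<ge> b * (1 + x)" if x: "x \<ge> 0" for x
  proof (cases "x \<ge> 2 * norm w0 + 1")
    case True
    have "b * (1 + x) \<le> 1/2 * (1 + x)" using x unfolding b_def by (intro mult_right_mono min.cobounded1) auto
    also have "\<dots> \<le> x - norm w0" using True by (simp add: field_simps)
    also have "\<dots> \<le> norm (w0 + of_real x)"
      using norm_triangle_ineq2[of "of_real x" "- w0"] x by (simp add: add.commute)
    finally show ?thesis .
  next
    case False
    have "b * (1 + x) \<le> d / (2 * norm w0 + 2) * (2 * norm w0 + 2)"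
      using x False d b by (intro mult_mono) (auto simp: b_def)
    also have "\<dots> = d" by (simp add: add_nonneg_eq_0_iff)
    finally show ?thesis using 1[OF x] by linarith
  qed
  show ?thesis
  proof (rule that[of "b / 2"])
    fix w x assume w: "dist w w0 < b / 2" and x: "(x::real) \<ge> 0"
    have "norm (w + of_real x) \<ge> norm (w0 + of_real x) - dist w w0"
      using norm_triangle_ineq2[of "w0 + of_real x" "w0 - w"] by (simp add: dist_norm norm_minus_commute add.commute)
    moreover have "b * x \<ge> 0" using b x by simp
    ultimately show "b / 2 * (1 + x) \<le> norm (w + of_real x)"
      using 2[OF x] w b by (simp add: algebra_simps)
  qed (use b in auto)
qed

text \<open>Binet's function, the remainder in Stirling's formula, in Gudermann's form.\<close>

definition stirling_remainder :: "complex \<Rightarrow> complex" where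
  "stirling_remainder z = (\<Sum>k. gudermann (z + of_nat k))"

lemma summable_gudermann:
  assumes z: "z \<notin> \<real>\<^sub>\<le>\<^sub>0"
  shows "summable (\<lambda>k. gudermann (z + of_nat k))"
proof -
  obtain c where c: "c > 0" "\<And>w x. \<lbrakk>dist w z < c; x \<ge> 0\<rbrakk> \<Longrightarrow> norm (w + of_real x) \<ge> c * (1 + x)"
    using norm_add_nonneg_real_ge[OF z] by blast
  \<comment> \<open>The estimate of \<open>gudermann\<close> needs arguments of modulus at least 2,
    so the first \<open>m\<close> terms are split off.\<close>
  obtain m :: nat where m: "real m \<ge> max 2 (2 / c)" using real_arch_simple by blast
  have "summable (\<lambda>k. norm (gudermann ((z + of_nat m) + of_nat k)))"
  proof (rule norm_gudermann_tail_bound[where A = "real m" and c = c])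
    show "2 \<le> c * real m" using m c by (simp add: field_simps)
    fix k :: nat
    have "c * (real m + real k) \<le> c * (1 + (real m + real k))" using c by simp
    also have "\<dots> \<le> norm (z + of_real (real m + real k))" using c by (intro c(2)) auto
    finally show "c * (real m + real k) \<le> norm (z + of_nat m + of_nat k)" by (simp add: add_ac)
  qed (use m c in auto)
  hence "summable (\<lambda>k. gudermann (z + of_nat (k + m)))"
    using summable_norm_cancel by (simp add: add_ac) 
  thus ?thesis by (subst (asm) summable_iff_shift)
qed

lemma stirling_remainder_rec:
  assumes z: "z \<notin> \<real>\<^sub>\<le>\<^sub>0"
  shows "stirling_remainder z = (\<Sum>k<m. gudermann (z + of_nat k)) + stirling_remainder (z + of_nat m)"
  unfolding stirling_remainder_def
  using suminf_split_initial_segment[OF summable_gudermann[OF z], of m] by (simp add: add_ac)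

text \<open>Convergence along the product filter is convergence locally uniform in \<open>w\<close>.
  It follows from a tail bound of order \<open>1 / a\<close> whose constant is the same for all
  \<open>w\<close> near \<open>w0\<close>.\<close>

lemma tendsto_stirling_remainder:
  fixes b :: complex
  assumes w0: "w0 \<notin> \<real>\<^sub>\<le>\<^sub>0"
  shows "((\<lambda>(a, w). stirling_remainder (of_real a * w + b)) \<longlongrightarrow> 0) (at_top \<times>\<^sub>F nhds w0)"
proof -
  obtain c where c: "c > 0" "\<And>w x. \<lbrakk>dist w w0 < c; x \<ge> 0\<rbrakk> \<Longrightarrow> norm (w + of_real x) \<ge> c * (1 + x)"
    using norm_add_nonneg_real_ge[OF w0] by blast
  define B where "B = (\<lambda>a::real. 3 / ((c/2)\<^sup>2 * (a - 1)))"
  have ev: "eventually (\<lambda>a::real. a \<ge> 2 \<and> c/2 * a \<ge> 2 \<and> c/2 * a \<ge> norm b) at_top"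
  proof -
    have "eventually (\<lambda>a::real. a \<ge> max 2 (max (4/c) (2 * norm b / c))) at_top"
      by (rule eventually_ge_at_top)
    thus ?thesis by eventually_elim (use c in \<open>auto simp: field_simps\<close>)
  qed
  have ew: "eventually (\<lambda>w. dist w w0 < c) (nhds w0)"
    using c eventually_nhds_metric by blast
  have le: "norm (stirling_remainder (of_real a * w + b)) \<le> B a"
    if a: "a \<ge> 2 \<and> c/2 * a \<ge> 2 \<and> c/2 * a \<ge> norm b" and w: "dist w w0 < c" for a :: real and w
    unfolding stirling_remainder_def B_def
  proof (rule norm_gudermann_tail_bound)
    fix k :: nat
    \<comment> \<open>The linear bound at \<open>w + k / a\<close>, multiplied by \<open>a\<close>,
      becomes a bound in \<open>a + k\<close>. Half of the constant \<open>c\<close> then absorbs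
      the fixed shift \<open>b\<close>.\<close>
    have "c * (a + real k) = a * (c * (1 + real k / a))" using a by (simp add: field_simps)
    also have "\<dots> \<le> a * norm (w + of_real (real k / a))" using a w by (intro mult_left_mono c) auto
    also have "\<dots> = norm (of_real a * (w + of_real (real k / a)))" using a by (simp add: norm_mult)
    also have "of_real a * (w + of_real (real k / a)) = of_real a * w + of_nat k"
      using a by (simp add: field_simps)
    finally have 1: "c * (a + real k) \<le> norm (of_real a * w + of_nat k)" .
    have "norm (of_real a * w + b + of_nat k) \<ge> norm (of_real a * w + of_nat k) - norm b"
      using norm_triangle_ineq2[of "of_real a * w + of_nat k" "-b"] by (simp add: algebra_simps)
    moreover have "c / 2 * real k \<ge> 0" using c by simp
    ultimately show "c/2 * (a + real k) \<le> norm (of_real a * w + b + of_nat k)"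
      using 1 a unfolding distrib_left by linarith
  qed (use a c in auto)
  show ?thesis
  proof (rule Lim_null_comparison)
    show "((\<lambda>(a, w). B a) \<longlongrightarrow> 0) (at_top \<times>\<^sub>F nhds w0)"
    proof -
      have "(B \<longlongrightarrow> 0) at_top" unfolding B_def using c by real_asymp
      hence "((\<lambda>p. B (fst p)) \<longlongrightarrow> 0) (at_top \<times>\<^sub>F nhds w0)"
        using filterlim_compose filterlim_fst by blast
      thus ?thesis by (simp add: case_prod_unfold)
    qed
    show "\<forall>\<^sub>F p in at_top \<times>\<^sub>F nhds w0. norm (case p of (a, w) \<Rightarrow> stirling_remainder (of_real a * w + b)) \<le> (case p of (a, w) \<Rightarrow> B a)"
      using eventually_prodI[OF ev ew] by eventually_elim (use le in auto)
  qed
qed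


section \<open>Identification of Gamma quotients with Stirling's formula\<close>

definition stirling_main :: "complex \<Rightarrow> complex" where
  "stirling_main z = (z - 1 / 2) * Ln z - z"

lemma nonpos_Reals_add_of_nat:
  assumes "z \<notin> \<real>\<^sub>\<le>\<^sub>0"
  shows "z + of_nat m \<notin> (\<real>\<^sub>\<le>\<^sub>0 :: complex set)"
  using assms by (auto simp: complex_nonpos_Reals_iff)

text \<open>The point is that Ln (z + 1) = Ln z + Ln (1 + 1 / z) holds for principal branches: off
  the real axis \<open>z\<close> and \<open>1 + 1 / z\<close> lie in opposite half planes, so their
  arguments have opposite signs and their sum stays in range.\<close>

lemma stirling_main_Suc:
  assumes z: "z \<notin> \<real>\<^sub>\<le>\<^sub>0"
  shows "stirling_main (z + 1) - stirling_main z = Ln z + gudermann z"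
proof -
  have z0: "z \<noteq> 0" using z by auto
  have "Ln (z * (1 + 1 / z)) = Ln z + Ln (1 + 1 / z)"
  proof (cases "Im z = 0")
    case True
    hence re: "Re z > 0" using z by (auto simp: complex_nonpos_Reals_iff)
    then obtain x where x: "z = of_real x" "x > 0" using True that[of "Re z"] by (simp add: complex_eq_iff)
    have "1 + 1 / x > 0" using x by (simp add: add_pos_pos)
    hence "Ln (of_real x * of_real (1 + 1 / x)) = Ln (of_real x) + Ln (of_real (1 + 1 / x))"
      using x by (simp only: of_real_mult [symmetric] Ln_of_real ln_mult_pos mult_pos_pos) simp
    thus ?thesis using x by simp
  next
    case False
    have im: "Im (1 + 1 / z) = - Im z / (norm z)\<^sup>2"
      by (simp add: Im_divide cmod_def)
    have n1: "1 + 1 / z \<noteq> 0"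
      using im False z0 by (metis divide_eq_0_iff neg_equal_0_iff_equal norm_eq_zero power_eq_0_iff zero_complex.simps(2))
    have "- pi < Im (Ln z) + Im (Ln (1 + 1 / z)) \<and> Im (Ln z) + Im (Ln (1 + 1 / z)) \<le> pi"
    proof (cases "Im z > 0")
      case True
      hence "Im (1 + 1 / z) < 0" using im z0 by simp
      hence "Im (Ln (1 + 1 / z)) < 0" "- pi < Im (Ln (1 + 1 / z))"
        using Im_Ln_pos_le[OF n1] mpi_less_Im_Ln[OF n1] Im_Ln_le_pi[OF n1] by auto
      moreover have "0 < Im (Ln z)" "Im (Ln z) < pi" using True Im_Ln_pos_lt_imp by blast+
      ultimately show ?thesis by linarith
    next
      case F2: False
      hence lt: "Im z < 0" using False by simp
      hence "Im (1 + 1 / z) > 0" unfolding im using z0 by (intro divide_pos_pos) auto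
      hence "0 < Im (Ln (1 + 1 / z))" "Im (Ln (1 + 1 / z)) < pi" using n1 Im_Ln_pos_lt by blast+
      moreover have "Im (Ln z) < 0" "- pi < Im (Ln z)"
        using lt Im_Ln_pos_le[OF z0] mpi_less_Im_Ln[OF z0] Im_Ln_le_pi[OF z0] by auto
      ultimately show ?thesis by linarith
    qed
    thus ?thesis by (intro Ln_times_simple z0 n1) auto
  qed
  moreover have "z * (1 + 1 / z) = z + 1" using z0 by (simp add: field_simps)
  ultimately have L: "Ln (z + 1) = Ln z + Ln (1 + 1 / z)" by simp
  show ?thesis unfolding stirling_main_def gudermann_def L by (simp add: algebra_simps)
qed

text \<open>Numerator and denominator both acquire the factor \<open>z\<close>, because the first
  term of Gudermann's series compensates the defect of the main term. The quotient is therefore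
  1-periodic, and comparison at infinity can show that it is constant.\<close>

lemma Gamma_eq_stirling_aux:
  assumes z: "z \<notin> \<real>\<^sub>\<le>\<^sub>0"
  shows "Gamma (z + 1) / exp (stirling_main (z + 1) + stirling_remainder (z + 1)) =
         Gamma z / exp (stirling_main z + stirling_remainder z)"
proof -
  have "z \<notin> \<int>\<^sub>\<le>\<^sub>0" "z \<noteq> 0" using z nonpos_Ints_subset_nonpos_Reals by auto
  have "stirling_remainder z = gudermann z + stirling_remainder (z + 1)"
    using stirling_remainder_rec[OF z, of 1] by simp
  hence "stirling_main (z + 1) + stirling_remainder (z + 1) = Ln z + (stirling_main z + stirling_remainder z)"
    using stirling_main_Suc[OF z] by (simp add: algebra_simps)
  thus ?thesis
    using \<open>z \<noteq> 0\<close> by (simp add: exp_add Gamma_plus1[OF \<open>z \<notin> \<int>\<^sub>\<le>\<^sub>0\<close>])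
qed

lemma Gamma_eq_stirling_shift:
  assumes z: "z \<notin> \<real>\<^sub>\<le>\<^sub>0"
  shows "Gamma (z + of_nat m) / exp (stirling_main (z + of_nat m) + stirling_remainder (z + of_nat m)) =
         Gamma z / exp (stirling_main z + stirling_remainder z)"
proof (induction m)
  case (Suc m)
  show ?case
    using Gamma_eq_stirling_aux[OF nonpos_Reals_add_of_nat[OF z, of m]] Suc by (simp add: add_ac)
qed auto

lemma tendsto_mult_Ln_add:
  fixes z :: complex
  shows "(\<lambda>m. of_nat m * Ln (1 + z / of_nat m)) \<longlonglongrightarrow> z"
proof -
  have "((\<lambda>u. Ln (1 + z * u)) has_field_derivative z) (at 0)"
    by (auto intro!: derivative_eq_intros)
  hence "((\<lambda>u. Ln (1 + z * u) / u) \<longlongrightarrow> z) (at 0)"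
    by (simp add: DERIV_def)
  moreover have "filterlim (\<lambda>m. 1 / of_nat m :: complex) (at 0) sequentially"
    by (intro filterlim_atI) (auto intro!: lim_1_over_n eventually_sequentiallyI[of 1])
  ultimately have "(\<lambda>m. Ln (1 + z * (1 / of_nat m)) / (1 / of_nat m)) \<longlonglongrightarrow> z"
    using filterlim_compose by blast
  thus ?thesis by (simp add: mult.commute)
qed

lemma Ln_add_of_nat:
  assumes m: "m > 0" and "norm z < real m"
  shows "Ln (z + of_nat m) = of_real (ln m) + Ln (1 + z / of_nat m)"
proof -
  have "1 + z / of_nat m \<noteq> 0"
  proof
    assume "1 + z / of_nat m = 0"
    hence "z = - of_nat m" using m by (simp add: field_simps eq_neg_iff_add_eq_0)
    thus False using assms by simp
  qed
  hence "Ln (of_real (real m) * (1 + z / of_nat m)) = of_real (ln m) + Ln (1 + z / of_nat m)"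
    using m by (subst Ln_times_of_real) auto
  moreover have "of_real (real m) * (1 + z / of_nat m) = z + of_nat m"
    using m by (simp add: field_simps)
  ultimately show ?thesis by simp
qed

lemma stirling_main_shift_tendsto:
  fixes z :: complex
  shows "(\<lambda>m. stirling_main (z + of_nat m) - stirling_main (of_nat m) - z * of_real (ln m)) \<longlonglongrightarrow> 0"
proof -
  have "(\<lambda>m. of_nat m * Ln (1 + z / of_nat m) + (z - 1/2) * Ln (1 + z / of_nat m) - z) \<longlonglongrightarrow> z + (z - 1/2) * Ln (1 + 0) - z"
    by (intro tendsto_intros tendsto_mult_Ln_add lim_const_over_n) auto
  hence lim: "(\<lambda>m. of_nat m * Ln (1 + z / of_nat m) + (z - 1/2) * Ln (1 + z / of_nat m) - z) \<longlonglongrightarrow> 0" by simp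
  obtain M :: nat where M: "real M > norm z" using reals_Archimedean2 by blast
  show ?thesis
  proof (rule Lim_transform_eventually[OF lim])
    show "\<forall>\<^sub>F m in sequentially. of_nat m * Ln (1 + z / of_nat m) + (z - 1/2) * Ln (1 + z / of_nat m) - z =
       stirling_main (z + of_nat m) - stirling_main (of_nat m) - z * of_real (ln m)"
      using eventually_ge_at_top[of "Suc M"]
    proof eventually_elim
      case (elim m)
      have L: "Ln (z + of_nat m) = of_real (ln m) + Ln (1 + z / of_nat m)"
        by (rule Ln_add_of_nat) (use elim M in auto)
      have "Ln (of_nat m) = complex_of_real (ln m)"
        using elim Ln_of_real[of "real m"] by simp
      thus ?case unfolding stirling_main_def L by (simp add: algebra_simps)
    qed
  qed
qed

text \<open>Gauss's product formula, read as a comparison of \<open>Gamma (z + of_nat m)\<close>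
  with \<open>Gamma (of_nat m)\<close> times the \<open>z\<close>-th power of
  \<open>m\<close>.\<close>

lemma Gamma_ratio_of_nat_tendsto:
  fixes z :: complex
  assumes z: "z \<notin> \<int>\<^sub>\<le>\<^sub>0"
  shows "(\<lambda>m. Gamma (z + of_nat m) / (Gamma (of_nat m) * exp (z * of_real (ln m)))) \<longlonglongrightarrow> 1"
proof -
  have g0: "Gamma z \<noteq> 0" using z by (simp add: Gamma_eq_zero_iff)
  have "(\<lambda>m. Gamma z / Gamma_series' z m) \<longlonglongrightarrow> Gamma z / Gamma z"
    by (intro tendsto_intros Gamma_series'_LIMSEQ g0)
  hence lim: "(\<lambda>m. Gamma z / Gamma_series' z m) \<longlonglongrightarrow> 1" using g0 by simp
  show ?thesis
  proof (rule Lim_transform_eventually[OF lim])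
    show "\<forall>\<^sub>F m in sequentially. Gamma z / Gamma_series' z m = Gamma (z + of_nat m) / (Gamma (of_nat m) * exp (z * of_real (ln m)))"
      using eventually_gt_at_top[of 0]
    proof eventually_elim
      case (elim m)
      have "Gamma (of_nat m) = (fact (m - 1) :: complex)"
        using elim Gamma_fact[of "m - 1"] by (simp add: of_nat_diff)
      moreover have "Gamma (z + of_nat m) = pochhammer z m * Gamma z"
        using pochhammer_Gamma[OF z, of m] g0 by simp
      ultimately show ?case by (simp add: Gamma_series'_def field_simps)
    qed
  qed
qed

lemma stirling_remainder_shift_tendsto:
  assumes z: "z \<notin> \<real>\<^sub>\<le>\<^sub>0"
  shows "(\<lambda>m. stirling_remainder (z + of_nat m)) \<longlonglongrightarrow> 0"
proof -
  have "(\<lambda>m. stirling_remainder z - (\<Sum>k<m. gudermann (z + of_nat k))) \<longlonglongrightarrow> stirling_remainder z - stirling_remainder z"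
    unfolding stirling_remainder_def[of z]
    by (intro tendsto_intros summable_LIMSEQ summable_gudermann z)
  moreover have "stirling_remainder z - (\<Sum>k<m. gudermann (z + of_nat k)) = stirling_remainder (z + of_nat m)" for m
    using stirling_remainder_rec[OF z, of m] by simp
  ultimately show ?thesis by simp
qed

text \<open>The quotient \<open>Q\<close> of Gamma by its Stirling expression is 1-periodic, and Q
  (u + m) / Q m tends to 1; hence \<open>Q\<close> is constant, and its value drops out of a
  ratio.\<close>

lemma Gamma_stirling_ratio:
  assumes z: "z \<notin> \<real>\<^sub>\<le>\<^sub>0" and w: "w \<notin> \<real>\<^sub>\<le>\<^sub>0"
  shows "Gamma z / Gamma w =
    exp (stirling_main z + stirling_remainder z - stirling_main w - stirling_remainder w)"
proof -
  define Q where "Q = (\<lambda>z. Gamma z / exp (stirling_main z + stirling_remainder z))"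
  have one: "(1::complex) \<notin> \<real>\<^sub>\<le>\<^sub>0" by simp
  have Q1: "Q u = Q 1" if u: "u \<notin> \<real>\<^sub>\<le>\<^sub>0" for u
  proof -
    have ui: "u \<notin> \<int>\<^sub>\<le>\<^sub>0" using u nonpos_Ints_subset_nonpos_Reals by auto
    \<comment> \<open>This is Q (u + m) / Q m, grouped so that each factor has a known limit. By
      periodicity it does not depend on \<open>m > 0\<close>.\<close>
    define A where "A = (\<lambda>m. Gamma (u + of_nat m) / (Gamma (of_nat m) * exp (u * of_real (ln (real m)))) /
       exp ((stirling_main (u + of_nat m) - stirling_main (of_nat m) - u * of_real (ln (real m)))
          + stirling_remainder (u + of_nat m) - stirling_remainder (of_nat m)))"
    have "(\<lambda>m. stirling_remainder (of_nat m)) \<longlonglongrightarrow> 0"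
      using stirling_remainder_shift_tendsto[OF one] 
      by (subst filterlim_sequentially_Suc[symmetric]) (simp add: add.commute)
    hence "A \<longlonglongrightarrow> 1 / exp (0 + 0 - 0)"
      unfolding A_def
      by (intro tendsto_intros Gamma_ratio_of_nat_tendsto stirling_main_shift_tendsto
          stirling_remainder_shift_tendsto u ui) auto
    hence "A \<longlonglongrightarrow> 1" by simp
    moreover have "\<forall>\<^sub>F m in sequentially. A m = Q u / Q 1"
      using eventually_gt_at_top[of 0]
    proof eventually_elim
      case (elim m)
      have "Gamma (of_nat m :: complex) \<noteq> 0" using elim Gamma_fact[of "m - 1", where 'a = complex]
        by (simp add: of_nat_diff)
      hence "A m = Q (u + of_nat m) / Q (of_nat m)"
        unfolding A_def Q_def by (simp add: exp_add exp_diff field_simps)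
      also have "Q (u + of_nat m) = Q u" unfolding Q_def by (rule Gamma_eq_stirling_shift[OF u])
      also have "Q (of_nat m) = Q 1"
        using Gamma_eq_stirling_shift[OF one, of "m - 1"] elim unfolding Q_def by (simp add: of_nat_diff)
      finally show ?case .
    qed
    ultimately have "(\<lambda>m. Q u / Q 1) \<longlonglongrightarrow> 1" by (rule Lim_transform_eventually)
    hence "Q u / Q 1 = 1" by (simp add: LIMSEQ_const_iff)
    thus ?thesis by (simp add: divide_eq_1_iff)
  qed
  have "w \<notin> \<int>\<^sub>\<le>\<^sub>0" using w nonpos_Ints_subset_nonpos_Reals by auto
  hence "Gamma w \<noteq> 0" by (simp add: Gamma_eq_zero_iff)
  hence "Q 1 \<noteq> 0" using Q1[OF w] unfolding Q_def by auto
  moreover have "Gamma u = Q 1 * exp (stirling_main u + stirling_remainder u)" if "u \<notin> \<real>\<^sub>\<le>\<^sub>0" for u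
    using Q1[OF that] unfolding Q_def by (simp add: field_simps)
  ultimately have "Gamma z / Gamma w = exp (stirling_main z + stirling_remainder z) / exp (stirling_main w + stirling_remainder w)"
    using z w by simp
  thus ?thesis by (simp add: exp_diff[symmetric] algebra_simps)
qed

section \<open>Stirling's formula along scaled arguments\<close>

lemma tendsto_scaled_Ln_add:
  fixes b :: complex
  assumes w0: "w0 \<noteq> 0"
  shows "((\<lambda>(a, w). of_real a * w * Ln (1 + b / (of_real a * w))) \<longlongrightarrow> b) (at_top \<times>\<^sub>F nhds w0)"
proof -
  \<comment> \<open>The continuous extension of \<open>Ln (1 + u) / u\<close> to 0 covers the case
    \<open>b = 0\<close>, where the inner argument vanishes identically.\<close>
  define g where "g = (\<lambda>u::complex. if u = 0 then 1 else Ln (1 + u) / u)"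
  have "((\<lambda>u. Ln (1 + u)) has_field_derivative 1) (at (0::complex))"
    by (auto intro!: derivative_eq_intros)
  hence "((\<lambda>u. Ln (1 + u) / u) \<longlongrightarrow> 1) (at (0::complex))"
    by (simp add: DERIV_def)
  hence "(g \<longlongrightarrow> g 0) (at 0)"
    by (simp add: g_def cong: LIM_cong)
  hence g: "isCont g 0" by (simp add: isCont_def)
  have u: "((\<lambda>p. b / (of_real (fst p) * snd p)) \<longlongrightarrow> 0) (at_top \<times>\<^sub>F nhds w0)"
  proof -
    have "((\<lambda>p. of_real (1 / fst p) * (b / snd p)) \<longlongrightarrow> of_real 0 * (b / w0)) (at_top \<times>\<^sub>F nhds w0)"
    proof (intro tendsto_intros w0)
      have "((\<lambda>x::real. 1 / x) \<longlongrightarrow> 0) at_top" by real_asymp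
      thus "((\<lambda>p. 1 / fst p :: real) \<longlongrightarrow> 0) (at_top \<times>\<^sub>F nhds w0)"
        using filterlim_compose filterlim_fst by blast
      show "(snd \<longlongrightarrow> w0) (at_top \<times>\<^sub>F nhds w0)" using filterlim_snd by blast
    qed
    thus ?thesis by simp
  qed
  have "((\<lambda>p. b * g (b / (of_real (fst p) * snd p))) \<longlongrightarrow> b * g 0) (at_top \<times>\<^sub>F nhds w0)"
    by (intro tendsto_intros isCont_tendsto_compose[OF g] u)
  hence lim: "((\<lambda>p. b * g (b / (of_real (fst p) * snd p))) \<longlongrightarrow> b) (at_top \<times>\<^sub>F nhds w0)"
    by (simp add: g_def)
  have "\<forall>\<^sub>F w in nhds w0. w \<noteq> 0" using w0 by (rule t1_space_nhds)
  hence "\<forall>\<^sub>F p in at_top \<times>\<^sub>F nhds w0. fst p > (0::real) \<and> snd p \<noteq> 0"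
    using eventually_prodI[OF eventually_gt_at_top[of "0::real"]] by fastforce
  hence "\<forall>\<^sub>F p in at_top \<times>\<^sub>F nhds w0. b * g (b / (of_real (fst p) * snd p)) =
     (case p of (a, w) \<Rightarrow> of_real a * w * Ln (1 + b / (of_real a * w)))"
    by eventually_elim (auto simp: g_def field_simps)
  from Lim_transform_eventually[OF lim this] show ?thesis .
qed

lemma tendsto_fst_at_top_prod: "((\<lambda>p. c / of_real (fst p)) \<longlongrightarrow> (0::complex)) (at_top \<times>\<^sub>F F)"
proof -
  have "((\<lambda>p. c * of_real (1 / fst p)) \<longlongrightarrow> c * of_real 0) (at_top \<times>\<^sub>F F)"
  proof (intro tendsto_intros)
    have "((\<lambda>x::real. 1 / x) \<longlongrightarrow> 0) at_top" by real_asymp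
    thus "((\<lambda>p. 1 / fst p :: real) \<longlongrightarrow> 0) (at_top \<times>\<^sub>F F)"
      using filterlim_compose filterlim_fst by blast
  qed
  thus ?thesis by (simp add: field_simps)
qed

text \<open>Since \<open>w0\<close> is off the cut, the argument of \<open>Ln w0\<close> lies
  strictly between -\<pi> and \<pi>. The correction \<open>1 + b / (a * w)\<close> has argument
  tending to 0, so eventually the two logarithms add without a change of branch.\<close>

lemma Ln_scaled_shift:
  fixes b :: complex
  assumes w0: "w0 \<notin> \<real>\<^sub>\<le>\<^sub>0"
  shows "\<forall>\<^sub>F (a, w) in at_top \<times>\<^sub>F nhds w0. of_real a * w + b \<notin> \<real>\<^sub>\<le>\<^sub>0 \<and>
     Ln (of_real a * w + b) = of_real (ln a) + Ln w + Ln (1 + b / (of_real a * w))"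
proof -
  let ?F = "at_top \<times>\<^sub>F nhds w0 :: (real \<times> complex) filter"
  have w00: "w0 \<noteq> 0" using w0 by auto
  have snd: "(snd \<longlongrightarrow> w0) ?F" using filterlim_snd by blast
  have u: "((\<lambda>p. (b / of_real (fst p)) / snd p) \<longlongrightarrow> 0 / w0) ?F"
    by (intro tendsto_intros tendsto_fst_at_top_prod snd w00)
  have L: "((\<lambda>p. Im (Ln (snd p)) + Im (Ln (1 + (b / of_real (fst p)) / snd p))) \<longlongrightarrow>
      Im (Ln w0) + Im (Ln (1 + 0 / w0))) ?F"
    by (intro tendsto_intros u snd w0) (auto simp: w0)
  have im: "Im (Ln w0) + Im (Ln (1 + 0 / w0)) \<in> {-pi<..<pi}"
    using mpi_less_Im_Ln[OF w00] Im_Ln_less_pi[OF w0] by simp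
  have ev1: "\<forall>\<^sub>F p in ?F. Im (Ln (snd p)) + Im (Ln (1 + (b / of_real (fst p)) / snd p)) \<in> {-pi<..<pi}"
    by (rule topological_tendstoD[OF L _ im]) auto
  have u1: "((\<lambda>p. snd p + b / of_real (fst p)) \<longlongrightarrow> w0 + 0) ?F"
    by (intro tendsto_intros tendsto_fst_at_top_prod snd)
  have ev2: "\<forall>\<^sub>F p in ?F. snd p + b / of_real (fst p) \<in> - \<real>\<^sub>\<le>\<^sub>0"
    by (rule topological_tendstoD[OF u1]) (use w0 in \<open>auto intro: open_Compl closed_nonpos_Reals_complex\<close>)
  have ev3: "\<forall>\<^sub>F p in ?F. snd p \<in> - {0}"
    by (rule topological_tendstoD[OF snd]) (use w00 in auto)
  have ev4: "\<forall>\<^sub>F p in ?F. fst p > 0"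
    by (rule eventually_compose_filterlim[OF eventually_gt_at_top filterlim_fst])
  have "\<forall>\<^sub>F p in ?F. of_real (fst p) * snd p + b \<notin> \<real>\<^sub>\<le>\<^sub>0 \<and>
     Ln (of_real (fst p) * snd p + b) = of_real (ln (fst p)) + Ln (snd p) + Ln (1 + b / (of_real (fst p) * snd p))"
    using ev1 ev2 ev3 ev4
  proof eventually_elim
    case (elim p)
    obtain a w where p: "p = (a, w)" by force
    have a: "a > 0" and w: "w \<noteq> 0" and nr: "w + b / of_real a \<notin> \<real>\<^sub>\<le>\<^sub>0" using elim p by auto
    have eq: "of_real a * w + b = of_real a * (w + b / of_real a)" using a by (simp add: field_simps)
    have eq2: "w + b / of_real a = w * (1 + (b / of_real a) / w)" using w by (simp add: field_simps)
    have nz: "w + b / of_real a \<noteq> 0" using nr by auto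
    have nz2: "1 + (b / of_real a) / w \<noteq> 0" using nz eq2 by auto
    have "Ln (of_real a * w + b) = of_real (ln a) + Ln (w + b / of_real a)"
      unfolding eq using a nz by (subst Ln_times_of_real) (auto simp: Ln_of_real)
    also have "Ln (w + b / of_real a) = Ln w + Ln (1 + (b / of_real a) / w)"
      unfolding eq2 using elim p by (intro Ln_times_simple w nz2) auto
    finally have "Ln (of_real a * w + b) = of_real (ln a) + Ln w + Ln (1 + b / (of_real a * w))"
      by (simp add: add_ac)
    moreover have "of_real a * (w + b / of_real a) \<notin> \<real>\<^sub>\<le>\<^sub>0"
    proof
      assume "of_real a * (w + b / of_real a) \<in> \<real>\<^sub>\<le>\<^sub>0"
      hence "w + b / of_real a \<in> \<real>\<^sub>\<le>\<^sub>0"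
        using a by (simp only: complex_nonpos_Reals_iff) (auto simp: mult_le_0_iff)
      thus False using nr by contradiction
    qed
    ultimately show ?case unfolding p fst_conv snd_conv eq by simp
  qed
  thus ?thesis by (simp add: case_prod_unfold)
qed

text \<open>Expanding both main terms, the \<open>ln a\<close> contributions leave
  \<open>a * (w - 1) * ln a\<close>, and the terms linear in \<open>a\<close> leave the second
  exponential. The shift contributes \<open>b\<close> once from the numerator and once, with
  opposite sign, from the denominator, so that only \<open>(b - 1 / 2) * Ln w0\<close>
  survives.\<close>

theorem Gamma_ratio_tendsto:
  fixes b :: real and w0 :: complex
  assumes w0: "w0 \<notin> \<real>\<^sub>\<le>\<^sub>0"
  shows "((\<lambda>(a, w). Gamma (of_real a * w + of_real b) / Gamma (of_real a + of_real b) *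
            exp (- (of_real a * (w - 1) * of_real (ln a))) *
            exp (- (of_real a * (w * Ln w - w + 1)))) \<longlongrightarrow> exp ((of_real b - 1 / 2) * Ln w0))
         (at_top \<times>\<^sub>F nhds w0)"
proof -
  let ?F = "at_top \<times>\<^sub>F nhds w0 :: (real \<times> complex) filter"
  define c where "c = complex_of_real b"
  define L where "L = (\<lambda>(a::real, w::complex). Ln (1 + c / (of_real a * w)))"
  have w00: "w0 \<noteq> 0" using w0 by auto
  have snd: "(snd \<longlongrightarrow> w0) ?F" using filterlim_snd by blast
  have one: "(1::complex) \<notin> \<real>\<^sub>\<le>\<^sub>0" by simp
  \<comment> \<open>The denominator is the numerator at \<open>w = 1\<close>; along \<open>k\<close>
    the same limits apply to it.\<close>
  define k where "k = (\<lambda>p::real \<times> complex. (fst p, 1 :: complex))"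
  have k: "filterlim k (at_top \<times>\<^sub>F nhds 1) ?F"
    unfolding k_def by (intro filterlim_Pair filterlim_fst tendsto_const)
  note K = filterlim_compose[OF _ k]
  have r1: "((\<lambda>p. stirling_remainder (of_real (fst p) * snd p + c)) \<longlongrightarrow> 0) ?F"
    using tendsto_stirling_remainder[OF w0, of c] by (simp add: case_prod_unfold)
  have r2: "((\<lambda>p. stirling_remainder (of_real (fst p) + c)) \<longlongrightarrow> 0) ?F"
    using K[OF tendsto_stirling_remainder[OF one, of c]] by (simp add: case_prod_unfold k_def)
  have l1: "((\<lambda>p. of_real (fst p) * snd p * L p) \<longlongrightarrow> c) ?F"
    using tendsto_scaled_Ln_add[OF w00, of c] unfolding L_def by (simp add: case_prod_unfold)
  have l2: "((\<lambda>p. of_real (fst p) * L (k p)) \<longlongrightarrow> c) ?F"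
    using K[OF tendsto_scaled_Ln_add[of 1 c]] unfolding L_def k_def by (simp add: case_prod_unfold)
  have m1: "(L \<longlongrightarrow> Ln (1 + 0 / w0)) ?F"
    unfolding L_def case_prod_unfold divide_divide_eq_left[symmetric]
    by (intro tendsto_intros tendsto_fst_at_top_prod snd w00) auto
  have m2: "((\<lambda>p. L (k p)) \<longlongrightarrow> Ln (1 + 0)) ?F"
    unfolding L_def k_def case_prod_unfold fst_conv snd_conv mult_1_right
    by (intro tendsto_intros tendsto_fst_at_top_prod) auto
  have ln: "((\<lambda>p. Ln (snd p)) \<longlongrightarrow> Ln w0) ?F" by (intro tendsto_intros snd w0)
  have lim: "((\<lambda>p. exp (of_real (fst p) * snd p * L p + (c - 1/2) * (Ln (snd p) + L p)
        - of_real (fst p) * L (k p) - (c - 1/2) * L (k p)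
        + stirling_remainder (of_real (fst p) * snd p + c) - stirling_remainder (of_real (fst p) + c)))
      \<longlongrightarrow> exp (c + (c - 1/2) * (Ln w0 + Ln (1 + 0 / w0)) - c - (c - 1/2) * Ln (1 + 0) + 0 - 0)) ?F"
    by (intro tendsto_intros r1 r2 l1 l2 m1 m2 ln)
  have e1: "\<forall>\<^sub>F p in ?F. of_real (fst p) * snd p + c \<notin> \<real>\<^sub>\<le>\<^sub>0 \<and>
     Ln (of_real (fst p) * snd p + c) = of_real (ln (fst p)) + Ln (snd p) + L p"
    using Ln_scaled_shift[OF w0, of c] by (simp add: case_prod_unfold L_def)
  have e2: "\<forall>\<^sub>F p in ?F. of_real (fst p) + c \<notin> \<real>\<^sub>\<le>\<^sub>0 \<and>
     Ln (of_real (fst p) + c) = of_real (ln (fst p)) + L (k p)"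
    using eventually_compose_filterlim[OF Ln_scaled_shift[OF one, of c] k]
    by (simp add: case_prod_unfold L_def k_def)
  have "\<forall>\<^sub>F p in ?F. exp (of_real (fst p) * snd p * L p + (c - 1/2) * (Ln (snd p) + L p)
        - of_real (fst p) * L (k p) - (c - 1/2) * L (k p)
        + stirling_remainder (of_real (fst p) * snd p + c) - stirling_remainder (of_real (fst p) + c)) =
     (case p of (a, w) \<Rightarrow> Gamma (of_real a * w + c) / Gamma (of_real a + c) *
            exp (- (of_real a * (w - 1) * of_real (ln a))) *
            exp (- (of_real a * (w * Ln w - w + 1))))"
    using e1 e2
  proof eventually_elim
    case (elim p)
    obtain a w where p: "p = (a, w)" by force
    have e1: "of_real a * w + c \<notin> \<real>\<^sub>\<le>\<^sub>0" "Ln (of_real a * w + c) = of_real (ln a) + Ln w + L p"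
      and e2: "of_real a + c \<notin> \<real>\<^sub>\<le>\<^sub>0" "Ln (of_real a + c) = of_real (ln a) + L (k p)"
      using elim by (auto simp: p)
    show ?case
      unfolding p case_prod_conv Gamma_stirling_ratio[OF e1(1) e2(1)] exp_add[symmetric]
      unfolding stirling_main_def e1(2) e2(2) fst_conv snd_conv
      by (rule arg_cong[where f = exp]) (simp add: p algebra_simps)
  qed
  from Lim_transform_eventually[OF lim this] show ?thesis unfolding c_def by simp
qed


subsection \<open>Moment generating functions and weak limits\<close>

lemma exp_abs_le: "exp (s * \<bar>x\<bar>) \<le> exp (s * x) + exp (- (s * x :: real))"
  by (cases "x \<ge> 0") (auto simp: add_increasing add_increasing2)

text \<open>Multiply by \<open>exp (d * (\<bar>x\<bar> - K)) \<ge> 1\<close>. At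
  \<open>t = 0\<close> this is Chernoff's bound, which yields tightness; at other \<open>t\<close>
  it makes the exponential integrands uniformly small outside a compact interval.\<close>

lemma exp_mult_tail_bound:
  fixes t d K x :: real
  assumes "d > 0" "\<bar>x\<bar> \<ge> K"
  shows "exp (t * x) \<le> exp (- (d * K)) * (exp ((t + d) * x) + exp ((t - d) * x))"
proof -
  have "1 \<le> exp (- (d * K)) * exp (d * \<bar>x\<bar>)"
    using assms by (simp add: exp_add[symmetric])
  also have "\<dots> \<le> exp (- (d * K)) * (exp (d * x) + exp (- (d * x)))"
    by (intro mult_left_mono exp_abs_le) auto
  finally have "exp (t * x) * 1 \<le> exp (t * x) * (exp (- (d * K)) * (exp (d * x) + exp (- (d * x))))"
    by (intro mult_left_mono) auto
  also have "\<dots> = exp (- (d * K)) * (exp (t * x) * exp (d * x) + exp (t * x) * exp (- (d * x)))"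
    by (simp add: algebra_simps)
  also have "exp (t * x) * exp (d * x) = exp ((t + d) * x)"
    by (simp add: exp_add[symmetric] algebra_simps)
  also have "exp (t * x) * exp (- (d * x)) = exp ((t - d) * x)"
    by (simp add: exp_add[symmetric] algebra_simps)
  finally show ?thesis by simp
qed

lemma Chernoff_two_sided:
  assumes "real_distribution M" and d: "d > 0"
    and i: "integrable M (\<lambda>x. exp (d * x))" "integrable M (\<lambda>x. exp (- d * x))"
  shows "measure M {x. \<bar>x\<bar> \<ge> K} \<le> exp (- (d * K)) * ((LINT x|M. exp (d * x)) + (LINT x|M. exp (- d * x)))"
proof -
  interpret real_distribution M by fact
  have "measure M {x. \<bar>x\<bar> \<ge> K} = (LINT x|M. indicator {x. \<bar>x\<bar> \<ge> K} x)" by simp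
  also have "\<dots> \<le> (LINT x|M. exp (- (d * K)) * (exp (d * x) + exp (- d * x)))"
  proof (rule integral_mono)
    show "integrable M (indicat_real {x. K \<le> \<bar>x\<bar>})"
      by (intro integrable_real_indicator) (auto simp: less_top[symmetric])
    show "integrable M (\<lambda>x. exp (- (d * K)) * (exp (d * x) + exp (- d * x)))"
      using i by auto
    show "indicat_real {x. K \<le> \<bar>x\<bar>} x \<le> exp (- (d * K)) * (exp (d * x) + exp (- d * x))" for x
      using exp_mult_tail_bound[of d K x 0] d by (auto simp: indicator_def)
  qed
  also have "\<dots> = exp (- (d * K)) * ((LINT x|M. exp (d * x)) + (LINT x|M. exp (- d * x)))"
    using i by simp
  finally show ?thesis .
qed

text \<open>Weak convergence controls bounded continuous integrands only. Two-sided exponential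
  moments give tightness and hence a weak subsequential limit; for the unbounded exponential,
  moments at the neighbouring exponents \<open>t + d\<close> and \<open>t - d\<close> bound the
  truncation error uniformly in \<open>N\<close>.\<close>

theorem mgf_convergence_imp_limit_law:
  fixes \<mu> :: "nat \<Rightarrow> real measure" and L :: "real \<Rightarrow> real" and c :: real
  assumes c: "c < 0"
    and distr: "\<And>N. real_distribution (\<mu> N)"
    and int: "\<And>N t. t > c \<Longrightarrow> integrable (\<mu> N) (\<lambda>x. exp (t * x))"
    and lim: "\<And>t. t > c \<Longrightarrow> (\<lambda>N. LINT x|\<mu> N. exp (t * x)) \<longlonglongrightarrow> L t"
  obtains \<phi> where "real_distribution \<phi>"
    "\<And>t. t > c \<Longrightarrow> integrable \<phi> (\<lambda>x. exp (t * x)) \<and> (LINT x|\<phi>. exp (t * x)) = L t"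
proof -
  interpret \<mu>: real_distribution "\<mu> N" for N by (rule distr)
  define m where "m N t = (LINT x|\<mu> N. exp (t * x))" for N t
  have "\<exists>B. \<forall>N. m N t \<le> B" if "t > c" for t
  proof -
    have "bounded (range (\<lambda>N. m N t))"
      using lim[OF that] unfolding m_def by (intro convergent_imp_bounded) auto
    thus ?thesis unfolding bounded_iff by (auto intro: abs_le_D1)
  qed
  then obtain B where B: "\<And>N t. t > c \<Longrightarrow> m N t \<le> B t" by metis
  \<comment> \<open>Both \<open>s\<close> and \<open>- s\<close> exceed \<open>c\<close>, as a
    two-sided Chernoff bound demands; this is where \<open>c < 0\<close> enters.\<close>
  define s where "s = - c / 2"
  have s: "s > 0" "s > c" "- s > c" using c by (auto simp: s_def)
  have tight: "tight \<mu>"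
    unfolding tight_def
  proof (intro conjI allI impI distr)
    fix \<epsilon> :: real assume \<epsilon>: "\<epsilon> > 0"
    define C where "C = B s + B (- s)"
    have "((\<lambda>K. exp (- (s * K)) * C) \<longlongrightarrow> 0) at_top" using s(1) by real_asymp
    hence "\<forall>\<^sub>F K in at_top. exp (- (s * K)) * C < \<epsilon>" using \<epsilon> by (rule order_tendstoD)
    then obtain K where K: "K > 0" "exp (- (s * K)) * C < \<epsilon>"
      by (metis (mono_tags, lifting) eventually_conj eventually_gt_at_top eventually_happens' trivial_limit_at_top_linorder)
    show "\<exists>a b. a < b \<and> (\<forall>n. 1 - \<epsilon> < measure (\<mu> n) {a<..b})"
    proof (rule exI[of _ "-K"], rule exI[of _ K], intro conjI allI)
      fix n
      have "measure (\<mu> n) {x. \<bar>x\<bar> \<ge> K} \<le> exp (- (s * K)) * (m n s + m n (- s))"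
        unfolding m_def using s int[of "s" n] int[of "- s" n] by (intro Chernoff_two_sided distr) simp_all
      also have "\<dots> \<le> exp (- (s * K)) * C"
        unfolding C_def using s by (intro mult_left_mono add_mono B) auto
      also note K(2)
      finally have "measure (\<mu> n) {x. \<bar>x\<bar> \<ge> K} < \<epsilon>" .
      moreover have "1 - measure (\<mu> n) {-K<..K} = measure (\<mu> n) (- {-K<..K})"
        using \<mu>.prob_compl[of "{-K<..K}"] by (simp add: Compl_eq_Diff_UNIV)
      moreover have "measure (\<mu> n) (- {-K<..K}) \<le> measure (\<mu> n) {x. \<bar>x\<bar> \<ge> K}"
        by (intro \<mu>.finite_measure_mono) auto
      ultimately show "1 - \<epsilon> < measure (\<mu> n) {-K<..K}" by linarith
    qed (use K in auto)
  qed
  \<comment> \<open>Passing to a subsequence is harmless, as the limits \<open>L t\<close> hold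
    along the whole sequence.\<close>
  obtain r \<phi> where r: "strict_mono (r :: nat \<Rightarrow> nat)" and \<phi>: "real_distribution \<phi>"
    and wc: "weak_conv_m (\<mu> \<circ> id \<circ> r) \<phi>"
    using tight_imp_convergent_subsubsequence[OF tight strict_mono_id] by blast
  interpret \<phi>: real_distribution \<phi> by fact
  \<comment> \<open>A continuous cutoff, equal to 1 on [-K, K] and to 0 beyond K + 1; times the
    exponential it is bounded and continuous.\<close>
  define h where "h K x = max 0 (min 1 (real K + 1 - \<bar>x\<bar>))" for K x
  have h: "0 \<le> h K x" "h K x \<le> 1" for K x by (auto simp: h_def)
  have h_meas [measurable]: "(\<lambda>x. h K x) \<in> borel_measurable borel" for K
    unfolding h_def by measurable
  have h1: "h K x = 1" if "\<bar>x\<bar> \<le> real K" for K x using that by (auto simp: h_def)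
  have h0: "h K x = 0" if "\<bar>x\<bar> \<ge> real K + 1" for K x using that by (auto simp: h_def)
  have hc: "isCont (\<lambda>x. h K x * exp (t * x)) x" for K t x
    unfolding h_def by (intro continuous_intros)
  have hlim: "(\<lambda>K. h K x) \<longlonglongrightarrow> 1" for x
  proof (rule tendsto_eventually)
    obtain K0 :: nat where "\<bar>x\<bar> \<le> real K0" using real_arch_simple by blast
    thus "\<forall>\<^sub>F K in sequentially. h K x = 1"
      by (auto intro!: eventually_sequentiallyI[of K0] h1)
  qed
  have bd: "norm (h K x * exp (t * x)) \<le> exp (\<bar>t\<bar> * (real K + 1))" for K t x
  proof (cases "\<bar>x\<bar> \<ge> real K + 1")
    case False
    have "t * x \<le> \<bar>t\<bar> * \<bar>x\<bar>" by (metis abs_ge_self abs_mult)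
    also have "\<dots> \<le> \<bar>t\<bar> * (real K + 1)" using False by (intro mult_left_mono) auto
    finally have "1 * exp (t * x) \<le> exp (\<bar>t\<bar> * (real K + 1))" by simp
    moreover have "h K x * exp (t * x) \<le> 1 * exp (t * x)" using h by (intro mult_right_mono) auto
    ultimately have "h K x * exp (t * x) \<le> exp (\<bar>t\<bar> * (real K + 1))" by linarith
    thus ?thesis using h(1)[of K x] by (simp add: abs_mult)
  qed (simp add: h0)
  have conv: "(\<lambda>n. LINT x|\<mu> (r n). h K x * exp (t * x)) \<longlonglongrightarrow> (LINT x|\<phi>. h K x * exp (t * x))" for K t
  proof -
    have "(\<lambda>n. LINT x|(\<mu> \<circ> id \<circ> r) n. h K x * exp (t * x)) \<longlonglongrightarrow> (LINT x|\<phi>. h K x * exp (t * x))"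
      by (rule weak_conv_imp_integral_bdd_continuous_conv[OF _ \<phi> wc hc bd]) (auto simp: distr)
    thus ?thesis by simp
  qed
  have inth: "integrable M (\<lambda>x. h K x * exp (t * x))" if "real_distribution M" for M K t
  proof -
    interpret M: real_distribution M by fact
    show ?thesis by (rule M.integrable_const_bound[OF AE_I2[OF bd]]) simp
  qed
  show thesis
  proof (rule that[OF \<phi>])
    fix t assume t: "t > c"
    have hB: "(LINT x|\<phi>. h K x * exp (t * x)) \<le> B t" for K
    proof (rule LIMSEQ_le_const2[OF conv])
      have "(LINT x|\<mu> (r n). h K x * exp (t * x)) \<le> B t" for n
      proof -
        have "(LINT x|\<mu> (r n). h K x * exp (t * x)) \<le> m (r n) t"
          unfolding m_def using h by (intro integral_mono inth distr int t) (auto intro: mult_left_le_one_le)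
        also have "\<dots> \<le> B t" by (rule B[OF t])
        finally show ?thesis .
      qed
      thus "\<exists>N. \<forall>n\<ge>N. (LINT x|\<mu> (r n). h K x * exp (t * x)) \<le> B t" by blast
    qed
    \<comment> \<open>Fatou's lemma carries the uniform bound \<open>B t\<close> to the limit law,
      so the exponential is integrable under it.\<close>
    have "(\<integral>\<^sup>+x. ennreal (exp (t * x)) \<partial>\<phi>) = (\<integral>\<^sup>+x. liminf (\<lambda>K. ennreal (h K x * exp (t * x))) \<partial>\<phi>)"
    proof (intro nn_integral_cong)
      fix x
      have "(\<lambda>K. ennreal (h K x * exp (t * x))) \<longlonglongrightarrow> ennreal (1 * exp (t * x))"
        by (intro tendsto_ennrealI tendsto_intros hlim)
      thus "ennreal (exp (t * x)) = liminf (\<lambda>K. ennreal (h K x * exp (t * x)))"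
        by (metis lim_imp_Liminf mult_1 sequentially_bot)
    qed
    also have "\<dots> \<le> liminf (\<lambda>K. \<integral>\<^sup>+x. ennreal (h K x * exp (t * x)) \<partial>\<phi>)"
      by (rule nn_integral_liminf) simp
    also have "\<dots> \<le> ennreal (B t)"
    proof -
      have "(\<integral>\<^sup>+x. ennreal (h K x * exp (t * x)) \<partial>\<phi>) \<le> ennreal (B t)" for K
        using hB h by (subst nn_integral_eq_integral[OF inth[OF \<phi>]]) (auto intro!: ennreal_leI)
      thus ?thesis by (intro Liminf_le) auto
    qed
    finally have fin: "(\<integral>\<^sup>+x. ennreal (exp (t * x)) \<partial>\<phi>) \<le> ennreal (B t)" .
    have int\<phi>: "integrable \<phi> (\<lambda>x. exp (t * x))"
      using fin by (intro integrableI_nonneg) (auto simp: less_top[symmetric] top_unique)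
    \<comment> \<open>Half the distance to \<open>c\<close> keeps both \<open>t + d\<close> and
      \<open>t - d\<close> in the range of available moments.\<close>
    define d where "d = (t - c) / 2"
    have d: "d > 0" "t + d > c" "t - d > c" using t by (auto simp: d_def field_simps)
    define C where "C = B (t + d) + B (t - d)"
    have diff: "\<bar>m N t - (LINT x|\<mu> N. h K x * exp (t * x))\<bar> \<le> exp (- (d * real K)) * C" for N K
    proof -
      have "m N t - (LINT x|\<mu> N. h K x * exp (t * x)) = (LINT x|\<mu> N. exp (t * x) - h K x * exp (t * x))"
        unfolding m_def by (intro Bochner_Integration.integral_diff[symmetric] int t inth distr)
      also have "\<bar>\<dots>\<bar> \<le> (LINT x|\<mu> N. exp (- (d * real K)) * (exp ((t + d) * x) + exp ((t - d) * x)))"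
        unfolding real_norm_def[symmetric]
      proof (rule order_trans[OF integral_norm_bound integral_mono])
        show "integrable (\<mu> N) (\<lambda>x. norm (exp (t * x) - h K x * exp (t * x)))"
          by (intro integrable_norm Bochner_Integration.integrable_diff int t inth distr)
        show "integrable (\<mu> N) (\<lambda>x. exp (- (d * real K)) * (exp ((t + d) * x) + exp ((t - d) * x)))"
          by (intro integrable_mult_right Bochner_Integration.integrable_add int d)
        fix x
        show "norm (exp (t * x) - h K x * exp (t * x)) \<le> exp (- (d * real K)) * (exp ((t + d) * x) + exp ((t - d) * x))"
        proof (cases "\<bar>x\<bar> \<le> real K")
          case False
          have "norm (exp (t * x) - h K x * exp (t * x)) = (1 - h K x) * exp (t * x)"
            using h[of K x] by (simp add: algebra_simps abs_mult flip: left_diff_distrib)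
          also have "\<dots> \<le> 1 * exp (t * x)" using h[of K x] by (intro mult_right_mono) auto
          also have "\<dots> \<le> exp (- (d * real K)) * (exp ((t + d) * x) + exp ((t - d) * x))"
            using exp_mult_tail_bound[OF d(1), of "real K" x t] False by simp
          finally show ?thesis .
        qed (simp add: h1)
      qed
      also have "\<dots> = exp (- (d * real K)) * (m N (t + d) + m N (t - d))"
        unfolding m_def using int d by simp
      also have "\<dots> \<le> exp (- (d * real K)) * C"
        unfolding C_def using d by (intro mult_left_mono add_mono B) auto
      finally show ?thesis .
    qed
    have "(\<lambda>n. m (r n) t) \<longlonglongrightarrow> L t"
      using LIMSEQ_subseq_LIMSEQ[OF lim[OF t] r] by (simp add: m_def o_def)
    hence "(\<lambda>n. \<bar>m (r n) t - (LINT x|\<mu> (r n). h K x * exp (t * x))\<bar>) \<longlonglongrightarrow>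
        \<bar>L t - (LINT x|\<phi>. h K x * exp (t * x))\<bar>" for K
      by (intro tendsto_intros conv)
    hence le: "\<bar>L t - (LINT x|\<phi>. h K x * exp (t * x))\<bar> \<le> exp (- (d * real K)) * C" for K
      by (rule LIMSEQ_le_const2) (use diff in auto)
    have "(\<lambda>K. LINT x|\<phi>. h K x * exp (t * x)) \<longlonglongrightarrow> (LINT x|\<phi>. exp (t * x))"
    proof (rule integral_dominated_convergence[OF _ _ int\<phi>])
      show "AE x in \<phi>. (\<lambda>K. h K x * exp (t * x)) \<longlonglongrightarrow> exp (t * x)"
        using tendsto_mult[OF hlim tendsto_const] by auto
      show "AE x in \<phi>. norm (h K x * exp (t * x)) \<le> exp (t * x)" for K
        using h by (auto simp: abs_mult intro: mult_left_le_one_le)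
    qed auto
    hence "(\<lambda>K. \<bar>L t - (LINT x|\<phi>. h K x * exp (t * x))\<bar>) \<longlonglongrightarrow> \<bar>L t - (LINT x|\<phi>. exp (t * x))\<bar>"
      by (intro tendsto_intros)
    moreover have "(\<lambda>K. exp (- (d * real K)) * C) \<longlonglongrightarrow> 0" using d(1) by real_asymp
    ultimately have "\<bar>L t - (LINT x|\<phi>. exp (t * x))\<bar> \<le> 0"
      by (rule LIMSEQ_le) (use le in auto)
    thus "integrable \<phi> (\<lambda>x. exp (t * x)) \<and> (LINT x|\<phi>. exp (t * x)) = L t"
      using int\<phi> by simp
  qed
qed

text \<open>Every point of the half plane lies in a disc that is centred on the real axis and contained
  in the half plane, so one power series around a real point suffices.\<close>

lemma mgf_holomorphic_on_ball:
  fixes c s :: real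
  assumes M: "real_distribution M" and s: "s > c"
    and int: "\<And>t::real. t > c \<Longrightarrow> integrable M (\<lambda>x. exp (t * x))"
  shows "(\<lambda>t::complex. LINT x|M. exp (t * of_real x)) holomorphic_on ball (of_real s) (s - c)"
proof -
  interpret real_distribution M by fact
  define a where "a n = (LINT x|M. of_real (x ^ n / fact n * exp (s * x)) :: complex)" for n
  show ?thesis
  proof (rule power_series_holomorphic)
    fix w :: complex assume w: "w \<in> ball (of_real s) (s - c)"
    define \<rho> where "\<rho> = norm (w - of_real s)"
    have \<rho>: "0 \<le> \<rho>" "\<rho> < s - c" using w by (auto simp: \<rho>_def dist_norm norm_minus_commute)
    define f where "f n x = of_real (x ^ n / fact n * exp (s * x)) * (w - of_real s) ^ n" for n and x :: real
    have nf: "norm (f n x) = (\<rho> * \<bar>x\<bar>) ^ n / fact n * exp (s * x)" for n x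
      by (simp add: f_def norm_mult norm_power \<rho>_def power_mult_distrib norm_divide power_abs)
    have e: "(\<lambda>n. norm (f n x)) sums (exp (\<rho> * \<bar>x\<bar>) * exp (s * x))" for x
      unfolding nf using exp_converges[of "\<rho> * \<bar>x\<bar>"]
      by (intro sums_mult2) (simp add: field_simps scaleR_conv_of_real)
    \<comment> \<open>The norms of the terms sum to
      \<open>exp (\<rho> * \<bar>x\<bar>) * exp (s * x)\<close>. The exponentials at
      \<open>s + \<rho>\<close> and \<open>s - \<rho>\<close> dominate this sum, and both are
      integrable because \<open>\<rho> < s - c\<close>; so series and integral may be
      exchanged.\<close>
    have ib: "integrable M (\<lambda>x. exp ((s + \<rho>) * x) + exp ((s - \<rho>) * x))"
      using \<rho> s by (intro Bochner_Integration.integrable_add int) auto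
    have eb: "exp (\<rho> * \<bar>x\<bar>) * exp (s * x) \<le> exp ((s + \<rho>) * x) + exp ((s - \<rho>) * x)" for x
    proof -
      have "exp (\<rho> * \<bar>x\<bar>) * exp (s * x) \<le> (exp (\<rho> * x) + exp (- (\<rho> * x))) * exp (s * x)"
        by (intro mult_right_mono exp_abs_le) auto
      also have "\<dots> = exp ((s + \<rho>) * x) + exp ((s - \<rho>) * x)"
        by (simp add: algebra_simps exp_add exp_diff exp_minus field_simps)
      finally show ?thesis .
    qed
    have part: "(\<Sum>i<n. norm (f i x)) \<le> exp (\<rho> * \<bar>x\<bar>) * exp (s * x)" for n x
      using e[of x] by (metis norm_ge_zero sum_le_suminf sums_iff finite_lessThan)
    have fb: "norm (f n x) \<le> exp ((s + \<rho>) * x) + exp ((s - \<rho>) * x)" for n x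
      using part[of x "Suc n"] eb[of x] sum_nonneg[of "{..<n}" "\<lambda>i. norm (f i x)"] by simp
    have [measurable]: "(\<lambda>x. f n x) \<in> borel_measurable M" for n
      unfolding f_def by measurable
    have fi: "integrable M (f n)" for n
      by (rule Bochner_Integration.integrable_bound[OF ib]) (use fb in \<open>auto intro!: AE_I2 intro: order_trans\<close>)
    have "(\<lambda>n. integral\<^sup>L M (f n)) sums (LINT x|M. (\<Sum>n. f n x))"
    proof (rule sums_integral[OF fi])
      show "AE x in M. summable (\<lambda>i. norm (f i x))" using e by (auto simp: sums_iff)
      show "summable (\<lambda>i. LINT x|M. norm (f i x))"
      proof (rule summableI_nonneg_bounded)
        fix n
        have "(\<Sum>i<n. LINT x|M. norm (f i x)) = (LINT x|M. (\<Sum>i<n. norm (f i x)))"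
          by (intro Bochner_Integration.integral_sum[symmetric] integrable_norm fi)
        also have "\<dots> \<le> (LINT x|M. exp ((s + \<rho>) * x) + exp ((s - \<rho>) * x))"
          by (intro integral_mono Bochner_Integration.integrable_sum integrable_norm fi ib order_trans[OF part eb])
        finally show "(\<Sum>i<n. LINT x|M. norm (f i x)) \<le> (LINT x|M. exp ((s + \<rho>) * x) + exp ((s - \<rho>) * x))" .
      qed simp
    qed
    moreover have "(\<Sum>n. f n x) = exp (w * of_real x)" for x
    proof -
      have "(\<lambda>n. (((w - of_real s) * of_real x) ^ n /\<^sub>R fact n) * exp (of_real (s * x))) sums
          (exp ((w - of_real s) * of_real x) * exp (of_real (s * x)))"
        by (intro sums_mult2 exp_converges)
      moreover have "(((w - of_real s) * of_real x) ^ n /\<^sub>R fact n) * exp (of_real (s * x)) = f n x" for n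
        unfolding f_def exp_of_real by (simp add: scaleR_conv_of_real power_mult_distrib divide_inverse mult_ac)
      moreover have "exp ((w - of_real s) * of_real x) * exp (of_real (s * x)) = exp (w * of_real x)"
        by (simp add: exp_add[symmetric] algebra_simps)
      ultimately show ?thesis by (simp add: sums_iff)
    qed
    moreover have "integral\<^sup>L M (f n) = a n * (w - of_real s) ^ n" for n
      unfolding f_def a_def by simp
    ultimately show "(\<lambda>n. a n * (w - of_real s) ^ n) sums (LINT x|M. exp (w * of_real x))" by simp
  qed
qed

text \<open>The identity theorem carries a formula from real exponents to the half plane. On a
  suitable disc both sides are holomorphic, and they agree on a real segment that accumulates at the
  centre.\<close>

lemma mgf_eq_holomorphic:
  fixes c :: real and L :: "complex \<Rightarrow> complex"
  assumes M: "real_distribution M"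
    and int: "\<And>t::real. t > c \<Longrightarrow> integrable M (\<lambda>x. exp (t * x))"
    and L: "L holomorphic_on {t. c < Re t}"
    and eq: "\<And>t::real. t > c \<Longrightarrow> of_real (LINT x|M. exp (t * x)) = L (of_real t)"
    and t: "c < Re t"
  shows "integrable M (\<lambda>x. exp (t * of_real x)) \<and> (LINT x|M. exp (t * of_real x)) = L t"
proof -
  interpret real_distribution M by fact
  \<comment> \<open>With y = (Im t)^2 / (Re t - c), the squared distance of \<open>t\<close> from
    \<open>s\<close> is y^2 + y * (Re t - c). This is less than (y + Re t - c)^2 = (s - c)^2, so
    \<open>t\<close> lies in the disc around \<open>s\<close> that touches the boundary
    line.\<close>
  define s where "s = Re t + (Im t)\<^sup>2 / (Re t - c)"
  have "(Im t)\<^sup>2 / (Re t - c) \<ge> 0" using t by auto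
  hence s: "s > c" using t unfolding s_def by linarith
  have tb: "t \<in> ball (of_real s) (s - c)"
  proof -
    define y where "y = (Im t)\<^sup>2 / (Re t - c)"
    have y: "y \<ge> 0" "(Im t)\<^sup>2 = y * (Re t - c)" using t by (auto simp: y_def)
    have "(norm (t - of_real s))\<^sup>2 = y\<^sup>2 + y * (Re t - c)"
      unfolding cmod_power2 by (simp add: s_def y_def[symmetric] y(2)[symmetric])
    also have "\<dots> < (s - c)\<^sup>2"
    proof -
      have "(s - c)\<^sup>2 = y\<^sup>2 + 2 * (y * (Re t - c)) + (Re t - c)\<^sup>2"
        unfolding s_def y_def[symmetric] by (simp add: power2_eq_square algebra_simps)
      moreover have "y * (Re t - c) \<ge> 0" "(Re t - c)\<^sup>2 > 0" using y t by auto
      ultimately show ?thesis by linarith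
    qed
    finally have "norm (t - of_real s) < s - c"
      by (rule power2_less_imp_less) (use s in auto)
    thus ?thesis by (simp add: dist_norm norm_minus_commute)
  qed
  have Lh: "L holomorphic_on ball (of_real s) (s - c)"
  proof (rule holomorphic_on_subset[OF L], safe)
    fix z assume "z \<in> ball (complex_of_real s) (s - c)"
    thus "c < Re z" using abs_Re_le_cmod[of "of_real s - z"] by (auto simp: dist_norm)
  qed
  have "(LINT x|M. exp (t * of_real x)) - L t = 0"
  proof (rule analytic_continuation[where S = "ball (of_real s) (s - c)" and \<xi> = "of_real s" and
        U = "of_real ` {s..<s + (s - c)}" and f = "\<lambda>t. (LINT x|M. exp (t * of_real x)) - L t"])
    show "(\<lambda>t. (LINT x|M. exp (t * complex_of_real x)) - L t) holomorphic_on ball (of_real s) (s - c)"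
      by (intro holomorphic_intros mgf_holomorphic_on_ball[OF M s int] Lh)
    show "complex_of_real s islimpt of_real ` {s..<s + (s - c)}"
      unfolding islimpt_approachable
    proof safe
      fix e :: real assume e: "e > 0"
      define d where "d = min (e / 2) ((s - c) / 2)"
      have d: "d > 0" "d < e" "d < s - c" using e s by (auto simp: d_def min_less_iff_disj)
      define u where "u = s + d"
      have "u \<noteq> s" "u \<in> {s..<s + (s - c)}" "dist (complex_of_real u) (of_real s) < e"
        using d by (auto simp: u_def dist_norm simp flip: of_real_diff)
      thus "\<exists>x'\<in>complex_of_real ` {s..<s + (s - c)}. x' \<noteq> complex_of_real s \<and> dist x' (complex_of_real s) < e"
        by (intro bexI[of _ "of_real u"]) auto
    qed
    fix z assume "z \<in> complex_of_real ` {s..<s + (s - c)}"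
    then obtain u where u: "z = of_real u" "u \<ge> s" by auto
    have uc: "u > c" using u(2) s by simp
    have "(LINT x|M. exp (z * complex_of_real x)) = of_real (LINT x|M. exp (u * x))"
      unfolding u(1) by (subst integral_complex_of_real[symmetric]) (simp add: exp_of_real flip: of_real_mult)
    thus "(LINT x|M. exp (z * complex_of_real x)) - L z = 0" using eq[OF uc] u by simp
  qed (use s tb in \<open>auto simp: dist_norm field_simps simp flip: of_real_diff\<close>)
  moreover have "integrable M (\<lambda>x. exp (t * of_real x))"
    by (rule Bochner_Integration.integrable_bound[OF int[OF t]]) auto
  ultimately show ?thesis by simp
qed


subsection \<open>Gamma laws and the limiting infinitely divisible law\<close>

text \<open>Unit-scale Gamma law, with the density in the shape of Euler's integral as used in
  \<open>Gamma_conv_nn_integral_real\<close>. A chi-square variable with \<open>m\<close> degrees of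
  freedom is twice a variable with law \<open>gamma_law (m / 2)\<close>.\<close>

definition gamma_law :: "real \<Rightarrow> real measure" where
  "gamma_law p = density lborel (\<lambda>x. ennreal (indicator {0..} x * x powr (p - 1) / exp x / Gamma p))"

lemma sets_gamma_law [measurable_cong, simp]: "sets (gamma_law p) = sets borel"
  by (simp add: gamma_law_def)

lemma space_gamma_law [simp]: "space (gamma_law p) = UNIV"
  by (simp add: gamma_law_def)

lemma nn_integral_gamma_law:
  assumes [measurable]: "f \<in> borel_measurable borel"
  shows "(\<integral>\<^sup>+x. f x \<partial>gamma_law p) =
    (\<integral>\<^sup>+x. ennreal (indicator {0..} x * x powr (p - 1) / exp x / Gamma p) * f x \<partial>lborel)"
  unfolding gamma_law_def by (subst nn_integral_density) auto

lemma nn_integral_gamma_law_exp: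
  assumes p: "p > 0" and z: "z > -1"
  shows "(\<integral>\<^sup>+x. ennreal (exp (- (z * x))) \<partial>gamma_law p) = ennreal ((1 + z) powr (- p))"
proof -
  have G: "Gamma p > 0" using p by simp
  define g where "g x = ennreal (indicator {0..} x * x powr (p - 1) / exp x)" for x :: real
  have [measurable]: "g \<in> borel_measurable borel" unfolding g_def by measurable
  have "ennreal (Gamma p) = (\<integral>\<^sup>+x. g x \<partial>lborel)"
    unfolding g_def using p by (simp add: Gamma_conv_nn_integral_real)
  also have "\<dots> = ennreal (1 + z) * (\<integral>\<^sup>+x. g (0 + (1 + z) * x) \<partial>lborel)"
    using z by (subst nn_integral_real_affine[where c = "1 + z" and t = 0]) auto
  also have "\<dots> = (\<integral>\<^sup>+x. ennreal (1 + z) * g ((1 + z) * x) \<partial>lborel)"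
    by (subst nn_integral_cmult) auto
  finally have *: "ennreal (Gamma p) = (\<integral>\<^sup>+x. ennreal (1 + z) * g ((1 + z) * x) \<partial>lborel)" .
  have "(\<integral>\<^sup>+x. ennreal (exp (- (z * x))) \<partial>gamma_law p) =
    (\<integral>\<^sup>+x. ennreal (indicator {0..} x * x powr (p - 1) / exp x / Gamma p) * ennreal (exp (- (z * x))) \<partial>lborel)"
    by (rule nn_integral_gamma_law) simp
  also have "\<dots> = (\<integral>\<^sup>+x. ennreal ((1 + z) powr (- p) / Gamma p) * (ennreal (1 + z) * g ((1 + z) * x)) \<partial>lborel)"
    unfolding g_def
  proof (intro nn_integral_cong)
    fix x :: real
    show "ennreal (indicator {0..} x * x powr (p - 1) / exp x / Gamma p) * ennreal (exp (- (z * x))) =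
      ennreal ((1 + z) powr (- p) / Gamma p) *
        (ennreal (1 + z) * ennreal (indicator {0..} ((1 + z) * x) * ((1 + z) * x) powr (p - 1) / exp ((1 + z) * x)))"
    proof (cases "x \<ge> 0")
      case True
      have e1: "((1 + z) * x) powr (p - 1) = (1 + z) powr (p - 1) * x powr (p - 1)"
        using True z by (intro powr_mult)
      have e2: "(1 + z) powr (p - 1) * (1 + z) * (1 + z) powr (- p) = 1"
      proof -
        have "(1 + z) powr (p - 1) * (1 + z) powr 1 * (1 + z) powr (- p) = (1 + z) powr ((p - 1) + 1 + (- p))"
          by (simp only: powr_add)
        thus ?thesis using z by simp
      qed
      have e3: "exp (- (z * x)) / exp x = 1 / exp ((1 + z) * x)"
        by (simp add: exp_minus exp_add algebra_simps divide_inverse)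
      have "indicator {0..} x * x powr (p - 1) / exp x / Gamma p * exp (- (z * x)) =
          x powr (p - 1) / Gamma p * (exp (- (z * x)) / exp x)" using True by simp
      also have "\<dots> = ((1 + z) powr (p - 1) * (1 + z) * (1 + z) powr (- p)) * (x powr (p - 1) / Gamma p * (1 / exp ((1 + z) * x)))"
        unfolding e2 e3 by simp
      also have "\<dots> = (1 + z) powr (- p) / Gamma p * ((1 + z) * (indicator {0..} ((1 + z) * x) * ((1 + z) * x) powr (p - 1) / exp ((1 + z) * x)))"
        unfolding e1 using True z by (simp add: mult_ac)
      finally show ?thesis using z G by (simp add: ennreal_mult'[symmetric] ennreal_mult''[symmetric])
    next
      case False
      hence "(1 + z) * x < 0" using z by (simp add: mult_pos_neg)
      thus ?thesis using False by simp
    qed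
  qed
  also have "\<dots> = ennreal ((1 + z) powr (- p) / Gamma p) * ennreal (Gamma p)"
    unfolding * by (subst nn_integral_cmult) (auto simp: g_def)
  also have "\<dots> = ennreal ((1 + z) powr (- p))"
    using G by (simp add: ennreal_mult'[symmetric])
  finally show ?thesis .
qed

lemma prob_space_gamma_law:
  assumes "p > 0" shows "prob_space (gamma_law p)"
proof
  have "emeasure (gamma_law p) (space (gamma_law p)) = (\<integral>\<^sup>+x. ennreal (exp (- (0 * x))) \<partial>gamma_law p)"
    by simp
  also have "\<dots> = 1" using assms by (subst nn_integral_gamma_law_exp) auto
  finally show "emeasure (gamma_law p) (space (gamma_law p)) = 1" .
qed

text \<open>The kernel \<open>g\<close> decreases on [1, \<infinity>) and has the antiderivative
  \<open>G\<close>, which tends to \<open>- t\<close> at infinity. Monotonicity squeezes the sum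
  between the integral and the integral plus the mesh times the total variation. Mesh 1 / (N + 1)
  and cutoff N + 1 are tied together, so that a single limit handles both.\<close>

lemma Riemann_sum_log_kernel:
  fixes t :: real
  assumes t: "t > -1"
  shows "(\<lambda>N. \<Sum>k = Suc N..<(Suc N)\<^sup>2. (t / (real k / Suc N) - ln (1 + t / (real k / Suc N))) / Suc N)
     \<longlonglongrightarrow> (1 + t) * ln (1 + t) - t"
proof -
  define g where "g u = t / u - ln (1 + t / u)" for u :: real
  define G where "G u = - ((u + t) * ln (1 + t / u))" for u :: real
  have pos: "1 + t / u > 0" "u + t > 0" if "u \<ge> 1" for u
    using that t by (auto simp: field_simps)
  have dG: "(G has_real_derivative g u) (at u)" if u: "u \<ge> 1" for u
  proof -
    have "(G has_real_derivative - (ln (1 + t / u) + (u + t) * ((- t / u\<^sup>2) / (1 + t / u)))) (at u)"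
      unfolding G_def using u pos[OF u] by (auto intro!: derivative_eq_intros simp: power2_eq_square mult_ac)
    moreover have "(u + t) * ((- t / u\<^sup>2) / (1 + t / u)) = - t / u"
    proof -
      have eq: "1 + t / u = (u + t) / u" using u by (simp add: field_simps)
      show ?thesis unfolding eq using u pos(2)[OF u] by (simp add: power2_eq_square)
    qed
    ultimately show ?thesis by (simp add: g_def)
  qed
  have dg: "(g has_real_derivative - (t\<^sup>2 / (u\<^sup>2 * (u + t)))) (at u)" if u: "u \<ge> 1" for u
  proof -
    have "(g has_real_derivative (- t / u\<^sup>2) - (- t / u\<^sup>2) / (1 + t / u)) (at u)"
      unfolding g_def using u pos[OF u] by (auto intro!: derivative_eq_intros simp: power2_eq_square)
    moreover have "(- t / u\<^sup>2) - (- t / u\<^sup>2) / (1 + t / u) = - (t\<^sup>2 / (u\<^sup>2 * (u + t)))"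
      using u pos[OF u] by (simp add: divide_simps power2_eq_square) (simp add: algebra_simps)
    ultimately show ?thesis by simp
  qed
  have anti: "g v \<le> g u" if "1 \<le> u" "u \<le> v" for u v
  proof (rule DERIV_nonpos_imp_nonincreasing[OF that(2)])
    fix x assume "u \<le> x" "x \<le> v"
    hence "1 \<le> x" using that by simp
    thus "\<exists>y. (g has_real_derivative y) (at x) \<and> y \<le> 0"
      using dg pos(2)[of x] by (intro exI[of _ "- (t\<^sup>2 / (x\<^sup>2 * (x + t)))"]) auto
  qed
  have step: "g v * (v - u) \<le> G v - G u \<and> G v - G u \<le> g u * (v - u)" if "1 \<le> u" "u < v" for u v
  proof -
    have "\<exists>z. u < z \<and> z < v \<and> G v - G u = (v - u) * g z"
      using that by (intro MVT2) (auto intro: dG)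
    then obtain z where z: "u < z" "z < v" "G v - G u = (v - u) * g z" by blast
    show ?thesis unfolding z(3) using anti[of u z] anti[of z v] z that by (auto simp: mult.commute)
  qed
  define S where "S N = (\<Sum>k = Suc N..<(Suc N)\<^sup>2. g (real k / Suc N) / Suc N)" for N
  have bounds: "G (Suc N) - G 1 \<le> S N \<and> S N \<le> G (Suc N) - G 1 + (g 1 - g (Suc N)) / Suc N" for N
  proof -
    define n where "n = Suc N"
    have n: "n > 0" "n \<le> n\<^sup>2" by (auto simp: n_def power2_eq_square)
    have st: "g (real (Suc k) / n) / n \<le> G (real (Suc k) / n) - G (real k / n) \<and>
       G (real (Suc k) / n) - G (real k / n) \<le> g (real k / n) / n" if "k \<ge> n" for k
    proof -
      have "real (Suc k) / n - real k / n = 1 / n" using n by (simp add: field_simps)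
      thus ?thesis using step[of "real k / n" "real (Suc k) / n"] that n by (simp add: field_simps)
    qed
    have tel: "(\<Sum>k = n..<n\<^sup>2. f (Suc k) - f k) = f (n\<^sup>2) - f n" for f :: "nat \<Rightarrow> real"
      using n by (intro sum_Suc_diff') 
    have e: "real (n\<^sup>2) / n = n" "real n / n = 1" using n by (auto simp: power2_eq_square)
    have "G n - G 1 = (\<Sum>k = n..<n\<^sup>2. G (real (Suc k) / n) - G (real k / n))"
      using tel[of "\<lambda>k. G (real k / n)"] e by simp
    also have "\<dots> \<le> (\<Sum>k = n..<n\<^sup>2. g (real k / n) / n)"
      by (intro sum_mono) (use st in auto)
    finally have 1: "G n - G 1 \<le> (\<Sum>k = n..<n\<^sup>2. g (real k / n) / n)" .
    have "(\<Sum>k = n..<n\<^sup>2. g (real k / n) / n) = (\<Sum>k = n..<n\<^sup>2. g (real (Suc k) / n) / n)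
        - (\<Sum>k = n..<n\<^sup>2. g (real (Suc k) / n) / n - g (real k / n) / n)"
      by (simp add: sum_subtractf)
    also have "(\<Sum>k = n..<n\<^sup>2. g (real (Suc k) / n) / n - g (real k / n) / n) = g n / n - g 1 / n"
      using tel[of "\<lambda>k. g (real k / n) / n"] e by simp
    also have "(\<Sum>k = n..<n\<^sup>2. g (real (Suc k) / n) / n) \<le> (\<Sum>k = n..<n\<^sup>2. G (real (Suc k) / n) - G (real k / n))"
      by (intro sum_mono) (use st in auto)
    also have "\<dots> = G n - G 1" using tel[of "\<lambda>k. G (real k / n)"] e by simp
    finally have 2: "(\<Sum>k = n..<n\<^sup>2. g (real k / n) / n) \<le> G n - G 1 + (g 1 - g n) / n"
      by (simp add: diff_divide_distrib)
    show ?thesis using 1 2 unfolding S_def n_def by simp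
  qed
  have "(\<lambda>N. G (real (Suc N)) - G 1) \<longlonglongrightarrow> - t - G 1"
    unfolding G_def by real_asymp
  moreover have "(\<lambda>N. G (real (Suc N)) - G 1 + (g 1 - g (real (Suc N))) / real (Suc N)) \<longlonglongrightarrow> - t - G 1"
    unfolding G_def g_def by real_asymp
  ultimately have "S \<longlonglongrightarrow> - t - G 1"
    by (rule tendsto_sandwich[rotated 2]) (use bounds in \<open>auto intro!: always_eventually\<close>)
  thus ?thesis unfolding S_def g_def G_def by (simp add: algebra_simps)
qed

text \<open>With \<open>c = 1\<close> this is the exponentially tilted and centred version of the
  totally skewed 1-stable law whose cumulant function is t * ln t. The free factor \<open>c\<close>
  provides all convolution roots within one family.\<close>

lemma exists_stable_type_law:
  fixes c :: real
  assumes c: "c > 0"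
  obtains \<phi> where "real_distribution \<phi>"
    "\<And>t::complex. Re t > -1 \<Longrightarrow> integrable \<phi> (\<lambda>x. exp (t * of_real x)) \<and>
      (LINT x|\<phi>. exp (t * of_real x)) = exp (of_real c * ((1 + t) * Ln (1 + t) - t))"
proof -
  define I where "I N = {Suc N..<(Suc N)\<^sup>2}" for N
  define p where "p N = c / Suc N" for N
  define u where "u N k = real k / Suc N" for N k
  define P where "P N = PiM (I N) (\<lambda>k. gamma_law (p N))" for N
  \<comment> \<open>A centred Gamma variable of shape \<open>p N\<close>, divided by
    \<open>u N k\<close> and reflected, has cumulant function
    \<open>p N * (t / u - ln (1 + t / u))\<close> at u = \<open>u N k\<close>. The shape
    \<open>c / Suc N\<close> is \<open>c\<close> times the mesh, so the sum has \<open>c\<close>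
    times the Riemann sum as its cumulant function.\<close>
  define Z where "Z N x = (\<Sum>k\<in>I N. p N / u N k - x k / u N k)" for N and x :: "nat \<Rightarrow> real"
  define \<mu> where "\<mu> N = distr (P N) borel (Z N)" for N
  have p: "p N > 0" for N using c by (simp add: p_def)
  have u: "u N k \<ge> 1" if "k \<in> I N" for N k using that by (simp add: u_def I_def)
  have fin: "finite (I N)" for N by (simp add: I_def)
  have Zm [measurable]: "Z N \<in> borel_measurable (P N)" for N
    unfolding Z_def P_def using fin by measurable
  interpret g: prob_space "gamma_law (p N)" for N by (rule prob_space_gamma_law[OF p])
  interpret ps: product_prob_space "\<lambda>k. gamma_law (p N)" for N by standard
  have P: "prob_space (P N)" for N unfolding P_def by (intro prob_space_PiM g.prob_space_axioms)
  have \<mu>: "real_distribution (\<mu> N)" for N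
    unfolding \<mu>_def by (intro real_distribution.intro prob_space.prob_space_distr P real_distribution_axioms.intro) auto
  define m where "m N t = exp (c * (\<Sum>k\<in>I N. (t / u N k - ln (1 + t / u N k)) / Suc N))" for N t
  have nn: "(\<integral>\<^sup>+x. ennreal (exp (t * x)) \<partial>\<mu> N) = ennreal (m N t)" if t: "t > -1" for N t
  proof -
    have z: "t / u N k > - 1" if "k \<in> I N" for k
      using u[OF that] t by (simp add: field_simps)
    have "(\<integral>\<^sup>+x. ennreal (exp (t * x)) \<partial>\<mu> N) = (\<integral>\<^sup>+x. ennreal (exp (t * Z N x)) \<partial>P N)"
      unfolding \<mu>_def by (subst nn_integral_distr) auto
    also have "\<dots> = (\<integral>\<^sup>+x. (\<Prod>k\<in>I N. ennreal (exp (t * (p N / u N k)) * exp (- (t / u N k * x k)))) \<partial>P N)"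
      unfolding Z_def sum_distrib_left exp_sum[OF fin]
      by (subst prod_ennreal) (auto intro!: nn_integral_cong prod.cong arg_cong[where f = ennreal] simp: exp_add[symmetric] algebra_simps)
    also have "\<dots> = (\<Prod>k\<in>I N. \<integral>\<^sup>+x. ennreal (exp (t * (p N / u N k)) * exp (- (t / u N k * x))) \<partial>gamma_law (p N))"
      unfolding P_def by (subst ps.product_nn_integral_prod[OF fin]) auto
    also have "\<dots> = (\<Prod>k\<in>I N. ennreal (exp (t * (p N / u N k)) * (1 + t / u N k) powr (- p N)))"
    proof (intro prod.cong refl)
      fix k assume k: "k \<in> I N"
      show "(\<integral>\<^sup>+x. ennreal (exp (t * (p N / u N k)) * exp (- (t / u N k * x))) \<partial>gamma_law (p N)) =
         ennreal (exp (t * (p N / u N k)) * (1 + t / u N k) powr (- p N))"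
        using nn_integral_gamma_law_exp[OF p z[OF k]]
        by (simp add: ennreal_mult nn_integral_cmult)
    qed
    also have "\<dots> = ennreal (\<Prod>k\<in>I N. exp (t * (p N / u N k)) * (1 + t / u N k) powr (- p N))"
      by (rule prod_ennreal) auto
    also have "(\<Prod>k\<in>I N. exp (t * (p N / u N k)) * (1 + t / u N k) powr (- p N)) = m N t"
      unfolding m_def sum_distrib_left exp_sum[OF fin]
    proof (intro prod.cong refl)
      fix k assume k: "k \<in> I N"
      have pw: "(1 + t / u N k) powr (- p N) = exp (- p N * ln (1 + t / u N k))"
        using z[OF k] by (simp add: powr_def)
      show "exp (t * (p N / u N k)) * (1 + t / u N k) powr (- p N) = exp (c * ((t / u N k - ln (1 + t / u N k)) / Suc N))"
      proof -
        have "exp (t * (p N / u N k)) * exp (- p N * ln (1 + t / u N k)) = exp (p N * (t / u N k - ln (1 + t / u N k)))"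
          by (simp add: exp_add[symmetric] algebra_simps)
        moreover have "p N * y = c * (y / Suc N)" for y by (simp add: p_def)
        ultimately show ?thesis using pw by simp
      qed
    qed
    finally show ?thesis .
  qed
  have im: "integrable (\<mu> N) (\<lambda>x. exp (t * x)) \<and> (LINT x|\<mu> N. exp (t * x)) = m N t" if t: "t > -1" for N t
  proof -
    have "m N t \<ge> 0" by (simp add: m_def)
    thus ?thesis
      using nn[OF t, of N] by (subst (asm) nn_integral_eq_integrable) (auto simp: \<mu>_def)
  qed
  define L where "L t = exp (c * ((1 + t) * ln (1 + t) - t))" for t :: real
  have lim: "(\<lambda>N. LINT x|\<mu> N. exp (t * x)) \<longlonglongrightarrow> L t" if t: "t > -1" for t
    using tendsto_exp[OF tendsto_mult[OF tendsto_const[of c] Riemann_sum_log_kernel[OF t]]] im[OF t]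
    unfolding L_def m_def I_def u_def by simp
  obtain \<phi> where \<phi>: "real_distribution \<phi>"
    "\<And>t. t > -1 \<Longrightarrow> integrable \<phi> (\<lambda>x. exp (t * x)) \<and> (LINT x|\<phi>. exp (t * x)) = L t"
    by (rule mgf_convergence_imp_limit_law[of "-1" \<mu> L]) (use \<mu> im lim in auto)
  show thesis
  proof (rule that[OF \<phi>(1)])
    fix t :: complex assume t: "Re t > -1"
    show "integrable \<phi> (\<lambda>x. exp (t * of_real x)) \<and>
      (LINT x|\<phi>. exp (t * of_real x)) = exp (of_real c * ((1 + t) * Ln (1 + t) - t))"
    proof (rule mgf_eq_holomorphic[where c = "-1"])
      show "(\<lambda>t. exp (complex_of_real c * ((1 + t) * Ln (1 + t) - t))) holomorphic_on {t. - 1 < Re t}"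
        by (intro holomorphic_intros) (auto simp: complex_nonpos_Reals_iff)
      fix t :: real assume t: "t > -1"
      have "Ln (1 + complex_of_real t) = of_real (ln (1 + t))"
        using t Ln_of_real[of "1 + t"] by simp
      thus "complex_of_real (LINT x|\<phi>. exp (t * x)) = exp (complex_of_real c * ((1 + complex_of_real t) * Ln (1 + complex_of_real t) - complex_of_real t))"
        using \<phi>(2)[OF t] by (simp add: L_def exp_of_real[symmetric])
    qed (use \<phi> t in auto)
  qed
qed

text \<open>The cumulant function is linear in the factor \<open>c\<close> of
  \<open>exists_stable_type_law\<close>, so the \<open>m\<close>-fold convolution of the law with
  factor \<open>1 / (2 * m)\<close> is the law with factor \<open>1 / 2\<close>.\<close>

lemma exists_infinitely_divisible_stable_type_law:
  "\<exists>\<phi>. infinitely_divisible \<phi> \<and> (\<forall>t::complex. Re t > -1 \<longrightarrow>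
     integrable \<phi> (\<lambda>x. exp (t * of_real x)) \<and>
     (LINT x|\<phi>. exp (t * of_real x)) = exp (1 / 2 * ((t + 1) * Ln (t + 1) - t)))"
proof -
  obtain \<phi> where \<phi>: "real_distribution \<phi>"
    "\<And>t::complex. Re t > -1 \<Longrightarrow> integrable \<phi> (\<lambda>x. exp (t * of_real x)) \<and>
      (LINT x|\<phi>. exp (t * of_real x)) = exp (of_real (1/2) * ((1 + t) * Ln (1 + t) - t))"
    using exists_stable_type_law[of "1/2"] by auto
  have "infinitely_divisible \<phi>"
    unfolding infinitely_divisible_def
  proof (intro conjI \<phi>(1) allI impI)
    fix m :: nat assume m: "m \<ge> 1"
    obtain \<nu> where \<nu>: "real_distribution \<nu>"
      "\<And>t::complex. Re t > -1 \<Longrightarrow> integrable \<nu> (\<lambda>x. exp (t * of_real x)) \<and>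
        (LINT x|\<nu>. exp (t * of_real x)) = exp (of_real (1 / (2 * m)) * ((1 + t) * Ln (1 + t) - t))"
      using exists_stable_type_law[of "1 / (2 * m)"] m by auto
    interpret \<nu>: real_distribution \<nu> by fact
    interpret ps: product_prob_space "\<lambda>k. \<nu>" "{..<m}" by standard
    define P where "P = PiM {..<m} (\<lambda>_. \<nu>)"
    define Q where "Q = distr P borel (\<lambda>x. \<Sum>i<m. x i)"
    have [measurable]: "(\<lambda>x. \<Sum>i<m. x i) \<in> borel_measurable P" unfolding P_def by measurable
    have "prob_space P" unfolding P_def by (intro prob_space_PiM \<nu>.prob_space_axioms)
    hence Q: "real_distribution Q"
      unfolding Q_def by (intro real_distribution.intro prob_space.prob_space_distr real_distribution_axioms.intro) auto
    \<comment> \<open>The imaginary axis lies in the half plane \<open>Re t > -1\<close>, so the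
      known formulas give the characteristic functions.\<close>
    have "char \<phi> = char Q"
    proof
      fix s :: real
      let ?t = "\<i> * complex_of_real s"
      have "char Q s = (LINT x|P. exp (?t * of_real (\<Sum>i<m. x i)))"
        unfolding char_def Q_def by (subst integral_distr) (auto simp: mult_ac)
      also have "\<dots> = (LINT x|P. (\<Prod>i<m. exp (?t * of_real (x i))))"
        by (simp add: sum_distrib_left exp_sum)
      also have "\<dots> = (\<Prod>i<m. LINT x|\<nu>. exp (?t * of_real x))"
        unfolding P_def using \<nu>(2)[of ?t] by (intro ps.product_integral_prod) auto
      also have "\<dots> = exp (of_nat m * (of_real (1 / (2 * m)) * ((1 + ?t) * Ln (1 + ?t) - ?t)))"
        unfolding exp_of_nat_mult using \<nu>(2)[of ?t] by (simp only: prod_constant card_lessThan) simp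
      also have "of_nat m * (of_real (1 / (2 * m)) * ((1 + ?t) * Ln (1 + ?t) - ?t)) = of_real (1/2) * ((1 + ?t) * Ln (1 + ?t) - ?t)"
        using m by simp
      also have "exp \<dots> = (LINT x|\<phi>. exp (?t * of_real x))" using \<phi>(2)[of ?t] by simp
      also have "\<dots> = char \<phi> s" unfolding char_def by (simp add: mult_ac)
      finally show "char \<phi> s = char Q s" ..
    qed
    hence "\<phi> = Q" by (rule Levy_uniqueness[OF \<phi>(1) Q])
    thus "\<exists>\<nu>. real_distribution \<nu> \<and> \<phi> = distr (Pi\<^sub>M {..<m} (\<lambda>_. \<nu>)) borel (\<lambda>x. \<Sum>i<m. x i)"
      using \<nu>(1) unfolding Q_def P_def by blast
  qed
  thus ?thesis using \<phi>(2) by (intro exI[of _ \<phi>]) (auto simp: add.commute)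
qed


subsection \<open>Rotation invariance of Gaussian vectors\<close>

text \<open>For \<open>c \<noteq> 0\<close> the rotation is carried out by two one-variable affine
  substitutions with Fubini in between; their Jacobian factors \<open>1 / c\<close> and
  \<open>c\<close> cancel. For \<open>c = 0\<close> it exchanges the coordinates up to sign.\<close>

lemma lborel_rotation:
  fixes g :: "real \<times> real \<Rightarrow> ennreal"
  assumes [measurable]: "g \<in> borel_measurable (borel \<Otimes>\<^sub>M borel)" and cs: "c\<^sup>2 + s\<^sup>2 = (1::real)"
  shows "(\<integral>\<^sup>+y. \<integral>\<^sup>+z. g (c * z + s * y, c * y - s * z) \<partial>lborel \<partial>lborel) = (\<integral>\<^sup>+y. \<integral>\<^sup>+z. g (z, y) \<partial>lborel \<partial>lborel)"
proof (cases "c = 0")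
  case True
  hence s: "\<bar>s\<bar> = 1" "s \<noteq> 0" using cs by (auto simp: power2_eq_1_iff)
  have 1: "(\<integral>\<^sup>+z. g (s * y, - (s * z)) \<partial>lborel) = (\<integral>\<^sup>+v. g (s * y, v) \<partial>lborel)" for y
  proof -
    have "(\<integral>\<^sup>+v. g (s * y, v) \<partial>lborel) = ennreal \<bar>- s\<bar> * (\<integral>\<^sup>+z. g (s * y, 0 + (- s) * z) \<partial>lborel)"
      by (rule nn_integral_real_affine) (use s(2) in simp_all)
    thus ?thesis using s(1) by simp
  qed
  have 2: "(\<integral>\<^sup>+y. g (s * y, v) \<partial>lborel) = (\<integral>\<^sup>+u. g (u, v) \<partial>lborel)" for v
  proof -
    have "(\<integral>\<^sup>+u. g (u, v) \<partial>lborel) = ennreal \<bar>s\<bar> * (\<integral>\<^sup>+y. g (0 + s * y, v) \<partial>lborel)"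
      by (rule nn_integral_real_affine) (use s(2) in simp_all)
    thus ?thesis using s(1) by simp
  qed
  have "(\<integral>\<^sup>+y. \<integral>\<^sup>+z. g (c * z + s * y, c * y - s * z) \<partial>lborel \<partial>lborel) = (\<integral>\<^sup>+y. \<integral>\<^sup>+v. g (s * y, v) \<partial>lborel \<partial>lborel)"
    using True 1 by simp
  also have "\<dots> = (\<integral>\<^sup>+v. \<integral>\<^sup>+y. g (s * y, v) \<partial>lborel \<partial>lborel)"
    by (rule lborel_pair.Fubini') simp
  finally show ?thesis unfolding 2 .
next
  case False
  have 1: "(\<integral>\<^sup>+z. g (c * z + s * y, c * y - s * z) \<partial>lborel) = ennreal \<bar>1 / c\<bar> * (\<integral>\<^sup>+u. g (u, (y - s * u) / c) \<partial>lborel)" for y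
  proof -
    have e: "c * y - s * (- (s * y / c) + 1 / c * u) = (y - s * u) / c" for u
    proof -
      have "c * y - s * (- (s * y / c) + 1 / c * u) = ((c\<^sup>2 + s\<^sup>2) * y - s * u) / c"
        using False by (simp add: field_simps power2_eq_square)
      thus ?thesis unfolding cs by simp
    qed
    have e2: "c * (- (s * y / c) + 1 / c * u) + s * y = u" for u
      using False by (simp add: field_simps)
    show ?thesis
      using nn_integral_real_affine[of "\<lambda>z. g (c * z + s * y, c * y - s * z)" "1 / c" "- (s * y / c)"] False
      unfolding e e2 by simp
  qed
  have 2: "ennreal \<bar>1 / c\<bar> * (\<integral>\<^sup>+y. g (u, (y - s * u) / c) \<partial>lborel) = (\<integral>\<^sup>+v. g (u, v) \<partial>lborel)" for u
  proof -
    have e: "- (s * u / c) + 1 / c * y = (y - s * u) / c" for y by (simp add: diff_divide_distrib)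
    show ?thesis
      using False nn_integral_real_affine[of "\<lambda>v. g (u, v)" "1 / c" "- (s * u / c)"] unfolding e by simp
  qed
  have "(\<integral>\<^sup>+y. \<integral>\<^sup>+z. g (c * z + s * y, c * y - s * z) \<partial>lborel \<partial>lborel) =
      ennreal \<bar>1 / c\<bar> * (\<integral>\<^sup>+y. \<integral>\<^sup>+u. g (u, (y - s * u) / c) \<partial>lborel \<partial>lborel)"
    unfolding 1 by (rule nn_integral_cmult) simp
  also have "(\<integral>\<^sup>+y. \<integral>\<^sup>+u. g (u, (y - s * u) / c) \<partial>lborel \<partial>lborel) = (\<integral>\<^sup>+u. \<integral>\<^sup>+y. g (u, (y - s * u) / c) \<partial>lborel \<partial>lborel)"
    by (rule lborel_pair.Fubini') simp
  also have "ennreal \<bar>1 / c\<bar> * \<dots> = (\<integral>\<^sup>+u. \<integral>\<^sup>+v. g (u, v) \<partial>lborel \<partial>lborel)"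
    unfolding 2[symmetric] by (rule nn_integral_cmult[symmetric]) simp
  also have "\<dots> = (\<integral>\<^sup>+y. \<integral>\<^sup>+z. g (z, y) \<partial>lborel \<partial>lborel)"
    by (rule lborel_pair.Fubini') simp
  finally show ?thesis .
qed

lemma sets_std_normal [simp, measurable_cong]: "sets std_normal_distribution = sets borel"
  by simp

lemma nn_integral_std_normal:
  assumes [measurable]: "f \<in> borel_measurable borel"
  shows "(\<integral>\<^sup>+x. f x \<partial>std_normal_distribution) = (\<integral>\<^sup>+x. ennreal (std_normal_density x) * f x \<partial>lborel)"
  by (rule nn_integral_density) simp_all

lemma std_normal_density_rotation:
  assumes "c\<^sup>2 + s\<^sup>2 = (1::real)"
  shows "std_normal_density (c * z + s * y) * std_normal_density (c * y - s * z) = std_normal_density z * std_normal_density y"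
proof -
  have "(c * z + s * y)\<^sup>2 + (c * y - s * z)\<^sup>2 = (c\<^sup>2 + s\<^sup>2) * (z\<^sup>2 + y\<^sup>2)"
    by (simp add: power2_eq_square algebra_simps)
  hence "- ((c * z + s * y)\<^sup>2) / 2 + - ((c * y - s * z)\<^sup>2) / 2 = - z\<^sup>2 / 2 + - y\<^sup>2 / 2" using assms by simp
  thus ?thesis unfolding normal_density_def by (simp add: exp_add[symmetric])
qed

lemma std_normal_rotation:
  fixes f :: "real \<times> real \<Rightarrow> ennreal"
  assumes [measurable]: "f \<in> borel_measurable (borel \<Otimes>\<^sub>M borel)" and cs: "c\<^sup>2 + s\<^sup>2 = (1::real)"
  shows "(\<integral>\<^sup>+y. \<integral>\<^sup>+z. f (c * z + s * y, c * y - s * z) \<partial>std_normal_distribution \<partial>std_normal_distribution)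
     = (\<integral>\<^sup>+y. \<integral>\<^sup>+z. f (z, y) \<partial>std_normal_distribution \<partial>std_normal_distribution)"
proof -
  have E: "(\<integral>\<^sup>+y. \<integral>\<^sup>+z. F z y \<partial>std_normal_distribution \<partial>std_normal_distribution) =
     (\<integral>\<^sup>+y. \<integral>\<^sup>+z. ennreal (std_normal_density z * std_normal_density y) * F z y \<partial>lborel \<partial>lborel)"
    if [measurable]: "(\<lambda>(z, y). F z y) \<in> borel_measurable (borel \<Otimes>\<^sub>M borel)" for F :: "real \<Rightarrow> real \<Rightarrow> ennreal"
  proof -
    have "(\<integral>\<^sup>+y. \<integral>\<^sup>+z. F z y \<partial>std_normal_distribution \<partial>std_normal_distribution) =
       (\<integral>\<^sup>+y. ennreal (std_normal_density y) * (\<integral>\<^sup>+z. ennreal (std_normal_density z) * F z y \<partial>lborel) \<partial>lborel)"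
      by (subst (1 2) nn_integral_std_normal) simp_all
    thus ?thesis
      by (subst (asm) nn_integral_cmult[symmetric]) (simp_all add: ennreal_mult mult_ac)
  qed
  define g where "g = (\<lambda>(z, y). ennreal (std_normal_density z * std_normal_density y) * f (z, y))"
  have [measurable]: "g \<in> borel_measurable (borel \<Otimes>\<^sub>M borel)" unfolding g_def by measurable
  have "(\<integral>\<^sup>+y. \<integral>\<^sup>+z. f (c * z + s * y, c * y - s * z) \<partial>std_normal_distribution \<partial>std_normal_distribution) =
     (\<integral>\<^sup>+y. \<integral>\<^sup>+z. g (c * z + s * y, c * y - s * z) \<partial>lborel \<partial>lborel)"
    by (subst E) (simp_all add: g_def std_normal_density_rotation[OF cs])
  also have "\<dots> = (\<integral>\<^sup>+y. \<integral>\<^sup>+z. g (z, y) \<partial>lborel \<partial>lborel)"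
    by (rule lborel_rotation[OF _ cs]) simp
  also have "\<dots> = (\<integral>\<^sup>+y. \<integral>\<^sup>+z. f (z, y) \<partial>std_normal_distribution \<partial>std_normal_distribution)"
    by (subst E) (simp_all add: g_def)
  finally show ?thesis .
qed

text \<open>Like \<open>std_gaussian\<close>, but over any index set: it serves for the coordinates
  of one point as well as for one coordinate of all vertices.\<close>

definition gauss :: "'k set \<Rightarrow> ('k \<Rightarrow> real) measure" where
  "gauss K = PiM K (\<lambda>_. std_normal_distribution)"

lemma prob_space_std_normal: "prob_space std_normal_distribution"
  by (rule prob_space_normal_density) simp

interpretation std_normal: prob_space std_normal_distribution
  by (rule prob_space_std_normal)

interpretation std_normal_PiM: product_prob_space "\<lambda>_. std_normal_distribution" K for K
  by standard

lemma prob_space_gauss: "prob_space (gauss K)"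
  unfolding gauss_def by (rule prob_space_PiM) (rule prob_space_std_normal)

lemma sets_gauss [measurable_cong]: "sets (gauss K) = sets (PiM K (\<lambda>_. borel))"
  unfolding gauss_def by (intro sets_PiM_cong) auto

lemma space_gauss: "space (gauss K) = extensional K"
  unfolding gauss_def by (auto simp: space_PiM PiE_def extensional_def)

lemma measurable_gauss_component: "k \<in> K \<Longrightarrow> (\<lambda>x. x k) \<in> borel_measurable (gauss K)"
  using measurable_component_singleton[of k K "\<lambda>_. borel"] by (simp cong: measurable_cong_sets add: sets_gauss)

lemma measure_eqI_nn_integral_distr:
  assumes [measurable]: "G \<in> M \<rightarrow>\<^sub>M N"
    and eq: "\<And>A. A \<in> sets N \<Longrightarrow> (\<integral>\<^sup>+x. indicator A (G x) \<partial>M) = emeasure N A"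
  shows "distr M N G = N"
proof (rule measure_eqI)
  fix A assume "A \<in> sets (distr M N G)"
  hence A [measurable]: "A \<in> sets N" by simp
  have "emeasure (distr M N G) A = (\<integral>\<^sup>+x. indicator A x \<partial>distr M N G)" by simp
  also have "\<dots> = (\<integral>\<^sup>+x. indicator A (G x) \<partial>M)" by (rule nn_integral_distr) simp_all
  finally show "emeasure (distr M N G) A = emeasure N A" using eq[OF A] by simp
qed simp

lemma measurable_gauss_fun_upd:
  assumes "f \<in> M \<rightarrow>\<^sub>M gauss K" "h \<in> borel_measurable M" "i \<in> K"
  shows "(\<lambda>x. (f x)(i := h x)) \<in> M \<rightarrow>\<^sub>M gauss K"
  using measurable_fun_upd[of K K i f M "\<lambda>_. borel" h] assms
  by (simp add: insert_absorb cong: measurable_cong_sets add: sets_gauss)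

text \<open>Fubini makes the coordinates \<open>a\<close> and \<open>b\<close> the innermost two,
  where the planar rotation invariance of the Gaussian density applies.\<close>

lemma distr_gauss_Givens:
  fixes c s :: real
  assumes K: "finite K" "a \<in> K" "b \<in> K" "a \<noteq> b" and cs: "c\<^sup>2 + s\<^sup>2 = 1"
  shows "distr (gauss K) (gauss K) (\<lambda>x. x(a := c * x a + s * x b, b := c * x b - s * x a)) = gauss K"
proof (rule measure_eqI_nn_integral_distr)
  let ?G = "\<lambda>x. x(a := c * x a + s * x b, b := c * x b - s * x a)"
  show G: "?G \<in> gauss K \<rightarrow>\<^sub>M gauss K"
    by (intro measurable_gauss_fun_upd measurable_ident K borel_measurable_add borel_measurable_diff borel_measurable_times measurable_gauss_component measurable_const)
       (auto simp: measurable_ident)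
  fix A assume A: "A \<in> sets (gauss K)"
  define K' where "K' = K - {a, b}"
  have K': "finite K'" "b \<notin> K'" "finite (insert b K')" "a \<notin> insert b K'" "K = insert a (insert b K')"
    using K by (auto simp: K'_def)
  have split: "(\<integral>\<^sup>+x. F x \<partial>gauss K) = (\<integral>\<^sup>+x. \<integral>\<^sup>+y. \<integral>\<^sup>+z. F (x(b := y, a := z)) \<partial>std_normal_distribution \<partial>std_normal_distribution \<partial>gauss K')"
    if F: "F \<in> borel_measurable (gauss K)" for F
  proof -
    have F1: "F \<in> borel_measurable (PiM (insert a (insert b K')) (\<lambda>_. std_normal_distribution))"
      using F K'(5) unfolding gauss_def by simp
    have F2: "(\<lambda>w. \<integral>\<^sup>+z. F (w(a := z)) \<partial>std_normal_distribution) \<in> borel_measurable (PiM (insert b K') (\<lambda>_. std_normal_distribution))"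
    proof (rule std_normal.borel_measurable_nn_integral)
      have "(\<lambda>(w, z). w(a := z)) \<in> PiM (insert b K') (\<lambda>_. std_normal_distribution) \<Otimes>\<^sub>M std_normal_distribution \<rightarrow>\<^sub>M
           PiM (insert a (insert b K')) (\<lambda>_. std_normal_distribution)"
        by (rule measurable_add_dim)
      from measurable_compose[OF this F1]
      show "(\<lambda>(w, z). F (w(a := z))) \<in> borel_measurable (PiM (insert b K') (\<lambda>_. std_normal_distribution) \<Otimes>\<^sub>M std_normal_distribution)"
        by (simp add: case_prod_unfold)
    qed
    show ?thesis
      unfolding gauss_def K'(5)
      by (subst std_normal_PiM.product_nn_integral_insert[OF K'(3,4) F1],
          subst std_normal_PiM.product_nn_integral_insert[OF K'(1,2) F2]) simp
  qed
  have Am: "indicator A \<in> borel_measurable (gauss K)" using A by simp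
  have AGm: "(\<lambda>x. indicator A (?G x)) \<in> borel_measurable (gauss K)"
    using measurable_compose[OF G Am] .
  have "(\<integral>\<^sup>+x. indicator A (?G x) \<partial>gauss K) = (\<integral>\<^sup>+x. \<integral>\<^sup>+y. \<integral>\<^sup>+z. indicator A (?G (x(b := y, a := z))) \<partial>std_normal_distribution \<partial>std_normal_distribution \<partial>gauss K')"
    by (rule split[OF AGm])
  also have "\<dots> = (\<integral>\<^sup>+x. \<integral>\<^sup>+y. \<integral>\<^sup>+z. indicator A (x(b := y, a := z)) \<partial>std_normal_distribution \<partial>std_normal_distribution \<partial>gauss K')"
  proof (rule nn_integral_cong)
    fix x assume x: "x \<in> space (gauss K')"
    define f where "f = (\<lambda>(z, y). indicator A (x(b := y, a := z)) :: ennreal)"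
    have "(\<lambda>p. x(b := snd p, a := fst p)) \<in> borel \<Otimes>\<^sub>M borel \<rightarrow>\<^sub>M PiM K (\<lambda>_. borel :: real measure)"
    proof (rule measurable_fun_upd[where J = "insert b K'"])
      show "(\<lambda>p::real\<times>real. x(b := snd p)) \<in> borel \<Otimes>\<^sub>M borel \<rightarrow>\<^sub>M PiM (insert b K') (\<lambda>_. borel :: real measure)"
        by (rule measurable_fun_upd[where J = K']) (use x in \<open>auto simp: space_PiM space_gauss PiE_def\<close>)
    qed (use K' in auto)
    hence "(\<lambda>p. x(b := snd p, a := fst p)) \<in> borel \<Otimes>\<^sub>M borel \<rightarrow>\<^sub>M gauss K"
      by (simp cong: measurable_cong_sets add: sets_gauss)
    note xm = measurable_compose[OF this Am]
    have "f = (\<lambda>p. indicator A (x(b := snd p, a := fst p)))" by (auto simp: f_def fun_eq_iff)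
    with xm have fm: "f \<in> borel_measurable (borel \<Otimes>\<^sub>M borel)" by (simp only:)
    have "?G (x(b := y, a := z)) = x(b := c * y - s * z, a := c * z + s * y)" for y z
      using K by auto
    thus "(\<integral>\<^sup>+y. \<integral>\<^sup>+z. indicator A (?G (x(b := y, a := z))) \<partial>std_normal_distribution \<partial>std_normal_distribution) =
       (\<integral>\<^sup>+y. \<integral>\<^sup>+z. indicator A (x(b := y, a := z)) \<partial>std_normal_distribution \<partial>std_normal_distribution)"
      using std_normal_rotation[OF fm cs] by (simp add: f_def)
  qed
  also have "\<dots> = (\<integral>\<^sup>+x. indicator A x \<partial>gauss K)" by (rule split[OF Am, symmetric])
  also have "\<dots> = emeasure (gauss K) A" using A by simp
  finally show "(\<integral>\<^sup>+x. indicator A (?G x) \<partial>gauss K) = emeasure (gauss K) A" .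
qed

text \<open>Matrices are functions on an index set rather than on a type, because the ambient
  dimension varies with \<open>n\<close> and shrinks in the induction over the Gram
  determinant.\<close>

definition lin :: "'k set \<Rightarrow> ('k \<Rightarrow> 'k \<Rightarrow> real) \<Rightarrow> ('k \<Rightarrow> real) \<Rightarrow> 'k \<Rightarrow> real" where
  "lin K q x = (\<lambda>k\<in>K. \<Sum>i\<in>K. q k i * x i)"

definition orthonormal_columns :: "'k set \<Rightarrow> ('k \<Rightarrow> 'k \<Rightarrow> real) \<Rightarrow> bool" where
  "orthonormal_columns K q \<longleftrightarrow> (\<forall>i\<in>K. \<forall>i'\<in>K. (\<Sum>k\<in>K. q k i * q k i') = of_bool (i = i'))"

lemma measurable_lin [measurable]: "lin K q \<in> gauss K \<rightarrow>\<^sub>M gauss K"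
proof -
  have "lin K q \<in> gauss K \<rightarrow>\<^sub>M PiM K (\<lambda>_. borel)"
    unfolding lin_def by (intro measurable_restrict borel_measurable_sum) auto
  thus ?thesis by (simp cong: measurable_cong_sets add: sets_gauss)
qed

lemma sum_lin_transpose:
  assumes K: "finite K" and q: "orthonormal_columns K q" and i: "i \<in> K"
  shows "(\<Sum>k\<in>K. q k i * lin K q x k) = x i"
proof -
  have "(\<Sum>k\<in>K. q k i * lin K q x k) = (\<Sum>k\<in>K. \<Sum>j\<in>K. q k i * q k j * x j)"
    by (simp add: lin_def sum_distrib_left mult_ac)
  also have "\<dots> = (\<Sum>j\<in>K. (\<Sum>k\<in>K. q k i * q k j) * x j)"
    by (subst sum.swap) (simp add: sum_distrib_right)
  also have "\<dots> = (\<Sum>j\<in>K. of_bool (i = j) * x j)"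
    using q i by (intro sum.cong) (auto simp: orthonormal_columns_def)
  also have "\<dots> = x i" using K i by (simp add: of_bool_def if_distrib[of "\<lambda>u. u * _"] sum.delta cong: if_cong)
  finally show ?thesis .
qed

lemma sum_lin_mult_lin:
  assumes K: "finite K" and q: "orthonormal_columns K q"
  shows "(\<Sum>k\<in>K. lin K q x k * lin K q y k) = (\<Sum>i\<in>K. x i * y i)"
proof -
  have "(\<Sum>k\<in>K. lin K q x k * lin K q y k) = (\<Sum>k\<in>K. \<Sum>i\<in>K. x i * (q k i * lin K q y k))"
    by (intro sum.cong refl) (simp add: lin_def[of K q x] sum_distrib_left sum_distrib_right mult_ac)
  also have "\<dots> = (\<Sum>i\<in>K. x i * (\<Sum>k\<in>K. q k i * lin K q y k))"
    by (subst sum.swap) (simp add: sum_distrib_left)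
  also have "\<dots> = (\<Sum>i\<in>K. x i * y i)"
    by (intro sum.cong refl) (simp add: sum_lin_transpose[OF K q])
  finally show ?thesis .
qed

text \<open>A product of Givens rotations, one for each coordinate other than \<open>i0\<close>,
  each moving the mass of that coordinate of the image of \<open>v\<close> into \<open>i0\<close>.
  Coordinates already cleared stay zero, since each rotation changes only \<open>i0\<close> and the
  coordinate being cleared.\<close>

lemma exists_Gaussian_rotation:
  assumes K: "finite K" "i0 \<in> K"
  obtains q where "orthonormal_columns K q" "distr (gauss K) (gauss K) (lin K q) = gauss K"
    "\<And>k. k \<in> K - {i0} \<Longrightarrow> lin K q v k = 0"
proof -
  have "\<exists>q. orthonormal_columns K q \<and> distr (gauss K) (gauss K) (lin K q) = gauss K \<and> (\<forall>k\<in>S. lin K q v k = 0)"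
    if "finite S" "S \<subseteq> K - {i0}" for S
    using that
  proof (induction S)
    case empty
    let ?q = "\<lambda>k i. of_bool (k = i) :: real"
    have l: "lin K ?q x = restrict x K" for x
      using K by (auto simp: lin_def of_bool_def if_distrib[of "\<lambda>u. u * _"] sum.delta cong: if_cong)
    have "distr (gauss K) (gauss K) (lin K ?q) = distr (gauss K) (gauss K) (\<lambda>x. x)"
      by (intro distr_cong) (auto simp: l space_gauss extensional_restrict)
    hence "distr (gauss K) (gauss K) (lin K ?q) = gauss K" by simp
    moreover have "orthonormal_columns K ?q"
      using K by (auto simp: orthonormal_columns_def of_bool_def if_distrib[of "\<lambda>u. u * _"] sum.delta cong: if_cong)
    ultimately show ?case by blast
  next
    case (insert a S)
    then obtain q where q: "orthonormal_columns K q" "distr (gauss K) (gauss K) (lin K q) = gauss K"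
      "\<forall>k\<in>S. lin K q v k = 0" by auto
    have a: "a \<in> K" "a \<noteq> i0" "a \<notin> S" "i0 \<notin> S" "S \<subseteq> K" using insert by auto
    define w where "w = lin K q v"
    define \<rho> where "\<rho> = sqrt ((w i0)\<^sup>2 + (w a)\<^sup>2)"
    \<comment> \<open>Cosine and sine of the angle that turns (w i0, w a) onto the \<open>i0\<close>
      axis; if both entries vanish, the identity is taken.\<close>
    define c where "c = (if \<rho> = 0 then 1 else w i0 / \<rho>)"
    define s where "s = (if \<rho> = 0 then 0 else w a / \<rho>)"
    have \<rho>2: "\<rho>\<^sup>2 = (w i0)\<^sup>2 + (w a)\<^sup>2" by (simp add: \<rho>_def)
    have cs: "c\<^sup>2 + s\<^sup>2 = 1"
      by (cases "\<rho> = 0") (simp_all add: c_def s_def power_divide add_divide_distrib[symmetric] \<rho>2[symmetric])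
    have wa: "c * w a - s * w i0 = 0"
    proof (cases "\<rho> = 0")
      case True
      hence "(w i0)\<^sup>2 + (w a)\<^sup>2 = 0" using \<rho>2 by simp
      hence "w a = 0" by (simp add: sum_power2_eq_zero_iff)
      thus ?thesis using True by (simp add: s_def)
    qed (auto simp: c_def s_def)
    define q' where "q' = q(i0 := (\<lambda>i. c * q i0 i + s * q a i), a := (\<lambda>i. c * q a i - s * q i0 i))"
    define G where "G = (\<lambda>x. x(i0 := c * x i0 + s * x a, a := c * x a - s * x i0) :: 'a \<Rightarrow> real)"
    have l: "lin K q' x = G (lin K q x)" for x
      using a K by (auto simp: fun_eq_iff lin_def G_def q'_def sum.distrib sum_distrib_left sum_subtractf algebra_simps)
    have Gd: "distr (gauss K) (gauss K) G = gauss K"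
      unfolding G_def by (rule distr_gauss_Givens) (use a K cs in auto)
    have Gm: "G \<in> gauss K \<rightarrow>\<^sub>M gauss K"
    proof -
      show ?thesis unfolding G_def
        by (intro measurable_gauss_fun_upd measurable_ident K a borel_measurable_add borel_measurable_diff borel_measurable_times measurable_gauss_component measurable_const)
           (auto simp: measurable_ident)
    qed
    have "distr (gauss K) (gauss K) (lin K q') = distr (distr (gauss K) (gauss K) (lin K q)) (gauss K) G"
      using Gm by (subst distr_distr) (auto simp: o_def l[abs_def])
    hence d: "distr (gauss K) (gauss K) (lin K q') = gauss K" using q(2) Gd by simp
    have "orthonormal_columns K q'"
      unfolding orthonormal_columns_def
    proof (intro ballI)
      fix i i' assume i: "i \<in> K" "i' \<in> K"
      have sp: "(\<Sum>k\<in>K. f k) = (f i0 + f a) + (\<Sum>k\<in>K - {i0} - {a}. f k)" for f :: "'a \<Rightarrow> real"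
        using K a by (simp add: sum.remove[of K i0] sum.remove[of "K - {i0}" a])
      have "(\<Sum>k\<in>K - {i0} - {a}. q' k i * q' k i') = (\<Sum>k\<in>K - {i0} - {a}. q k i * q k i')"
        by (intro sum.cong) (auto simp: q'_def)
      moreover have "q' i0 i * q' i0 i' + q' a i * q' a i' = (c\<^sup>2 + s\<^sup>2) * (q i0 i * q i0 i' + q a i * q a i')"
        using a by (simp add: q'_def power2_eq_square algebra_simps)
      ultimately have "(\<Sum>k\<in>K. q' k i * q' k i') = (\<Sum>k\<in>K. q k i * q k i')"
        unfolding sp[of "\<lambda>k. q' k i * q' k i'"] sp[of "\<lambda>k. q k i * q k i'"] cs by simp
      thus "(\<Sum>k\<in>K. q' k i * q' k i') = of_bool (i = i')"
        using q(1) i by (simp add: orthonormal_columns_def)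
    qed
    moreover have "\<forall>k\<in>insert a S. lin K q' v k = 0"
      using q(3) wa a unfolding l G_def w_def[symmetric] by auto
    ultimately show ?case using d by blast
  qed
  from this[of "K - {i0}"] show thesis using K that by auto
qed


subsection \<open>Gram determinants of Gaussian vectors\<close>

text \<open>Formulas on a real half line around 0 extend to the imaginary axis through a holomorphic
  \<open>L\<close>, and there they give the characteristic functions. Nonnegative integrals in the
  hypotheses provide integrability together with the value.\<close>

lemma real_distribution_eqI_mgf:
  fixes m :: "real \<Rightarrow> real" and L :: "complex \<Rightarrow> complex"
  assumes c: "c < 0" and M: "real_distribution M1" "real_distribution M2"
    and m1: "\<And>t. t > c \<Longrightarrow> (\<integral>\<^sup>+x. ennreal (exp (t * x)) \<partial>M1) = ennreal (m t)"
    and m2: "\<And>t. t > c \<Longrightarrow> (\<integral>\<^sup>+x. ennreal (exp (t * x)) \<partial>M2) = ennreal (m t)"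
    and m0: "\<And>t. t > c \<Longrightarrow> m t \<ge> 0"
    and L: "L holomorphic_on {t. c < Re t}" "\<And>t. t > c \<Longrightarrow> of_real (m t) = L (of_real t)"
  shows "M1 = M2"
proof (rule Levy_uniqueness[OF M])
  have real: "integrable N (\<lambda>x. exp (t * x)) \<and> (LINT x|N. exp (t * x)) = m t"
    if N: "real_distribution N" and t: "t > c"
      and n: "\<And>t. t > c \<Longrightarrow> (\<integral>\<^sup>+x. ennreal (exp (t * x)) \<partial>N) = ennreal (m t)" for N t
  proof -
    interpret real_distribution N by fact
    show ?thesis using n[OF t] by (subst (asm) nn_integral_eq_integrable) (auto simp: m0[OF t])
  qed
  have cmp: "(LINT x|N. exp (t * of_real x)) = L t"
    if N: "real_distribution N" and t: "Re t > c"
      and n: "\<And>t. t > c \<Longrightarrow> (\<integral>\<^sup>+x. ennreal (exp (t * x)) \<partial>N) = ennreal (m t)" for N and t :: complex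
    using mgf_eq_holomorphic[OF N _ L(1) _ t] real[OF N _ n] L(2) by simp
  show "char M1 = char M2"
  proof
    fix s :: real
    have "(LINT x|M1. exp (\<i> * of_real s * of_real x)) = (LINT x|M2. exp (\<i> * of_real s * of_real x))"
      using cmp[OF M(1) _ m1, of "\<i> * of_real s"] cmp[OF M(2) _ m2, of "\<i> * of_real s"] c by simp
    thus "char M1 s = char M2 s" unfolding char_def by (simp add: mult_ac)
  qed
qed

lemma nn_integral_std_normal_exp_square:
  assumes z: "z > -1"
  shows "(\<integral>\<^sup>+x. ennreal (exp (- (z * x\<^sup>2 / 2))) \<partial>std_normal_distribution) = ennreal ((1 + z) powr (- (1 / 2)))"
proof -
  define \<sigma> where "\<sigma> = 1 / sqrt (1 + z)"
  have \<sigma>: "\<sigma> > 0" "\<sigma>\<^sup>2 = 1 / (1 + z)" using z by (auto simp: \<sigma>_def power_divide)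
  have one: "(\<integral>\<^sup>+x. ennreal (normal_density 0 \<sigma> x) \<partial>lborel) = 1"
    using prob_space.emeasure_space_1[OF prob_space_normal_density[OF \<sigma>(1), of 0]] by (simp add: emeasure_density)
  have e: "std_normal_density x * exp (- (z * x\<^sup>2 / 2)) = (1 + z) powr (- (1 / 2)) * normal_density 0 \<sigma> x" for x
  proof -
    have "normal_density 0 \<sigma> x = sqrt (1 + z) / sqrt (2 * pi) * exp (- x\<^sup>2 * (1 + z) / 2)"
      using z unfolding normal_density_def \<sigma>(2) by (simp add: real_sqrt_divide)
    moreover have "std_normal_density x * exp (- (z * x\<^sup>2 / 2)) = 1 / sqrt (2 * pi) * exp (- x\<^sup>2 * (1 + z) / 2)"
      unfolding normal_density_def by (simp add: exp_add[symmetric] algebra_simps add_divide_distrib)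
    moreover have "(1 + z) powr (- (1 / 2)) * sqrt (1 + z) = 1"
      using z by (simp add: powr_minus powr_half_sqrt)
    ultimately show ?thesis by (simp add: mult.assoc[symmetric])
  qed
  have "(\<integral>\<^sup>+x. ennreal (exp (- (z * x\<^sup>2 / 2))) \<partial>std_normal_distribution) =
    (\<integral>\<^sup>+x. ennreal ((1 + z) powr (- (1 / 2))) * ennreal (normal_density 0 \<sigma> x) \<partial>lborel)"
    by (subst nn_integral_std_normal) (simp_all add: ennreal_mult'[symmetric] ennreal_mult''[symmetric] e)
  also have "\<dots> = ennreal ((1 + z) powr (- (1 / 2))) * 1"
    by (subst nn_integral_cmult) (simp_all add: one)
  finally show ?thesis by simp
qed

text \<open>Both sides have Laplace transform \<open>(1 + t) powr (- card J / 2)\<close> after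
  halving, and a law is determined by its transform.\<close>

lemma nn_integral_gauss_sum_squares:
  fixes f :: "real \<Rightarrow> ennreal"
  assumes J: "finite J" "J \<noteq> {}" and f [measurable]: "f \<in> borel_measurable borel"
  shows "(\<integral>\<^sup>+x. f (\<Sum>j\<in>J. (x j)\<^sup>2) \<partial>gauss J) = (\<integral>\<^sup>+g. f (2 * g) \<partial>gamma_law (card J / 2))"
proof -
  define p where "p = real (card J) / 2"
  have p: "p > 0" using J by (simp add: p_def card_gt_0_iff)
  interpret g: prob_space "gamma_law p" by (rule prob_space_gamma_law[OF p])
  interpret n: prob_space "gauss J" by (rule prob_space_gauss)
  have Sm: "(\<lambda>x. - ((\<Sum>j\<in>J. (x j)\<^sup>2) / 2)) \<in> borel_measurable (gauss J)"
    by (intro borel_measurable_uminus borel_measurable_divide borel_measurable_sum borel_measurable_power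
        measurable_gauss_component borel_measurable_const)
  \<comment> \<open>The sign turns the Laplace transform, finite for \<open>t > -1\<close>, into a
    moment generating function on a right half line.\<close>
  define A where "A = distr (gauss J) borel (\<lambda>x. - ((\<Sum>j\<in>J. (x j)\<^sup>2) / 2))"
  define B where "B = distr (gamma_law p) borel uminus"
  have Um: "uminus \<in> borel_measurable (gamma_law p)"
    by (rule borel_measurable_uminus[OF measurable_ident_sets]) simp
  have "A = B"
  proof (rule real_distribution_eqI_mgf[where c = "-1" and m = "\<lambda>t. (1 + t) powr (- p)" and L = "\<lambda>t. exp (- of_real p * Ln (1 + t))"])
    show "real_distribution A"
      unfolding A_def real_distribution_def real_distribution_axioms_def
      using n.prob_space_distr[OF Sm] by simp
    show "real_distribution B"
      unfolding B_def real_distribution_def real_distribution_axioms_def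
      using g.prob_space_distr[OF Um] by simp
    fix t :: real assume t: "t > -1"
    show "(\<integral>\<^sup>+x. ennreal (exp (t * x)) \<partial>B) = ennreal ((1 + t) powr (- p))"
      unfolding B_def using nn_integral_gamma_law_exp[OF p t] by (subst nn_integral_distr[OF Um]) simp_all
    have "(\<integral>\<^sup>+x. ennreal (exp (t * x)) \<partial>A) = (\<integral>\<^sup>+x. ennreal (exp (t * (- ((\<Sum>j\<in>J. (x j)\<^sup>2) / 2)))) \<partial>gauss J)"
      unfolding A_def by (subst nn_integral_distr[OF Sm]) simp_all
    also have "\<dots> = (\<integral>\<^sup>+x. (\<Prod>j\<in>J. ennreal (exp (- (t * (x j)\<^sup>2 / 2)))) \<partial>gauss J)"
      using J by (subst prod_ennreal) (auto simp: exp_sum[symmetric] sum_negf sum_distrib_left sum_divide_distrib)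
    also have "\<dots> = (\<Prod>j\<in>J. \<integral>\<^sup>+x. ennreal (exp (- (t * x\<^sup>2 / 2))) \<partial>std_normal_distribution)"
      unfolding gauss_def by (rule std_normal_PiM.product_nn_integral_prod) (use J in auto)
    also have "\<dots> = ennreal ((1 + t) powr (- (1 / 2))) ^ card J"
      unfolding nn_integral_std_normal_exp_square[OF t] by simp
    also have "\<dots> = ennreal ((1 + t) powr (- p))"
      using t by (simp add: ennreal_power p_def powr_realpow[symmetric] powr_powr)
    finally show "(\<integral>\<^sup>+x. ennreal (exp (t * x)) \<partial>A) = ennreal ((1 + t) powr (- p))" .
    have "Ln (1 + complex_of_real t) = of_real (ln (1 + t))"
      using t Ln_of_real[of "1 + t"] by simp
    thus "complex_of_real ((1 + t) powr (- p)) = exp (- of_real p * Ln (1 + of_real t))"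
      using t by (simp add: powr_def exp_of_real[symmetric])
  next
    show "(\<lambda>t. exp (- complex_of_real p * Ln (1 + t))) holomorphic_on {t. - 1 < Re t}"
      by (intro holomorphic_intros) (auto simp: complex_nonpos_Reals_iff)
  qed auto
  have "(\<integral>\<^sup>+x. f (\<Sum>j\<in>J. (x j)\<^sup>2) \<partial>gauss J) = (\<integral>\<^sup>+y. f (- 2 * y) \<partial>A)"
    unfolding A_def by (subst nn_integral_distr[OF Sm]) simp_all
  also have "\<dots> = (\<integral>\<^sup>+g. f (2 * g) \<partial>gamma_law p)"
    unfolding \<open>A = B\<close> B_def by (subst nn_integral_distr[OF Um]) simp_all
  finally show ?thesis by (simp add: p_def)
qed

section \<open>Determinants of Gram matrices\<close>

lemma det_row_operations:
  fixes A :: "real^'n::finite^'n"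
  assumes k: "k \<notin> S"
  shows "det (\<chi> i. if i \<in> S then row i A + c i *s row k A else row i A) = det A"
proof -
  have "finite S" by simp
  thus ?thesis using k
  proof (induction S)
    case empty
    have "(\<chi> i. row i A) = A" by (simp add: vec_eq_iff row_def)
    thus ?case by simp
  next
    case (insert a S)
    define B where "B = (\<chi> i. if i \<in> S then row i A + c i *s row k A else row i A)"
    have B: "det B = det A" using insert unfolding B_def by auto
    have r: "row a B = row a A" "row k B = row k A"
      using insert by (auto simp: B_def row_def vec_eq_iff)
    have "(\<chi> i. if i \<in> insert a S then row i A + c i *s row k A else row i A) =
      (\<chi> i. if i = a then row a B + c a *s row k B else row i B)"
      unfolding r using insert by (auto simp: vec_eq_iff B_def row_def)
    also have "det \<dots> = det B" using insert by (intro det_row_operation) auto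
    finally show ?case using B by simp
  qed
qed

text \<open>The minor of \<open>G\<close> with rows and columns in \<open>I\<close>, padded with the identity, so that minors of
  different sizes are determinants of matrices of the same type.\<close>

definition gdet :: "'i::finite set \<Rightarrow> ('i \<Rightarrow> 'i \<Rightarrow> real) \<Rightarrow> real" where
  "gdet I G = det (\<chi> i k. if i \<in> I \<and> k \<in> I then G i k else of_bool (i = k))"

lemma gdet_cong: "(\<And>i k. i \<in> I \<Longrightarrow> k \<in> I \<Longrightarrow> G i k = H i k) \<Longrightarrow> gdet I G = gdet I H"
  unfolding gdet_def by (rule arg_cong[where f = det]) (auto simp: vec_eq_iff)

lemma gdet_empty [simp]: "gdet {} G = 1"
proof -
  have "(\<chi> i k. of_bool (i = k)) = (mat 1 :: real^'a^'a)" by (simp add: mat_def vec_eq_iff)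
  thus ?thesis by (simp add: gdet_def)
qed

text \<open>Here \<open>G\<close> is the Gram matrix of vectors of which the one with index
  \<open>i0\<close> is \<open>\<rho>\<close> times a unit vector, \<open>a i\<close> are the
  components along that unit vector, and \<open>H\<close> is the Gram matrix of the orthogonal
  projections. Elimination of row and column \<open>i0\<close> leaves \<open>H\<close> as Schur
  complement; the form \<open>\<rho> * a i\<close> of the entries also admits
  \<open>\<rho> = 0\<close>.\<close>

lemma gdet_Schur:
  assumes i0: "i0 \<notin> I" and G00: "G i0 i0 = \<rho> * \<rho>"
    and G0: "\<And>i. i \<in> I \<Longrightarrow> G i0 i = \<rho> * a i" "\<And>i. i \<in> I \<Longrightarrow> G i i0 = \<rho> * a i"
    and G: "\<And>i k. i \<in> I \<Longrightarrow> k \<in> I \<Longrightarrow> G i k = a i * a k + H i k"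
  shows "gdet (insert i0 I) G = \<rho>\<^sup>2 * gdet I H"
proof -
  define M where "M = (\<chi> i k. if i \<in> insert i0 I \<and> k \<in> insert i0 I then G i k else of_bool (i = k))"
  define N where "N = (\<chi> i k. if i \<in> I \<and> k \<in> I then H i k else of_bool (i = k))"
  show ?thesis
  proof (cases "\<rho> = 0")
    case True
    have "row i0 M = 0" using i0 True G00 G0 by (auto simp: M_def row_def vec_eq_iff)
    hence "det M = 0" by (rule det_zero_row)
    thus ?thesis using True by (simp add: gdet_def M_def)
  next
    case False
    define c where "c i = - (a i / \<rho>)" for i
    \<comment> \<open>The first pass clears the column of \<open>i0\<close>. The transposition makes
      the second pass act on the columns of the original matrix, where it clears the row of
      \<open>i0\<close>.\<close>
    define M1 where "M1 = transpose (\<chi> i. if i \<in> I then row i M + c i *s row i0 M else row i M)"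
    define M2 where "M2 = transpose (\<chi> i. if i \<in> I then row i M1 + c i *s row i0 M1 else row i M1)"
    have "det M2 = det M1" unfolding M2_def det_transpose by (rule det_row_operations[OF i0])
    also have "det M1 = det M" unfolding M1_def det_transpose by (rule det_row_operations[OF i0])
    finally have d: "det M2 = det M" .
    have M1: "M1 $ k $ i = (if i \<in> I then (if k \<in> I then H i k else of_bool (i = k)) else M $ i $ k)" for i k
      using i0 False G0 G G00
      by (auto simp: M1_def M_def c_def transpose_def row_def)
    have "M2 $ i $ k = (\<chi> i. if i = i0 then \<rho>\<^sup>2 *s row i0 N else row i N) $ i $ k" for i k
      using i0 False G0 G G00
      by (auto simp: M2_def M1 M_def N_def c_def transpose_def row_def power2_eq_square)
    hence "M2 = (\<chi> i. if i = i0 then \<rho>\<^sup>2 *s row i N else row i N)" by (simp add: vec_eq_iff)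
    hence "det M2 = \<rho>\<^sup>2 * det (\<chi> i. if i = i0 then row i N else row i N)" by (simp only: det_row_mul)
    moreover have "(\<chi> i. if i = i0 then row i N else row i N) = N" by (simp add: vec_eq_iff row_def)
    ultimately show ?thesis using d by (simp add: gdet_def M_def N_def)
  qed
qed

definition gram :: "'j set \<Rightarrow> ('i \<Rightarrow> 'j \<Rightarrow> real) \<Rightarrow> 'i \<Rightarrow> 'i \<Rightarrow> real" where
  "gram J z i k = (\<Sum>j\<in>J. z i j * z k j)"

lemma gram_lin:
  assumes "finite J" "orthonormal_columns J q"
  shows "gram J (\<lambda>i. lin J q (z i)) = gram J z"
  using sum_lin_mult_lin[OF assms] by (simp add: gram_def fun_eq_iff)

lemma measurable_gdet_gram:
  fixes I :: "'i::finite set"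
  assumes "\<And>i j. i \<in> I \<Longrightarrow> j \<in> J \<Longrightarrow> (\<lambda>x. z x i j) \<in> borel_measurable M"
  shows "(\<lambda>x. gdet I (gram J (z x))) \<in> borel_measurable M"
proof -
  have m: "(\<lambda>x. if i \<in> I \<and> k \<in> I then gram J (z x) i k else of_bool (i = k)) \<in> borel_measurable M" for i k
  proof (cases "i \<in> I \<and> k \<in> I")
    case True
    have "(\<lambda>x. \<Sum>j\<in>J. z x i j * z x k j) \<in> borel_measurable M"
      using True by (intro borel_measurable_sum borel_measurable_times assms) auto
    moreover have "(\<lambda>x. if i \<in> I \<and> k \<in> I then gram J (z x) i k else of_bool (i = k)) = (\<lambda>x. \<Sum>j\<in>J. z x i j * z x k j)"
      using True by (auto simp: gram_def fun_eq_iff)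
    ultimately show ?thesis by (simp only:)
  next
    case False
    thus ?thesis by (simp only: if_False borel_measurable_const)
  qed
  show ?thesis unfolding gdet_def det_def vec_lambda_beta
    by (intro borel_measurable_sum borel_measurable_times borel_measurable_prod m borel_measurable_const)
qed

interpretation gauss: prob_space "gauss J" for J :: "'j set" by (rule prob_space_gauss)
interpretation gauss_PiM: product_prob_space "\<lambda>_. gauss J" I for J :: "'j set" and I :: "'i set" by standard

lemma measurable_PiM_gauss_entry:
  "i \<in> I \<Longrightarrow> j \<in> J \<Longrightarrow> (\<lambda>z. z i j) \<in> borel_measurable (PiM I (\<lambda>_. gauss J))"
  by (rule measurable_compose[OF measurable_component_singleton[of i I "\<lambda>_. gauss J"] measurable_gauss_component])

lemma distr_gauss_restrict:
  assumes "finite J" "J' \<subseteq> J"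
  shows "distr (gauss J) (gauss J') (\<lambda>x. restrict x J') = gauss J'"
  unfolding gauss_def by (rule std_normal_PiM.distr_restrict[OF assms(2,1), symmetric])

lemma nn_integral_PiM_gauss_map:
  assumes I: "finite I" and T: "T \<in> gauss J \<rightarrow>\<^sub>M gauss J'" "distr (gauss J) (gauss J') T = gauss J'"
    and h: "h \<in> borel_measurable (PiM I (\<lambda>_. gauss J'))"
  shows "(\<integral>\<^sup>+z. h (compose I T z) \<partial>PiM I (\<lambda>_. gauss J)) = (\<integral>\<^sup>+y. h y \<partial>PiM I (\<lambda>_. gauss J'))"
proof -
  have d: "distr (PiM I (\<lambda>_. gauss J)) (PiM I (\<lambda>_. gauss J')) (compose I T) = PiM I (\<lambda>_. gauss J')"
    using distr_PiM_finite_prob_space'[OF I prob_space_gauss prob_space_gauss T(1)] unfolding T(2) .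
  have [measurable]: "compose I T \<in> PiM I (\<lambda>_. gauss J) \<rightarrow>\<^sub>M PiM I (\<lambda>_. gauss J')"
    unfolding compose_def by (intro measurable_restrict measurable_compose[OF _ T(1)] measurable_component_singleton)
  show ?thesis by (subst d[symmetric], subst nn_integral_distr) (use h in auto)
qed

text \<open>Condition on the vector \<open>v\<close> with index \<open>i0\<close> and rotate all
  vectors so that \<open>v\<close> lies on the axis \<open>j0\<close>. The Schur complement splits
  off the squared length of \<open>v\<close>, and the projections of the others are Gaussian vectors
  on \<open>J - {j0}\<close>. Numbers of vectors and of coordinates drop together, so
  \<open>d\<close> stays fixed. Since \<open>f\<close> is arbitrary, equality of laws is proved and
  the known factor can be absorbed into \<open>f\<close> in the induction.\<close>

theorem nn_integral_gdet_gram: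
  fixes I :: "'i::finite set" and J :: "'j set" and f :: "real \<Rightarrow> ennreal"
  assumes "finite J" "card J = card I + d" "f \<in> borel_measurable borel"
  shows "(\<integral>\<^sup>+z. f (gdet I (gram J z)) \<partial>PiM I (\<lambda>_. gauss J)) =
    (\<integral>\<^sup>+g. f (\<Prod>j<card I. 2 * g j) \<partial>PiM {..<card I} (\<lambda>j. gamma_law (real (d + Suc j) / 2)))"
proof -
  have "finite I" by simp
  thus ?thesis using assms
  proof (induction I arbitrary: J f)
    case empty
    thus ?case by (simp add: PiM_empty nn_integral_count_space_finite)
  next
    case (insert i0 I)
    note f [measurable] = insert.prems(3)
    define m where "m = card I"
    have cI: "card (insert i0 I) = Suc m" using insert by (simp add: m_def)
    have cJ: "card J = Suc m + d" using insert cI by simp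
    hence "J \<noteq> {}" by auto
    then obtain j0 where j0: "j0 \<in> J" by blast
    define J' where "J' = J - {j0}"
    have J': "finite J'" "card J' = m + d" "J' \<subseteq> J" "J = insert j0 J'" "j0 \<notin> J'"
      using insert.prems(1) cJ j0 by (auto simp: J'_def)
    define \<Gamma> where "\<Gamma> = (\<lambda>j. gamma_law (real (d + Suc j) / 2))"
    have \<Gamma>: "prob_space (\<Gamma> j)" for j unfolding \<Gamma>_def by (rule prob_space_gamma_law) simp
    interpret \<Gamma>: prob_space "\<Gamma> j" for j by (rule \<Gamma>)
    interpret \<Gamma>P: product_prob_space \<Gamma> "{} :: nat set" by standard
    have \<Gamma>c [measurable]: "(\<lambda>g. g j) \<in> borel_measurable (PiM K \<Gamma>)" if "j \<in> K" for j K
    proof -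
      have s: "sets (\<Gamma> j) = sets borel" by (simp add: \<Gamma>_def)
      show ?thesis
        using measurable_component_singleton[OF that, of \<Gamma>] unfolding measurable_cong_sets[OF refl s] .
    qed
    \<comment> \<open>The expectation over the remaining factors when the squared length split off
      has the value \<open>s\<close>.\<close>
    define k where "k = (\<lambda>s. \<integral>\<^sup>+g. f (s * (\<Prod>j<m. 2 * g j)) \<partial>PiM {..<m} \<Gamma>)"
    interpret \<Gamma>m: prob_space "PiM {..<m} \<Gamma>" by (intro prob_space_PiM \<Gamma>)
    have k [measurable]: "k \<in> borel_measurable borel"
    proof -
      have "(\<lambda>p. f (fst p * (\<Prod>j<m. 2 * snd p j))) \<in> borel_measurable (borel \<Otimes>\<^sub>M PiM {..<m} \<Gamma>)"
        by (rule measurable_compose[OF borel_measurable_times f], rule measurable_fst,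
            rule borel_measurable_prod, rule borel_measurable_times, rule measurable_const, simp,
            rule measurable_compose[OF measurable_snd \<Gamma>c]) simp
      hence "(\<lambda>(s, g). f (s * (\<Prod>j<m. 2 * g j))) \<in> borel_measurable (borel \<Otimes>\<^sub>M PiM {..<m} \<Gamma>)"
        by (simp only: case_prod_unfold)
      thus ?thesis unfolding k_def by (rule \<Gamma>m.borel_measurable_nn_integral)
    qed
    have fm: "(\<lambda>z. f (gdet (insert i0 I) (gram J z))) \<in> borel_measurable (PiM (insert i0 I) (\<lambda>_. gauss J))"
      by (rule measurable_compose[OF measurable_gdet_gram[where z = "\<lambda>z. z"] f]) (rule measurable_PiM_gauss_entry)
    \<comment> \<open>By rotation invariance the conditional expectation depends on \<open>v\<close>
      through its length only.\<close>
    have inner: "(\<integral>\<^sup>+z. f (gdet (insert i0 I) (gram J (z(i0 := v)))) \<partial>PiM I (\<lambda>_. gauss J)) = k (\<Sum>j\<in>J. (v j)\<^sup>2)" for v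
    proof -
      obtain q where q: "orthonormal_columns J q" "distr (gauss J) (gauss J) (lin J q) = gauss J"
        "\<And>k. k \<in> J - {j0} \<Longrightarrow> lin J q v k = 0"
        using exists_Gaussian_rotation[OF insert.prems(1) j0, of v] by blast
      define w where "w = lin J q v"
      define \<rho> where "\<rho> = w j0"
      have \<rho>: "\<rho>\<^sup>2 = (\<Sum>j\<in>J. (v j)\<^sup>2)"
      proof -
        have "(\<Sum>j\<in>J. (v j)\<^sup>2) = (\<Sum>j\<in>J. w j * w j)"
          using sum_lin_mult_lin[OF insert.prems(1) q(1), of v v] by (simp add: w_def power2_eq_square)
        also have "\<dots> = w j0 * w j0 + (\<Sum>j\<in>J'. w j * w j)"
          unfolding J'(4) using J' by simp
        also have "(\<Sum>j\<in>J'. w j * w j) = 0" using q(3) by (intro sum.neutral) (auto simp: w_def J'_def)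
        finally show ?thesis by (simp add: \<rho>_def power2_eq_square)
      qed
      define h where "h = (\<lambda>y. f (gdet (insert i0 I) (gram J (y(i0 := w)))))"
      have hm: "h \<in> borel_measurable (PiM I (\<lambda>_. gauss J))"
        unfolding h_def
      proof (rule measurable_compose[OF measurable_gdet_gram[where z = "\<lambda>y. y(i0 := w)"] f])
        fix i j assume "i \<in> insert i0 I" "j \<in> J"
        thus "(\<lambda>x. (x(i0 := w)) i j) \<in> borel_measurable (PiM I (\<lambda>_. gauss J))"
          by (cases "i = i0") (auto intro: measurable_PiM_gauss_entry)
      qed
      have S: "gdet (insert i0 I) (gram J (y(i0 := w))) = \<rho>\<^sup>2 * gdet I (gram J' y)" for y
      proof (rule gdet_Schur[where a = "\<lambda>i. y i j0"])
        have w0: "(\<Sum>j\<in>J. w j * u j) = \<rho> * u j0" "(\<Sum>j\<in>J. u j * w j) = \<rho> * u j0" for u :: "'j \<Rightarrow> real"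
        proof -
          have "(\<Sum>j\<in>J'. w j * u j) = 0" using q(3) by (intro sum.neutral) (auto simp: w_def J'_def)
          thus "(\<Sum>j\<in>J. w j * u j) = \<rho> * u j0" unfolding J'(4) using J' by (simp add: \<rho>_def)
          thus "(\<Sum>j\<in>J. u j * w j) = \<rho> * u j0" by (simp add: mult.commute)
        qed
        show "gram J (y(i0 := w)) i0 i0 = \<rho> * \<rho>" by (simp add: gram_def w0) (simp add: \<rho>_def)
        fix i assume i: "i \<in> I"
        hence "i \<noteq> i0" using insert by auto
        thus "gram J (y(i0 := w)) i0 i = \<rho> * y i j0" "gram J (y(i0 := w)) i i0 = \<rho> * y i j0"
          by (simp_all add: gram_def w0)
        fix k assume k: "k \<in> I"
        hence "k \<noteq> i0" using insert by auto
        thus "gram J (y(i0 := w)) i k = y i j0 * y k j0 + gram J' y i k"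
          unfolding J'(4) using J' \<open>i \<noteq> i0\<close> by (simp add: gram_def)
      qed (use insert in auto)
      have "(\<integral>\<^sup>+z. f (gdet (insert i0 I) (gram J (z(i0 := v)))) \<partial>PiM I (\<lambda>_. gauss J)) =
         (\<integral>\<^sup>+z. h (compose I (lin J q) z) \<partial>PiM I (\<lambda>_. gauss J))"
      proof (rule nn_integral_cong)
        fix z
        have "gdet (insert i0 I) (gram J (z(i0 := v))) = gdet (insert i0 I) (gram J (\<lambda>i. lin J q ((z(i0 := v)) i)))"
          by (simp only: gram_lin[OF insert.prems(1) q(1)])
        also have "\<dots> = gdet (insert i0 I) (gram J ((compose I (lin J q) z)(i0 := w)))"
          by (rule gdet_cong) (auto simp: gram_def compose_def w_def)
        finally show "f (gdet (insert i0 I) (gram J (z(i0 := v)))) = h (compose I (lin J q) z)" by (simp add: h_def)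
      qed
      also have "\<dots> = (\<integral>\<^sup>+y. h y \<partial>PiM I (\<lambda>_. gauss J))"
        by (rule nn_integral_PiM_gauss_map[OF insert.hyps(1) measurable_lin q(2) hm])
      \<comment> \<open>The coordinate \<open>j0\<close> no longer occurs, so it may be projected
        away before the induction hypothesis is applied in the smaller space.\<close>
      also have "\<dots> = (\<integral>\<^sup>+y. f (\<rho>\<^sup>2 * gdet I (gram J' (compose I (\<lambda>x. restrict x J') y))) \<partial>PiM I (\<lambda>_. gauss J))"
      proof (rule nn_integral_cong)
        fix y
        have "gdet I (gram J' y) = gdet I (gram J' (compose I (\<lambda>x. restrict x J') y))"
          by (rule gdet_cong) (auto simp: gram_def compose_def)
        thus "h y = f (\<rho>\<^sup>2 * gdet I (gram J' (compose I (\<lambda>x. restrict x J') y)))" by (simp add: h_def S)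
      qed
      also have "\<dots> = (\<integral>\<^sup>+y. f (\<rho>\<^sup>2 * gdet I (gram J' y)) \<partial>PiM I (\<lambda>_. gauss J'))"
      proof (rule nn_integral_PiM_gauss_map[OF insert.hyps(1) _ distr_gauss_restrict[OF insert.prems(1) J'(3)]])
        show "(\<lambda>x. restrict x J') \<in> gauss J \<rightarrow>\<^sub>M gauss J'"
          unfolding gauss_def by (rule measurable_restrict_subset[OF J'(3)])
        have "(\<lambda>y. gdet I (gram J' y)) \<in> borel_measurable (PiM I (\<lambda>_. gauss J'))"
          by (rule measurable_gdet_gram[where z = "\<lambda>z. z"]) (rule measurable_PiM_gauss_entry)
        hence "(\<lambda>y. \<rho>\<^sup>2 * gdet I (gram J' y)) \<in> borel_measurable (PiM I (\<lambda>_. gauss J'))"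
          by (rule borel_measurable_times[OF borel_measurable_const])
        thus "(\<lambda>y. f (\<rho>\<^sup>2 * gdet I (gram J' y))) \<in> borel_measurable (PiM I (\<lambda>_. gauss J'))"
          by (rule measurable_compose[OF _ f])
      qed
      also have "\<dots> = (\<integral>\<^sup>+g. f (\<rho>\<^sup>2 * (\<Prod>j<card I. 2 * g j)) \<partial>PiM {..<card I} (\<lambda>j. gamma_law (real (d + Suc j) / 2)))"
        by (rule insert.IH[of J' "\<lambda>u. f (\<rho>\<^sup>2 * u)"]) (use J' in \<open>auto simp: m_def\<close>)
      finally show ?thesis by (simp add: k_def \<rho>[symmetric] m_def \<Gamma>_def)
    qed
    have "(\<integral>\<^sup>+z. f (gdet (insert i0 I) (gram J z)) \<partial>PiM (insert i0 I) (\<lambda>_. gauss J)) =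
       (\<integral>\<^sup>+v. \<integral>\<^sup>+z. f (gdet (insert i0 I) (gram J (z(i0 := v)))) \<partial>PiM I (\<lambda>_. gauss J) \<partial>gauss J)"
      by (rule gauss_PiM.product_nn_integral_insert_rev[OF insert.hyps fm])
    also have "\<dots> = (\<integral>\<^sup>+v. k (\<Sum>j\<in>J. (v j)\<^sup>2) \<partial>gauss J)" unfolding inner ..
    also have "\<dots> = (\<integral>\<^sup>+w. k (2 * w) \<partial>gamma_law (card J / 2))"
      by (rule nn_integral_gauss_sum_squares) (use insert.prems(1) j0 in auto)
    \<comment> \<open>The vector removed first has the most degrees of freedom,
      \<open>m + 1 + d\<close>, and is therefore the factor with the last index
      \<open>m\<close>.\<close>
    also have "gamma_law (card J / 2) = \<Gamma> m" by (simp add: \<Gamma>_def cJ add_ac)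
    also have "(\<integral>\<^sup>+w. k (2 * w) \<partial>\<Gamma> m) = (\<integral>\<^sup>+w. \<integral>\<^sup>+g. f (\<Prod>j<Suc m. 2 * (g(m := w)) j) \<partial>PiM {..<m} \<Gamma> \<partial>\<Gamma> m)"
      unfolding k_def by (intro nn_integral_cong arg_cong[where f = f]) (simp add: mult_ac)
    also have "\<dots> = (\<integral>\<^sup>+g. f (\<Prod>j<Suc m. 2 * g j) \<partial>PiM (insert m {..<m}) \<Gamma>)"
    proof (rule \<Gamma>P.product_nn_integral_insert_rev[symmetric])
      show "(\<lambda>g. f (\<Prod>j<Suc m. 2 * g j)) \<in> borel_measurable (Pi\<^sub>M (insert m {..<m}) \<Gamma>)"
        by (rule measurable_compose[OF borel_measurable_prod f], rule borel_measurable_times, rule measurable_const, simp,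
            rule \<Gamma>c) auto
    qed auto
    also have "insert m {..<m} = {..<Suc m}" by auto
    finally show ?case unfolding cI \<Gamma>_def .
  qed
qed


subsection \<open>Edge vectors of a Gaussian simplex\<close>

lemma indep_vars_PiM_components:
  assumes N: "prob_space N" and K: "K \<noteq> {}"
  shows "prob_space.indep_vars (PiM K (\<lambda>_. N)) (\<lambda>_. N) (\<lambda>p \<omega>. \<omega> p) K"
proof -
  interpret P: prob_space "PiM K (\<lambda>_. N)" by (intro prob_space_PiM N)
  have "distr (PiM K (\<lambda>_. N)) (PiM K (\<lambda>_. N)) (\<lambda>x. \<lambda>i\<in>K. x i) = distr (PiM K (\<lambda>_. N)) (PiM K (\<lambda>_. N)) (\<lambda>x. x)"
    by (intro distr_cong) (auto simp: space_PiM)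
  also have "\<dots> = PiM K (\<lambda>i. distr (PiM K (\<lambda>_. N)) N (\<lambda>\<omega>. \<omega> i))"
  proof -
    have "distr (PiM K (\<lambda>_. N)) N (\<lambda>\<omega>. \<omega> i) = N" if "i \<in> K" for i
      using distr_PiM_component[of K "\<lambda>_. N" i] N that by simp
    hence "PiM K (\<lambda>i. distr (PiM K (\<lambda>_. N)) N (\<lambda>\<omega>. \<omega> i)) = PiM K (\<lambda>_. N)" by (intro PiM_cong refl)
    thus ?thesis by simp
  qed
  finally show ?thesis
    by (subst P.indep_vars_iff_distr_eq_PiM'[OF K]) auto
qed

text \<open>The blocks \<open>{j} \<times> I\<close> of a flat product are independent, and their
  joint law is therefore the product of the block laws.\<close>

lemma distr_curry_PiM:
  assumes N: "prob_space N" and I: "I \<noteq> {}" and J: "J \<noteq> {}"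
  shows "distr (PiM (J \<times> I) (\<lambda>_. N)) (PiM J (\<lambda>_. PiM I (\<lambda>_. N))) (\<lambda>\<omega>. \<lambda>j\<in>J. \<lambda>i\<in>I. \<omega> (j, i)) =
         PiM J (\<lambda>_. PiM I (\<lambda>_. N))"
proof -
  interpret P: prob_space "PiM (J \<times> I) (\<lambda>_. N)" by (intro prob_space_PiM N)
  have "P.indep_vars (\<lambda>j. PiM ({j} \<times> I) (\<lambda>_. N)) (\<lambda>j \<omega>. \<lambda>p\<in>{j} \<times> I. \<omega> p) J"
    by (rule P.indep_vars_restrict[OF indep_vars_PiM_components[OF N]])
       (use I J in \<open>auto simp: disjoint_family_on_def\<close>)
  hence "P.indep_vars (\<lambda>_. PiM I (\<lambda>_. N)) (\<lambda>j \<omega>. (\<lambda>y. \<lambda>i\<in>I. y (j, i)) (\<lambda>p\<in>{j} \<times> I. \<omega> p)) J"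
    by (rule P.indep_vars_compose2) (rule measurable_restrict, rule measurable_component_singleton, simp)
  also have "(\<lambda>j \<omega>. (\<lambda>y. \<lambda>i\<in>I. y (j, i)) (\<lambda>p\<in>{j} \<times> I. \<omega> p)) = (\<lambda>j \<omega>. \<lambda>i\<in>I. \<omega> (j, i))"
    by (auto simp: fun_eq_iff)
  finally have ind: "P.indep_vars (\<lambda>_. PiM I (\<lambda>_. N)) (\<lambda>j \<omega>. \<lambda>i\<in>I. \<omega> (j, i)) J" .
  have rv: "(\<lambda>\<omega>. \<lambda>i\<in>I. \<omega> (j, i)) \<in> PiM (J \<times> I) (\<lambda>_. N) \<rightarrow>\<^sub>M PiM I (\<lambda>_. N)" if "j \<in> J" for j
    using that by (intro measurable_restrict measurable_component_singleton) auto
  have "distr (PiM (J \<times> I) (\<lambda>_. N)) (PiM J (\<lambda>_. PiM I (\<lambda>_. N))) (\<lambda>\<omega>. \<lambda>j\<in>J. \<lambda>i\<in>I. \<omega> (j, i)) =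
     PiM J (\<lambda>j. distr (PiM (J \<times> I) (\<lambda>_. N)) (PiM I (\<lambda>_. N)) (\<lambda>\<omega>. \<lambda>i\<in>I. \<omega> (j, i)))"
    by (rule P.indep_vars_iff_distr_eq_PiM'[OF J, THEN iffD1, OF rv ind])
  also have "\<dots> = PiM J (\<lambda>_. PiM I (\<lambda>_. N))"
  proof (rule PiM_cong[OF refl])
    fix j assume "j \<in> J"
    thus "distr (PiM (J \<times> I) (\<lambda>_. N)) (PiM I (\<lambda>_. N)) (\<lambda>\<omega>. \<lambda>i\<in>I. \<omega> (j, i)) = PiM I (\<lambda>_. N)"
      using distr_PiM_reindex[of "J \<times> I" "\<lambda>_. N" "\<lambda>i. (j, i)" I] N by (auto simp: inj_on_def)
  qed
  finally show ?thesis .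
qed

lemma measurable_curry_PiM:
  "(\<lambda>\<omega>. \<lambda>j\<in>J. \<lambda>i\<in>I. \<omega> (f j i)) \<in> PiM K (\<lambda>_. N) \<rightarrow>\<^sub>M PiM J (\<lambda>_. PiM I (\<lambda>_. N))"
  if "\<And>i j. i \<in> I \<Longrightarrow> j \<in> J \<Longrightarrow> f j i \<in> K"
  using that by (intro measurable_restrict measurable_component_singleton) auto

lemma measurable_transpose_PiM:
  "(\<lambda>x. \<lambda>j\<in>J. \<lambda>i\<in>I. x i j) \<in> PiM I (\<lambda>_. PiM J (\<lambda>_. N)) \<rightarrow>\<^sub>M PiM J (\<lambda>_. PiM I (\<lambda>_. N))"
proof (intro measurable_restrict)
  fix i j assume "i \<in> I" "j \<in> J"
  thus "(\<lambda>x. x i j) \<in> PiM I (\<lambda>_. PiM J (\<lambda>_. N)) \<rightarrow>\<^sub>M N"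
    by (intro measurable_compose[OF measurable_component_singleton[of i I "\<lambda>_. PiM J (\<lambda>_. N)"] measurable_component_singleton])
qed

text \<open>Transposition factors through the flat product over pairs, where it is a reindexing by
  \<open>prod.swap\<close>.\<close>

lemma distr_transpose_PiM:
  assumes N: "prob_space N" and I: "I \<noteq> {}" and J: "J \<noteq> {}"
  shows "distr (PiM I (\<lambda>_. PiM J (\<lambda>_. N))) (PiM J (\<lambda>_. PiM I (\<lambda>_. N))) (\<lambda>x. \<lambda>j\<in>J. \<lambda>i\<in>I. x i j) =
         PiM J (\<lambda>_. PiM I (\<lambda>_. N))"
proof -
  let ?C = "PiM J (\<lambda>_. PiM I (\<lambda>_. N))"
  let ?c = "\<lambda>\<omega>. \<lambda>j\<in>J. \<lambda>i\<in>I. \<omega> (j, i)"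
  have "distr (PiM I (\<lambda>_. PiM J (\<lambda>_. N))) ?C (\<lambda>x. \<lambda>j\<in>J. \<lambda>i\<in>I. x i j) =
     distr (PiM (I \<times> J) (\<lambda>_. N)) ?C ((\<lambda>x. \<lambda>j\<in>J. \<lambda>i\<in>I. x i j) \<circ> (\<lambda>\<omega>. \<lambda>i\<in>I. \<lambda>j\<in>J. \<omega> (i, j)))"
    by (subst distr_curry_PiM[OF N J I, symmetric], rule distr_distr[OF measurable_transpose_PiM measurable_curry_PiM]) auto
  also have "\<dots> = distr (PiM (I \<times> J) (\<lambda>_. N)) ?C (?c \<circ> (\<lambda>\<omega>. \<lambda>p\<in>J \<times> I. \<omega> (prod.swap p)))"
    by (intro distr_cong) (auto simp: fun_eq_iff)
  also have "\<dots> = distr (distr (PiM (I \<times> J) (\<lambda>_. N)) (PiM (J \<times> I) (\<lambda>_. N)) (\<lambda>\<omega>. \<lambda>p\<in>J \<times> I. \<omega> (prod.swap p))) ?C ?c"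
    by (rule distr_distr[symmetric, OF measurable_curry_PiM])
       (auto intro!: measurable_restrict measurable_component_singleton)
  also have "distr (PiM (I \<times> J) (\<lambda>_. N)) (PiM (J \<times> I) (\<lambda>_. N)) (\<lambda>\<omega>. \<lambda>p\<in>J \<times> I. \<omega> (prod.swap p)) = PiM (J \<times> I) (\<lambda>_. N)"
  proof -
    have "prod.swap \<in> J \<times> I \<rightarrow> I \<times> J" by (rule Pi_I) auto
    thus ?thesis using distr_PiM_reindex[of "I \<times> J" "\<lambda>_. N" prod.swap "J \<times> I"] N by (simp add: inj_on_def)
  qed
  also have "distr (PiM (J \<times> I) (\<lambda>_. N)) ?C ?c = ?C" by (rule distr_curry_PiM[OF N I J])
  finally show ?thesis .
qed

text \<open>A rotation of the index set of the vertices acts on each coordinate separately; transposing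
  twice reduces it to the rotation invariance of the columns.\<close>

lemma distr_rotate_vertices:
  assumes K: "finite K" "K \<noteq> {}" and J: "finite J" "J \<noteq> {}"
    and q: "distr (gauss K) (gauss K) (lin K q) = gauss K"
  shows "distr (PiM K (\<lambda>_. gauss J)) (PiM K (\<lambda>_. gauss J)) (\<lambda>x. \<lambda>k\<in>K. \<lambda>j\<in>J. \<Sum>i\<in>K. q k i * x i j) =
         PiM K (\<lambda>_. gauss J)"
    and "(\<lambda>x. \<lambda>k\<in>K. \<lambda>j\<in>J. \<Sum>i\<in>K. q k i * x i j) \<in> PiM K (\<lambda>_. gauss J) \<rightarrow>\<^sub>M PiM K (\<lambda>_. gauss J)"
proof -
  let ?KJ = "PiM K (\<lambda>_. gauss J)" and ?JK = "PiM J (\<lambda>_. gauss K)"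
  define S where "S = (\<lambda>x::'a \<Rightarrow> 'b \<Rightarrow> real. \<lambda>j\<in>J. \<lambda>i\<in>K. x i j)"
  define T where "T = (\<lambda>x::'b \<Rightarrow> 'a \<Rightarrow> real. \<lambda>i\<in>K. \<lambda>j\<in>J. x j i)"
  define C where "C = compose J (lin K q)"
  have Sm: "S \<in> ?KJ \<rightarrow>\<^sub>M ?JK" and Tm: "T \<in> ?JK \<rightarrow>\<^sub>M ?KJ"
    unfolding S_def T_def gauss_def by (rule measurable_transpose_PiM)+
  have Sd: "distr ?KJ ?JK S = ?JK" and Td: "distr ?JK ?KJ T = ?KJ"
    unfolding S_def T_def gauss_def by (rule distr_transpose_PiM[OF prob_space_std_normal]; use K J in simp)+
  have Cm: "C \<in> ?JK \<rightarrow>\<^sub>M ?JK"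
    unfolding C_def compose_def
    by (intro measurable_restrict measurable_compose[OF _ measurable_lin] measurable_component_singleton)
  have Cd: "distr ?JK ?JK C = ?JK"
    unfolding C_def using distr_PiM_finite_prob_space'[OF J(1) prob_space_gauss prob_space_gauss measurable_lin[of K q]] unfolding q .
  have eq: "(\<lambda>x. \<lambda>k\<in>K. \<lambda>j\<in>J. \<Sum>i\<in>K. q k i * x i j) = T \<circ> (C \<circ> S)"
    by (auto simp: fun_eq_iff T_def C_def S_def compose_def lin_def)
  show "(\<lambda>x. \<lambda>k\<in>K. \<lambda>j\<in>J. \<Sum>i\<in>K. q k i * x i j) \<in> ?KJ \<rightarrow>\<^sub>M ?KJ"
    unfolding eq by (rule measurable_comp[OF measurable_comp[OF Sm Cm] Tm])
  have "distr ?KJ ?KJ (T \<circ> (C \<circ> S)) = distr (distr (distr ?KJ ?JK S) ?JK C) ?KJ T"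
    by (subst distr_distr[OF Cm Sm], subst distr_distr[OF Tm measurable_comp[OF Sm Cm]]) (rule refl)
  also have "\<dots> = ?KJ" unfolding Sd Cd Td ..
  finally show "distr ?KJ ?KJ (\<lambda>x. \<lambda>k\<in>K. \<lambda>j\<in>J. \<Sum>i\<in>K. q k i * x i j) = ?KJ" unfolding eq .
qed

section \<open>Determinant of the passage from rotated vertices to edges\<close>

lemma det_unit_row_ones:
  fixes a :: "'n::finite"
  shows "det (\<chi> i k. if i = a then 1 else of_bool (i = k) :: real^'n^'n) = 1"
proof -
  have "transpose (\<chi> i k. if i = a then 1 else of_bool (i = k) :: real^'n^'n) =
     (\<chi> i. if i \<in> - {a} then row i (mat 1) + (\<lambda>_. 1) i *s row a (mat 1) else row i (mat 1))"
    by (auto simp: vec_eq_iff transpose_def row_def mat_def)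
  also have "det \<dots> = det (mat 1 :: real^'n^'n)" by (rule det_row_operations) simp
  finally show ?thesis by (simp add: det_transpose)
qed

text \<open>For \<open>S = UNIV\<close> this is the rank-one determinant formula for the identity
  plus \<open>c\<close> times the all-ones matrix. Perturbing only the rows in \<open>S\<close>
  allows induction: additivity in the new row produces \<open>c\<close> times a determinant that row
  operations reduce to 1.\<close>

lemma det_identity_add_const_rows:
  fixes c :: real
  shows "det (\<chi> i k. if i \<in> S then of_bool (i = k) + c else of_bool (i = k) :: real^'n::finite^'n) = 1 + c * card S"
proof -
  have "finite S" by simp
  thus ?thesis
  proof (induction S)
    case empty
    have "(\<chi> i k. of_bool (i = k)) = (mat 1 :: real^'n^'n)" by (simp add: mat_def vec_eq_iff)
    thus ?case by simp
  next
    case (insert a S)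
    define M where "M T = (\<chi> i k. if i \<in> T then of_bool (i = k) + c else of_bool (i = k) :: real^'n^'n)" for T
    define one where "one = (\<chi> k. 1 :: real^'n)"
    define N where "N = (\<chi> i. if i = a then one else row i (M S))"
    have "(\<chi> i. if i \<in> S then row i N + (\<lambda>_. - c) i *s row a N else row i N) =
        (\<chi> i k. if i = a then 1 else of_bool (i = k))"
      using insert by (auto simp: vec_eq_iff N_def M_def row_def one_def)
    hence N: "det N = 1"
      using det_row_operations[of a S N "\<lambda>_. - c"] insert det_unit_row_ones[of a] by simp
    have "M (insert a S) = (\<chi> i. if i = a then (\<lambda>i. row i (M S)) i + (\<lambda>_. c *s one) i else (\<lambda>i. row i (M S)) i)"
      using insert by (auto simp: vec_eq_iff M_def row_def one_def)
    also have "det \<dots> = det (\<chi> i. if i = a then row i (M S) else row i (M S)) + det (\<chi> i. if i = a then c *s one else row i (M S))"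
      by (rule det_row_add)
    also have "(\<chi> i. if i = a then row i (M S) else row i (M S)) = M S"
      by (simp add: vec_eq_iff row_def)
    also have "det (\<chi> i. if i = a then c *s one else row i (M S)) = c * det N"
      unfolding N_def by (rule det_row_mul)
    finally show ?case using insert N unfolding M_def by (simp add: algebra_simps)
  qed
qed

lemma gdet_UNIV: "gdet UNIV G = det (\<chi> i k. G i k)"
  by (simp add: gdet_def)

text \<open>The edge vectors share the vertex 0 and are dependent. A rotation of the vertex index
  that sends the all-ones vector to the axis 0 puts their common part into rotated vertex 0, which
  cancels in differences; the other \<open>r\<close> rotated vertices are independent Gaussian
  vectors. Enumerating the nonzero vertices by \<open>\<sigma>\<close> turns the passage into a
  square matrix.\<close>

theorem nn_integral_gdet_edges:
  fixes \<sigma> :: "'i::finite \<Rightarrow> nat" and J :: "'j set" and f :: "real \<Rightarrow> ennreal"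
  assumes \<sigma>: "bij_betw \<sigma> UNIV {1..CARD('i)}" and J: "finite J" "card J = CARD('i) + d"
    and f: "f \<in> borel_measurable borel"
  defines "r \<equiv> CARD('i)"
  shows "(\<integral>\<^sup>+x. f (gdet UNIV (gram J (\<lambda>i j. x (\<sigma> i) j - x 0 j))) \<partial>PiM {..r} (\<lambda>_. gauss J)) =
    (\<integral>\<^sup>+g. f (real (r + 1) * (\<Prod>j<r. 2 * g j)) \<partial>PiM {..<r} (\<lambda>j. gamma_law (real (d + Suc j) / 2)))"
proof -
  define K where "K = {..r}"
  have K: "finite K" "0 \<in> K" "K \<noteq> {}" by (auto simp: K_def)
  have r0: "r > 0" by (simp add: r_def)
  have Jne: "J \<noteq> {}" using J r0 by (auto simp: r_def)
  have \<sigma>K: "\<sigma> i \<in> K" "\<sigma> i \<noteq> 0" for i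
    using bij_betwE[OF \<sigma>, rule_format, of i] by (auto simp: K_def r_def)
  have inj: "inj \<sigma>" and im: "range \<sigma> = K - {0}"
    using \<sigma> by (auto simp: bij_betw_def K_def r_def)
  obtain q where q: "orthonormal_columns K q" "distr (gauss K) (gauss K) (lin K q) = gauss K"
    "\<And>k. k \<in> K - {0} \<Longrightarrow> lin K q (\<lambda>_. 1) k = 0"
    using exists_Gaussian_rotation[OF K(1,2)] by blast
  \<comment> \<open>The image of the all-ones vector is concentrated at 0, and the transpose of
    \<open>q\<close> brings it back; so every entry of row 0 times the same number is 1.\<close>
  have q0: "q 0 i = q 0 0" if "i \<in> K" for i
  proof -
    define \<rho> where "\<rho> = lin K q (\<lambda>_. 1) 0"
    have "q 0 i * \<rho> = 1" if "i \<in> K" for i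
    proof -
      have "1 = (\<Sum>k\<in>K. q k i * lin K q (\<lambda>_. 1) k)" by (rule sum_lin_transpose[OF K(1) q(1) that, symmetric])
      also have "\<dots> = q 0 i * \<rho> + (\<Sum>k\<in>K - {0}. q k i * lin K q (\<lambda>_. 1) k)"
        using K by (simp add: sum.remove \<rho>_def)
      also have "(\<Sum>k\<in>K - {0}. q k i * lin K q (\<lambda>_. 1) k) = 0" using q(3) by (intro sum.neutral) auto
      finally show ?thesis by simp
    qed
    from this[OF that] this[OF K(2)] show ?thesis by (metis mult_cancel_right mult_zero_right zero_neq_one)
  qed
  have sumK: "(\<Sum>k\<in>K. h k) = (\<Sum>i'\<in>UNIV. h (\<sigma> i'))" if "h 0 = 0" for h :: "nat \<Rightarrow> real"
  proof -
    have "(\<Sum>k\<in>K. h k) = (\<Sum>k\<in>K - {0}. h k)" using K that by (simp add: sum.remove)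
    also have "\<dots> = (\<Sum>i'\<in>UNIV. h (\<sigma> i'))" unfolding im[symmetric] by (simp add: sum.reindex[OF inj])
    finally show ?thesis .
  qed
  \<comment> \<open>Its rows are the differences of column \<open>\<sigma> i\<close> and column 0 of
    \<open>q\<close>. The entry at \<open>l = 0\<close> vanishes by \<open>q0\<close> and may be
    left out; orthonormality makes the inner products 1, plus 1 on the diagonal.\<close>
  define A :: "real^'i^'i" where "A = (\<chi> i i'. q (\<sigma> i') (\<sigma> i) - q (\<sigma> i') 0)"
  have AAT: "A ** transpose A = (\<chi> i k. if i \<in> UNIV then of_bool (i = k) + 1 else of_bool (i = k))"
  proof -
    have "(\<Sum>l\<in>UNIV. A $ i $ l * A $ k $ l) = of_bool (i = k) + 1" for i k
    proof -
      have "(\<Sum>l\<in>UNIV. A $ i $ l * A $ k $ l) = (\<Sum>l\<in>K. (q l (\<sigma> i) - q l 0) * (q l (\<sigma> k) - q l 0))"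
        using q0[OF \<sigma>K(1)] by (subst sumK) (auto simp: A_def)
      also have "\<dots> = (\<Sum>l\<in>K. q l (\<sigma> i) * q l (\<sigma> k)) - (\<Sum>l\<in>K. q l (\<sigma> i) * q l 0) - (\<Sum>l\<in>K. q l 0 * q l (\<sigma> k)) + (\<Sum>l\<in>K. q l 0 * q l 0)"
        by (simp add: sum.distrib[symmetric] sum_subtractf[symmetric] algebra_simps)
      also have "\<dots> = of_bool (\<sigma> i = \<sigma> k) - of_bool (\<sigma> i = 0) - of_bool (0 = \<sigma> k) + of_bool (0 = (0::nat))"
        using q(1) \<sigma>K K unfolding orthonormal_columns_def by (simp only: )
      also have "\<dots> = of_bool (i = k) + 1" using \<sigma>K(2)[of i] \<sigma>K(2)[of k] inj by (auto simp: inj_eq)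
      finally show ?thesis .
    qed
    thus ?thesis by (simp add: matrix_matrix_mult_def transpose_def vec_eq_iff)
  qed
  have detA: "det A * det A = real (r + 1)"
  proof -
    have "det A * det A = det (A ** transpose A)" by (simp add: det_mul det_transpose)
    also have "\<dots> = 1 + 1 * real (card (UNIV :: 'i set))"
      unfolding AAT by (rule det_identity_add_const_rows)
    finally show ?thesis by (simp add: r_def)
  qed
  define R where "R = (\<lambda>x. \<lambda>k\<in>K. \<lambda>j\<in>J. \<Sum>i\<in>K. q k i * x i j :: real)"
  note R = distr_rotate_vertices[OF K(1,3) J(1) Jne q(2), folded R_def]
  have edge: "x (\<sigma> i) j - x 0 j = (\<Sum>l\<in>UNIV. A $ i $ l * R x (\<sigma> l) j)" if j: "j \<in> J" for x i j
  proof -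
    have Rx: "R x k j = lin K q (\<lambda>i. x i j) k" if "k \<in> K" for k
      using that j by (simp add: R_def lin_def)
    have "x (\<sigma> i) j - x 0 j = (\<Sum>k\<in>K. q k (\<sigma> i) * lin K q (\<lambda>i. x i j) k) - (\<Sum>k\<in>K. q k 0 * lin K q (\<lambda>i. x i j) k)"
      by (simp add: sum_lin_transpose[OF K(1) q(1)] \<sigma>K K)
    also have "\<dots> = (\<Sum>k\<in>K. (q k (\<sigma> i) - q k 0) * lin K q (\<lambda>i. x i j) k)"
      by (simp add: sum_subtractf[symmetric] algebra_simps)
    also have "\<dots> = (\<Sum>l\<in>UNIV. A $ i $ l * lin K q (\<lambda>i. x i j) (\<sigma> l))"
      using q0[OF \<sigma>K(1)] by (subst sumK) (auto simp: A_def)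
    also have "\<dots> = (\<Sum>l\<in>UNIV. A $ i $ l * R x (\<sigma> l) j)" using Rx \<sigma>K by simp
    finally show ?thesis .
  qed
  have main: "gdet UNIV (gram J (\<lambda>i j. x (\<sigma> i) j - x 0 j)) = real (r + 1) * gdet UNIV (gram J (\<lambda>i. R x (\<sigma> i)))" for x
  proof -
    define G :: "real^'i^'i" where "G = (\<chi> i k. gram J (\<lambda>i. R x (\<sigma> i)) i k)"
    have "gram J (\<lambda>i j. x (\<sigma> i) j - x 0 j) i k = (A ** G ** transpose A) $ i $ k" for i k
    proof -
      have "gram J (\<lambda>i j. x (\<sigma> i) j - x 0 j) i k =
         (\<Sum>j\<in>J. (\<Sum>l\<in>UNIV. A $ i $ l * R x (\<sigma> l) j) * (\<Sum>m\<in>UNIV. A $ k $ m * R x (\<sigma> m) j))"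
        unfolding gram_def by (intro sum.cong refl) (simp add: edge)
      also have "\<dots> = (\<Sum>j\<in>J. \<Sum>m\<in>UNIV. \<Sum>l\<in>UNIV. A $ i $ l * (R x (\<sigma> l) j * R x (\<sigma> m) j) * A $ k $ m)"
        by (simp add: sum_distrib_left sum_distrib_right mult_ac)
      also have "\<dots> = (\<Sum>m\<in>UNIV. \<Sum>l\<in>UNIV. \<Sum>j\<in>J. A $ i $ l * (R x (\<sigma> l) j * R x (\<sigma> m) j) * A $ k $ m)"
        by (subst sum.swap, intro sum.cong refl, subst sum.swap) (rule refl)
      also have "\<dots> = (A ** G ** transpose A) $ i $ k"
        by (simp add: matrix_matrix_mult_def transpose_def G_def gram_def sum_distrib_left sum_distrib_right mult_ac)
      finally show ?thesis .
    qed
    hence "(\<chi> i k. gram J (\<lambda>i j. x (\<sigma> i) j - x 0 j) i k) = A ** G ** transpose A"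
      by (simp add: vec_eq_iff)
    hence "gdet UNIV (gram J (\<lambda>i j. x (\<sigma> i) j - x 0 j)) = det (A ** G ** transpose A)"
      unfolding gdet_UNIV by (simp only:)
    also have "\<dots> = (det A * det A) * det G" by (simp add: det_mul det_transpose)
    finally show ?thesis unfolding detA by (simp add: gdet_UNIV G_def)
  qed
  have gm: "(\<lambda>z. f (real (r + 1) * gdet UNIV (gram J z))) \<in> borel_measurable (PiM (UNIV :: 'i set) (\<lambda>_. gauss J))"
    by (rule measurable_compose[OF borel_measurable_times[OF borel_measurable_const measurable_gdet_gram[where z = "\<lambda>z. z"]] f])
       (rule measurable_PiM_gauss_entry)
  define h where "h = (\<lambda>y. f (real (r + 1) * gdet UNIV (gram J (\<lambda>i. y (\<sigma> i)))))"
  have hm: "h \<in> borel_measurable (PiM K (\<lambda>_. gauss J))"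
    unfolding h_def
    by (rule measurable_compose[OF borel_measurable_times[OF borel_measurable_const measurable_gdet_gram[where z = "\<lambda>y i. y (\<sigma> i)"]] f])
       (rule measurable_PiM_gauss_entry, rule \<sigma>K)
  have "(\<integral>\<^sup>+x. f (gdet UNIV (gram J (\<lambda>i j. x (\<sigma> i) j - x 0 j))) \<partial>PiM {..r} (\<lambda>_. gauss J)) =
     (\<integral>\<^sup>+x. h (R x) \<partial>PiM K (\<lambda>_. gauss J))"
    unfolding main h_def K_def ..
  also have "\<dots> = (\<integral>\<^sup>+y. h y \<partial>distr (PiM K (\<lambda>_. gauss J)) (PiM K (\<lambda>_. gauss J)) R)"
    by (rule nn_integral_distr[symmetric, OF R(2)]) (simp only: measurable_distr_eq1 hm)
  also have "\<dots> = (\<integral>\<^sup>+y. h y \<partial>PiM K (\<lambda>_. gauss J))" unfolding R(1) ..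
  also have "\<dots> = (\<integral>\<^sup>+y. (\<lambda>z. f (real (r + 1) * gdet UNIV (gram J z))) (\<lambda>i\<in>UNIV. y (\<sigma> i)) \<partial>PiM K (\<lambda>_. gauss J))"
    unfolding h_def restrict_UNIV ..
  also have "\<dots> = (\<integral>\<^sup>+z. f (real (r + 1) * gdet UNIV (gram J z)) \<partial>distr (PiM K (\<lambda>_. gauss J)) (PiM UNIV (\<lambda>_. gauss J)) (\<lambda>y. \<lambda>i\<in>UNIV. y (\<sigma> i)))"
  proof (rule nn_integral_distr[symmetric])
    show "(\<lambda>y. \<lambda>i\<in>UNIV. y (\<sigma> i)) \<in> PiM K (\<lambda>_. gauss J) \<rightarrow>\<^sub>M PiM UNIV (\<lambda>_. gauss J)"
      by (rule measurable_restrict, rule measurable_component_singleton, rule \<sigma>K)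
  qed (simp only: measurable_distr_eq1 gm)
  also have "distr (PiM K (\<lambda>_. gauss J)) (PiM UNIV (\<lambda>_. gauss J)) (\<lambda>y. \<lambda>i\<in>UNIV. y (\<sigma> i)) = PiM UNIV (\<lambda>_. gauss J)"
    using distr_PiM_reindex[of K "\<lambda>_. gauss J" \<sigma> UNIV] inj \<sigma>K(1) prob_space_gauss by auto
  also have "(\<integral>\<^sup>+z. f (real (r + 1) * gdet UNIV (gram J z)) \<partial>PiM (UNIV :: 'i set) (\<lambda>_. gauss J)) =
     (\<integral>\<^sup>+g. f (real (r + 1) * (\<Prod>j<card (UNIV :: 'i set). 2 * g j)) \<partial>PiM {..<card (UNIV :: 'i set)} (\<lambda>j. gamma_law (real (d + Suc j) / 2)))"
    by (rule nn_integral_gdet_gram[of J "UNIV :: 'i set" d "\<lambda>u. f (real (r + 1) * u)", OF J])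
       (rule measurable_compose[OF borel_measurable_times[OF borel_measurable_const measurable_ident_sets[OF refl]] f])
  finally show ?thesis by (simp add: r_def)
qed


subsection \<open>Volumes of simplices\<close>

text \<open>Leibniz's formula for the squared distance from a weighted mean, in one coordinate. The
  weights may be negative.\<close>

lemma square_diff_weighted_sum:
  fixes u a :: "'i \<Rightarrow> real" and y :: real
  assumes u: "(\<Sum>i\<in>I. u i) = 1"
  shows "(y - (\<Sum>i\<in>I. u i * a i))\<^sup>2 =
    (\<Sum>i\<in>I. u i * (y - a i)\<^sup>2) - (\<Sum>i\<in>I. \<Sum>k\<in>I. u i * u k * (a i - a k)\<^sup>2) / 2"
proof -
  define m where "m = (\<Sum>i\<in>I. u i * a i)"
  define s where "s = (\<Sum>i\<in>I. u i * (a i)\<^sup>2)"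
  have 1: "(\<Sum>i\<in>I. u i * (y - a i)\<^sup>2) = y\<^sup>2 - 2 * y * m + s"
  proof -
    have "(\<Sum>i\<in>I. u i * (y - a i)\<^sup>2) = (\<Sum>i\<in>I. y\<^sup>2 * u i - 2 * y * (u i * a i) + u i * (a i)\<^sup>2)"
      by (intro sum.cong refl) (simp add: power2_eq_square algebra_simps)
    thus ?thesis by (simp add: sum.distrib sum_subtractf sum_distrib_left[symmetric] u m_def s_def)
  qed
  have 2: "(\<Sum>i\<in>I. \<Sum>k\<in>I. u i * u k * (a i - a k)\<^sup>2) = 2 * s - 2 * m\<^sup>2"
  proof -
    have "(\<Sum>k\<in>I. u i * u k * (a i - a k)\<^sup>2) = u i * (a i)\<^sup>2 - 2 * m * (u i * a i) + s * u i" for i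
    proof -
      have "(\<Sum>k\<in>I. u i * u k * (a i - a k)\<^sup>2) =
          (\<Sum>k\<in>I. (u i * (a i)\<^sup>2) * u k - (2 * (u i * a i)) * (u k * a k) + u i * (u k * (a k)\<^sup>2))"
        by (intro sum.cong refl) (simp add: power2_eq_square algebra_simps)
      also have "\<dots> = (u i * (a i)\<^sup>2) * (\<Sum>k\<in>I. u k) - (2 * (u i * a i)) * m + u i * s"
        unfolding m_def s_def by (simp add: sum.distrib sum_subtractf sum_distrib_left)
      finally show ?thesis by (simp add: u mult_ac)
    qed
    hence "(\<Sum>i\<in>I. \<Sum>k\<in>I. u i * u k * (a i - a k)\<^sup>2) = s - 2 * m * m + s * 1"
      by (simp add: sum.distrib sum_subtractf sum_distrib_left[symmetric] u m_def[symmetric] s_def[symmetric])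
    thus ?thesis by (simp add: power2_eq_square)
  qed
  show ?thesis unfolding 1 2 m_def[symmetric] by (simp add: power2_eq_square field_simps)
qed

lemma sum_square_diff_weighted_sum:
  fixes u :: "'i \<Rightarrow> real" and a :: "'i \<Rightarrow> 'l \<Rightarrow> real"
  assumes u: "(\<Sum>i\<in>I. u i) = 1"
  shows "(\<Sum>l\<in>L. (y l - (\<Sum>i\<in>I. u i * a i l))\<^sup>2) =
     (\<Sum>i\<in>I. u i * (\<Sum>l\<in>L. (y l - a i l)\<^sup>2)) - (\<Sum>i\<in>I. \<Sum>k\<in>I. u i * u k * (\<Sum>l\<in>L. (a i l - a k l)\<^sup>2)) / 2"
proof -
  have "(\<Sum>l\<in>L. (y l - (\<Sum>i\<in>I. u i * a i l))\<^sup>2) =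
    (\<Sum>l\<in>L. \<Sum>i\<in>I. u i * (y l - a i l)\<^sup>2) - (\<Sum>l\<in>L. \<Sum>i\<in>I. \<Sum>k\<in>I. u i * u k * (a i l - a k l)\<^sup>2) / 2"
    by (simp add: square_diff_weighted_sum[OF u] sum_subtractf sum_divide_distrib)
  also have "(\<Sum>l\<in>L. \<Sum>i\<in>I. u i * (y l - a i l)\<^sup>2) = (\<Sum>i\<in>I. u i * (\<Sum>l\<in>L. (y l - a i l)\<^sup>2))"
    by (subst sum.swap) (simp add: sum_distrib_left)
  also have "(\<Sum>l\<in>L. \<Sum>i\<in>I. \<Sum>k\<in>I. u i * u k * (a i l - a k l)\<^sup>2) = (\<Sum>i\<in>I. \<Sum>l\<in>L. \<Sum>k\<in>I. u i * u k * (a i l - a k l)\<^sup>2)"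
    by (rule sum.swap)
  also have "\<dots> = (\<Sum>i\<in>I. \<Sum>k\<in>I. u i * u k * (\<Sum>l\<in>L. (a i l - a k l)\<^sup>2))"
    by (intro sum.cong refl, subst sum.swap) (simp add: sum_distrib_left)
  finally show ?thesis .
qed

section \<open>Isometric charts and the pullback of a simplex\<close>

lemma dist_vec_power2: "(dist p q)\<^sup>2 = (\<Sum>k\<in>UNIV. (p $ k - q $ k)\<^sup>2)" for p q :: "real^'n"
  by (simp add: dist_norm norm_vec_def L2_set_def sum_nonneg)

lemma isometric_chart_power2:
  assumes "isometric_chart n f"
  shows "(\<Sum>j<n. (f p j - f q j)\<^sup>2) = (dist p q)\<^sup>2"
proof -
  have "dist p q = sqrt (\<Sum>j<n. (f p j - f q j)\<^sup>2)"
    using assms by (simp add: isometric_chart_def L2_set_def)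
  thus ?thesis by (simp add: sum_nonneg)
qed

lemma isometric_chart_inj:
  assumes "isometric_chart n f" shows "inj f"
proof (rule injI)
  fix p q assume "f p = f q"
  hence "(dist p q)\<^sup>2 = 0" using isometric_chart_power2[OF assms, of p q] by simp
  thus "p = q" by simp
qed

text \<open>An isometry preserves affine combinations, because the squared distance of a point from
  \<open>\<Sum>i. u i * p i\<close> is a function of its distances from the \<open>p i\<close> and of the mutual distances of the \<open>p i\<close>.\<close>

lemma isometric_chart_affine:
  fixes f :: "real^'n \<Rightarrow> nat \<Rightarrow> real" and u :: "'b \<Rightarrow> real"
  assumes f: "isometric_chart n f" and u: "(\<Sum>i\<in>I. u i) = 1"
  shows "f (\<Sum>i\<in>I. u i *\<^sub>R p i) = (\<lambda>j\<in>{..<n}. \<Sum>i\<in>I. u i * f (p i) j)"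
proof -
  define q where "q = (\<Sum>i\<in>I. u i *\<^sub>R p i)"
  have "(\<Sum>j<n. (f q j - (\<Sum>i\<in>I. u i * f (p i) j))\<^sup>2) =
     (\<Sum>i\<in>I. u i * (dist q (p i))\<^sup>2) - (\<Sum>i\<in>I. \<Sum>k\<in>I. u i * u k * (dist (p i) (p k))\<^sup>2) / 2"
    using sum_square_diff_weighted_sum[OF u, where L = "{..<n}" and y = "f q" and a = "\<lambda>i. f (p i)"] unfolding isometric_chart_power2[OF f] .
  also have "\<dots> = (\<Sum>k\<in>UNIV. (q $ k - (\<Sum>i\<in>I. u i * p i $ k))\<^sup>2)"
    using sum_square_diff_weighted_sum[OF u, where L = UNIV and y = "\<lambda>k. q $ k" and a = "\<lambda>i k. p i $ k"] unfolding dist_vec_power2[symmetric] by simp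
  also have "\<dots> = 0" by (simp add: q_def)
  finally have "\<forall>j<n. f q j = (\<Sum>i\<in>I. u i * f (p i) j)"
    by (subst (asm) sum_nonneg_eq_0_iff) auto
  moreover have "f q \<in> extensional {..<n}" using f by (auto simp: isometric_chart_def)
  ultimately show ?thesis unfolding q_def[symmetric] by (auto simp: fun_eq_iff extensional_def)
qed

text \<open>Polarization: inner products relative to a base point are functions of mutual distances,
  which the chart preserves.\<close>

lemma isometric_chart_inner:
  fixes f :: "real^'n \<Rightarrow> nat \<Rightarrow> real"
  assumes f: "isometric_chart n f"
  shows "(\<Sum>j<n. (f p j - f c0 j) * (f q j - f c0 j)) = (\<Sum>k\<in>UNIV. (p $ k - c0 $ k) * (q $ k - c0 $ k))"
proof -
  have e: "a * b = (a\<^sup>2 + b\<^sup>2 - (a - b)\<^sup>2) / 2" for a b :: real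
    by (simp add: power2_eq_square algebra_simps)
  have "(\<Sum>j<n. (f p j - f c0 j) * (f q j - f c0 j)) = ((dist p c0)\<^sup>2 + (dist q c0)\<^sup>2 - (dist p q)\<^sup>2) / 2"
    unfolding e isometric_chart_power2[OF f, symmetric]
    by (simp add: sum.distrib sum_subtractf sum_divide_distrib[symmetric])
  also have "\<dots> = (\<Sum>k\<in>UNIV. (p $ k - c0 $ k) * (q $ k - c0 $ k))"
    unfolding e dist_vec_power2
    by (simp add: sum.distrib sum_subtractf sum_divide_distrib[symmetric])
  finally show ?thesis .
qed

text \<open>The weights are indexed by vertex numbers rather than by points, so coinciding vertices
  are covered and the description matches \<open>simplex_hull\<close>.\<close>

lemma convex_hull_image_atMost:
  fixes p :: "nat \<Rightarrow> 'a::real_vector"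
  shows "convex hull (p ` {..r}) = {\<Sum>i\<le>r. u i *\<^sub>R p i | u. (\<forall>i\<le>r. 0 \<le> u i) \<and> (\<Sum>i\<le>r. u i) = 1}" (is "_ = ?C")
proof
  show "convex hull (p ` {..r}) \<subseteq> ?C"
  proof (rule hull_minimal)
    show "p ` {..r} \<subseteq> ?C"
    proof safe
      fix i assume i: "i \<le> r"
      have "(\<Sum>k\<le>r. of_bool (k = i) *\<^sub>R p k) = p i"
        using i by (simp add: of_bool_def if_distrib[of "\<lambda>c. c *\<^sub>R _"] sum.delta cong: if_cong)
      moreover have "(\<Sum>k\<le>r. of_bool (k = i) :: real) = 1"
        using i by (simp add: of_bool_def sum.delta)
      ultimately show "\<exists>u. p i = (\<Sum>k\<le>r. u k *\<^sub>R p k) \<and> (\<forall>k\<le>r. 0 \<le> u k) \<and> (\<Sum>k\<le>r. u k) = 1"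
        by (intro exI[of _ "\<lambda>k. of_bool (k = i)"]) auto
    qed
    show "convex ?C"
    proof (rule convexI)
      fix x y :: 'a and a b :: real
      assume xy: "x \<in> ?C" "y \<in> ?C" and ab: "0 \<le> a" "0 \<le> b" "a + b = 1"
      then obtain u v where u: "x = (\<Sum>i\<le>r. u i *\<^sub>R p i)" "\<forall>i\<le>r. 0 \<le> u i" "(\<Sum>i\<le>r. u i) = 1"
        and v: "y = (\<Sum>i\<le>r. v i *\<^sub>R p i)" "\<forall>i\<le>r. 0 \<le> v i" "(\<Sum>i\<le>r. v i) = 1" by auto
      have "a *\<^sub>R x + b *\<^sub>R y = (\<Sum>i\<le>r. (a * u i + b * v i) *\<^sub>R p i)"
        by (simp add: u v scaleR_sum_right sum.distrib scaleR_add_left)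
      moreover have "(\<Sum>i\<le>r. a * u i + b * v i) = 1"
        by (simp add: sum.distrib sum_distrib_left[symmetric] u v ab)
      ultimately show "a *\<^sub>R x + b *\<^sub>R y \<in> ?C"
        using u v ab by (intro CollectI exI[of _ "\<lambda>i. a * u i + b * v i"]) auto
    qed
  qed
  show "?C \<subseteq> convex hull (p ` {..r})"
  proof safe
    fix u :: "nat \<Rightarrow> real" assume "\<forall>i\<le>r. 0 \<le> u i" "(\<Sum>i\<le>r. u i) = 1"
    thus "(\<Sum>i\<le>r. u i *\<^sub>R p i) \<in> convex hull (p ` {..r})"
      by (intro convex_sum) (auto simp: hull_inc)
  qed
qed

lemma vimage_simplex_hull:
  fixes f :: "real^'n \<Rightarrow> nat \<Rightarrow> real"
  assumes f: "isometric_chart n f" and p: "\<And>i. i \<le> r \<Longrightarrow> f (p i) = x i"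
  shows "f -` simplex_hull n r x = convex hull (p ` {..r})"
proof -
  have aff: "f (\<Sum>i\<le>r. u i *\<^sub>R p i) = (\<lambda>j\<in>{..<n}. \<Sum>i\<le>r. u i * x i j)" if "(\<Sum>i\<le>r. u i) = 1" for u
    unfolding isometric_chart_affine[OF f that] using p by (auto simp: fun_eq_iff)
  have inj: "f a = f b \<longleftrightarrow> a = b" for a b using isometric_chart_inj[OF f] by (auto dest: injD)
  show ?thesis
    unfolding convex_hull_image_atMost
  proof (intro set_eqI iffI)
    fix y assume "y \<in> f -` simplex_hull n r x"
    then obtain u where u: "f y = (\<lambda>j\<in>{..<n}. \<Sum>i\<le>r. u i * x i j)" "\<forall>i\<le>r. 0 \<le> u i" "(\<Sum>i\<le>r. u i) = 1"
      unfolding simplex_hull_def by blast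
    have "y = (\<Sum>i\<le>r. u i *\<^sub>R p i)" using u(1) by (simp only: aff[OF u(3), symmetric] inj)
    thus "y \<in> {\<Sum>i\<le>r. u i *\<^sub>R p i | u. (\<forall>i\<le>r. 0 \<le> u i) \<and> (\<Sum>i\<le>r. u i) = 1}" using u by blast
  next
    fix y assume "y \<in> {\<Sum>i\<le>r. u i *\<^sub>R p i | u. (\<forall>i\<le>r. 0 \<le> u i) \<and> (\<Sum>i\<le>r. u i) = 1}"
    then obtain u where u: "y = (\<Sum>i\<le>r. u i *\<^sub>R p i)" "\<forall>i\<le>r. 0 \<le> u i" "(\<Sum>i\<le>r. u i) = 1" by blast
    have "f y = (\<lambda>j\<in>{..<n}. \<Sum>i\<le>r. u i * x i j)" unfolding u(1) by (rule aff[OF u(3)])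
    thus "y \<in> f -` simplex_hull n r x" unfolding simplex_hull_def using u by blast
  qed
qed

text \<open>The simplex is a translate of a linear image of the standard simplex, whose content is
  the reciprocal of the factorial. Degenerate edges are included, with both sides equal to
  0.\<close>

lemma measure_convex_hull_simplex:
  fixes p0 :: "(real, 'n::{finite,wellorder}) vec" and e :: "'n \<Rightarrow> (real, 'n) vec"
  shows "measure lebesgue (convex hull (insert p0 (range (\<lambda>i. p0 + e i)))) = \<bar>det (\<chi> i. e i)\<bar> / fact CARD('n)"
proof -
  define M :: "((real, 'n) vec, 'n) vec" where "M = transpose (\<chi> i. e i)"
  define g where "g = (\<lambda>x. M *v x)"
  have [simp]: "M *v axis i 1 = e i" for i :: 'n
    by (simp add: M_def matrix_vector_mult_basis column_def transpose_def vec_eq_iff)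
  define std where "std = (convex hull insert 0 Basis :: (real, 'n) vec set)"
  have compact: "compact std" unfolding std_def
    by (intro finite_imp_compact_convex_hull) auto
  have "insert p0 (range (\<lambda>i. p0 + e i)) = (+) p0 ` (insert 0 (range e))" by auto
  hence "convex hull (insert p0 (range (\<lambda>i. p0 + e i))) = (+) p0 ` (convex hull (insert 0 (range e)))"
    by (simp only: convex_hull_translation)
  hence "measure lebesgue (convex hull (insert p0 (range (\<lambda>i. p0 + e i)))) = measure lebesgue (convex hull (insert 0 (range e)))"
    by (simp only: measure_translation)
  also have "insert 0 (range e) = g ` insert 0 Basis"
    by (auto simp: g_def Basis_vec_def image_iff)
  also have "convex hull (g ` insert 0 Basis) = g ` std"
    unfolding std_def by (rule convex_hull_linear_image[symmetric]) (auto simp: g_def)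
  also have "measure lebesgue (g ` std) = \<bar>det M\<bar> * measure lebesgue std"
    using compact
    by (subst measure_lebesgue_linear_transformation)
       (auto intro: finite_imp_bounded_convex_hull dest: compact_imp_closed simp: g_def std_def)
  also have "measure lebesgue std = measure lborel std" using compact
    by (intro measure_completion) (auto dest: compact_imp_closed)
  also have "measure lborel std = 1 / fact CARD('n)" unfolding std_def
    by (simp add: content_std_simplex)
  finally show ?thesis by (simp add: M_def det_transpose)
qed

text \<open>The change of variables theorem for linear maps on \<open>real^'n\<close> asks for an index type with a
  well-order; a copy of an arbitrary finite type carries one.\<close>

typedef 'a well_ordered = "UNIV :: 'a set" by simp

instance well_ordered :: (finite) finite
proof
  have "inj (Rep_well_ordered :: 'a well_ordered \<Rightarrow> 'a)" by (simp add: inj_def Rep_well_ordered_inject)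
  moreover have "finite (range (Rep_well_ordered :: 'a well_ordered \<Rightarrow> 'a))" by (rule finite)
  ultimately show "finite (UNIV :: 'a well_ordered set)" by (rule finite_imageD[rotated])
qed

definition well_ordered_index :: "'a::finite well_ordered \<Rightarrow> nat" where
  "well_ordered_index = (SOME f. inj f)"

lemma inj_well_ordered_index: "inj (well_ordered_index :: 'a::finite well_ordered \<Rightarrow> nat)"
proof -
  have "\<exists>f :: 'a well_ordered \<Rightarrow> nat. inj f"
    using finite_imp_inj_to_nat_seg[of "UNIV :: 'a well_ordered set"] by auto
  thus ?thesis unfolding well_ordered_index_def by (rule someI_ex)
qed

instantiation well_ordered :: (finite) wellorder
begin

definition less_eq_well_ordered :: "'a well_ordered \<Rightarrow> 'a well_ordered \<Rightarrow> bool" where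
  "less_eq_well_ordered x y \<longleftrightarrow> well_ordered_index x \<le> well_ordered_index y"

definition less_well_ordered :: "'a well_ordered \<Rightarrow> 'a well_ordered \<Rightarrow> bool" where
  "less_well_ordered x y \<longleftrightarrow> well_ordered_index x < well_ordered_index y"

instance
proof
  fix P :: "'a well_ordered \<Rightarrow> bool" and a
  assume *: "\<And>x. (\<And>y. y < x \<Longrightarrow> P y) \<Longrightarrow> P x"
  show "P a"
    by (induction a rule: measure_induct_rule[of well_ordered_index]) (rule *, simp add: less_well_ordered_def)
qed (auto simp: less_eq_well_ordered_def less_well_ordered_def inj_eq[OF inj_well_ordered_index])

end

lemma bij_Rep_well_ordered: "bij (Rep_well_ordered :: 'a well_ordered \<Rightarrow> 'a)"
  by (rule bij_betwI[of _ _ _ Abs_well_ordered]) (simp_all add: Rep_well_ordered_inverse Abs_well_ordered_inverse)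

lemma card_well_ordered: "CARD('a::finite well_ordered) = CARD('a)"
  using bij_betw_same_card[OF bij_Rep_well_ordered[where 'a = 'a]] .

section \<open>Lebesgue measure under a change of index type\<close>

definition reindex_vec :: "real^'a \<Rightarrow> real^('a::finite well_ordered)" where
  "reindex_vec v = (\<chi> i. v $ Rep_well_ordered i)"

definition unindex_vec :: "real^('a::finite well_ordered) \<Rightarrow> real^'a" where
  "unindex_vec v = (\<chi> i. v $ Abs_well_ordered i)"

lemma reindex_unindex_vec [simp]: "reindex_vec (unindex_vec v) = v" "unindex_vec (reindex_vec w) = w"
  by (simp_all add: reindex_vec_def unindex_vec_def vec_eq_iff Rep_well_ordered_inverse Abs_well_ordered_inverse)

lemma dist_unindex_vec: "dist (unindex_vec v) (unindex_vec w) = dist v w"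
proof -
  have "(dist v w)\<^sup>2 = (\<Sum>k\<in>UNIV. (unindex_vec v $ Rep_well_ordered k - unindex_vec w $ Rep_well_ordered k)\<^sup>2)"
    by (simp add: dist_vec_power2 unindex_vec_def Rep_well_ordered_inverse)
  also have "\<dots> = (dist (unindex_vec v) (unindex_vec w))\<^sup>2"
    unfolding dist_vec_power2 by (rule sum.reindex_bij_betw[OF bij_Rep_well_ordered])
  finally show ?thesis by (metis zero_le_dist power2_eq_iff_nonneg)
qed

text \<open>Renaming coordinates maps boxes to boxes with the same side lengths, and Lebesgue
  measure is determined by its values on boxes.\<close>

lemma distr_lborel_reindex_vec: "distr lborel borel (reindex_vec :: real^'a::finite \<Rightarrow> _) = lborel"
proof (rule lborel_eqI[symmetric])
  have lin: "linear (reindex_vec :: real^'a \<Rightarrow> _)"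
    by (rule linearI) (simp_all add: reindex_vec_def vec_eq_iff)
  have [measurable]: "(reindex_vec :: real^'a \<Rightarrow> _) \<in> borel_measurable borel"
    by (intro borel_measurable_continuous_onI linear_continuous_on linear_conv_bounded_linear[THEN iffD1] lin)
  fix l u :: "real^'a well_ordered" assume le: "\<And>b. b \<in> Basis \<Longrightarrow> l \<bullet> b \<le> u \<bullet> b"
  have le': "l $ i \<le> u $ i" for i using le[of "axis i 1"] by (simp add: inner_axis axis_in_Basis_iff)
  have box: "reindex_vec -` box l u = box (unindex_vec l) (unindex_vec u)"
  proof -
    have "(\<forall>i. l $ i < v $ Rep_well_ordered i \<and> v $ Rep_well_ordered i < u $ i) \<longleftrightarrow>
       (\<forall>i. l $ Abs_well_ordered i < v $ i \<and> v $ i < u $ Abs_well_ordered i)" for v :: "real^'a"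
      by (metis Rep_well_ordered_inverse Abs_well_ordered_inverse UNIV_I)
    thus ?thesis by (auto simp: mem_box_cart reindex_vec_def unindex_vec_def)
  qed
  have prodB: "(\<Prod>b\<in>Basis. (v - w) \<bullet> b) = (\<Prod>i\<in>UNIV. v $ i - w $ i)" for v w :: "real^'n"
  proof -
    have B: "(Basis :: (real^'n) set) = (\<lambda>i. axis i 1) ` UNIV" by (auto simp: Basis_vec_def)
    have inj: "inj (\<lambda>i. axis i 1 :: real^'n)" by (auto simp: inj_def axis_eq_axis)
    show ?thesis unfolding B by (subst prod.reindex[OF inj]) (simp add: inner_axis)
  qed
  have "emeasure (distr lborel borel reindex_vec) (box l u) = emeasure lborel (box (unindex_vec l) (unindex_vec u))"
    by (simp add: emeasure_distr box)
  also have "\<dots> = ennreal (\<Prod>b\<in>Basis. (unindex_vec u - unindex_vec l) \<bullet> b)"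
  proof (rule emeasure_lborel_box)
    fix b :: "real^'a" assume "b \<in> Basis"
    thus "unindex_vec l \<bullet> b \<le> unindex_vec u \<bullet> b"
      using le' by (auto simp: Basis_vec_def inner_axis unindex_vec_def)
  qed
  also have "(\<Prod>b\<in>Basis. (unindex_vec u - unindex_vec l) \<bullet> b) = (\<Prod>i\<in>UNIV. u $ i - l $ i)"
    unfolding prodB by (subst prod.reindex_bij_betw[OF bij_Rep_well_ordered, symmetric])
       (simp add: unindex_vec_def Rep_well_ordered_inverse)
  finally show "emeasure (distr lborel borel reindex_vec) (box l u) = ennreal (\<Prod>b\<in>Basis. (u - l) \<bullet> b)"
    unfolding prodB .
qed simp

lemma measure_unindex_vec_vimage:
  fixes A :: "(real^'a::finite) set"
  assumes "compact (unindex_vec -` A)"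
  shows "measure lebesgue A = measure lebesgue (unindex_vec -` A)"
proof -
  let ?B = "unindex_vec -` A"
  \<comment> \<open>Compactness provides a Borel set, on which Lebesgue measure and its completion
    agree.\<close>
  have B: "?B \<in> sets borel" using assms by (simp add: borel_compact)
  have lin: "linear (reindex_vec :: real^'a \<Rightarrow> _)"
    by (rule linearI) (simp_all add: reindex_vec_def vec_eq_iff)
  have [measurable]: "(reindex_vec :: real^'a \<Rightarrow> _) \<in> borel_measurable borel"
    by (intro borel_measurable_continuous_onI linear_continuous_on linear_conv_bounded_linear[THEN iffD1] lin)
  have A: "A = reindex_vec -` ?B" by auto
  have "reindex_vec -` ?B \<inter> space borel \<in> sets borel" by (rule measurable_sets[OF _ B]) measurable
  hence "A \<in> sets borel" by (simp add: A[symmetric])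
  hence "measure lebesgue A = measure lborel A" by (simp add: measure_completion)
  also have "\<dots> = measure (distr lborel borel reindex_vec) ?B"
    using B by (subst measure_distr) (simp_all add: A[symmetric])
  also have "\<dots> = measure lebesgue ?B"
    unfolding distr_lborel_reindex_vec using B by (simp add: measure_completion)
  finally show ?thesis .
qed

text \<open>Gram-Schmidt orthogonalization that tolerates dependent vectors: when a residual
  vanishes, any unit vector orthogonal to the previous ones is inserted, for which the cardinality
  assumption leaves room.\<close>

lemma orthonormal_basis_containing_span:
  fixes e :: "'i \<Rightarrow> 'j \<Rightarrow> real"
  assumes I: "finite I" and J: "finite J" and card: "card I \<le> card J"
  shows "\<exists>b. (\<forall>i\<in>I. \<forall>k\<in>I. (\<Sum>j\<in>J. b i j * b k j) = of_bool (i = k)) \<and>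
     (\<forall>i\<in>I. \<exists>c. \<forall>j\<in>J. e i j = (\<Sum>k\<in>I. c k * b k j))"
  using I card
proof (induction I)
  case (insert a I)
  then obtain b where b: "\<And>i k. i \<in> I \<Longrightarrow> k \<in> I \<Longrightarrow> (\<Sum>j\<in>J. b i j * b k j) = of_bool (i = k)"
    "\<forall>i\<in>I. \<exists>c. \<forall>j\<in>J. e i j = (\<Sum>k\<in>I. c k * b k j)" by fastforce
  define ip where "ip v w = (\<Sum>j\<in>J. v j * w j)" for v w :: "'j \<Rightarrow> real"
  define res where "res v j = v j - (\<Sum>k\<in>I. ip v (b k) * b k j)" for v j
  have res_orth: "ip (res v) (b i) = 0" if i: "i \<in> I" for v i
  proof -
    have "ip (res v) (b i) = (\<Sum>j\<in>J. v j * b i j - (\<Sum>k\<in>I. ip v (b k) * (b k j * b i j)))"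
      unfolding ip_def[of "res v"] by (simp add: res_def left_diff_distrib sum_distrib_right mult.assoc)
    also have "\<dots> = ip v (b i) - (\<Sum>j\<in>J. \<Sum>k\<in>I. ip v (b k) * (b k j * b i j))"
      unfolding ip_def[of v "b i"] by (rule sum_subtractf)
    also have "(\<Sum>j\<in>J. \<Sum>k\<in>I. ip v (b k) * (b k j * b i j)) = (\<Sum>k\<in>I. ip v (b k) * of_bool (k = i))"
      by (subst sum.swap) (simp add: sum_distrib_left[symmetric] b(1) i)
    also have "\<dots> = ip v (b i)"
      using i insert.hyps by (simp add: of_bool_def if_distrib[of "\<lambda>u. _ * u"] sum.delta cong: if_cong)
    finally show ?thesis by simp
  qed
  have "\<exists>v. (\<forall>i\<in>I. ip v (b i) = 0) \<and> ip v v = 1 \<and> (\<exists>s. \<forall>j\<in>J. res (e a) j = s * v j)"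
  proof (cases "\<forall>j\<in>J. res (e a) j = 0")
    case False
    define N where "N = ip (res (e a)) (res (e a))"
    have N: "N > 0"
      using False J unfolding N_def ip_def
      by (metis (no_types, lifting) less_eq_real_def mult_eq_0_iff sum_nonneg sum_nonneg_eq_0_iff zero_le_square)
    define v where "v j = res (e a) j / sqrt N" for j
    have "ip v (b i) = ip (res (e a)) (b i) / sqrt N" for i by (simp add: ip_def v_def sum_divide_distrib)
    hence "\<forall>i\<in>I. ip v (b i) = 0" using res_orth by simp
    moreover have "ip v v = N / (sqrt N * sqrt N)" by (simp add: N_def ip_def v_def sum_divide_distrib)
    hence "ip v v = 1" using N by simp
    moreover have "\<forall>j\<in>J. res (e a) j = sqrt N * v j" using N by (simp add: v_def)
    ultimately show ?thesis by blast
  next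
    case True
    \<comment> \<open>Otherwise every coordinate vector would be in the span of the previous
      \<open>b k\<close>, so the squares \<open>b k j0 * b k j0\<close> would sum to 1 over
      \<open>k\<close> for each \<open>j0\<close>. Summing over \<open>j0\<close> would give
      \<open>card J = card I\<close>, which the new index \<open>a\<close> excludes.\<close>
    have "\<exists>j0\<in>J. \<exists>j\<in>J. res (\<lambda>j. of_bool (j = j0)) j \<noteq> 0"
    proof (rule ccontr)
      assume "\<not> ?thesis"
      hence z: "res (\<lambda>j. of_bool (j = j0)) j0 = 0" if "j0 \<in> J" for j0 using that by blast
      have ip1: "ip (\<lambda>j. of_bool (j = j0)) w = w j0" if "j0 \<in> J" for w j0
        using that J by (simp add: ip_def of_bool_def if_distrib[of "\<lambda>u. u * _"] sum.delta cong: if_cong)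
      have "1 = (\<Sum>k\<in>I. b k j0 * b k j0)" if "j0 \<in> J" for j0
        using z[OF that] by (simp add: res_def ip1[OF that])
      hence "real (card J) = (\<Sum>j0\<in>J. \<Sum>k\<in>I. b k j0 * b k j0)" by simp
      also have "\<dots> = real (card I)" by (subst sum.swap) (simp add: b(1))
      finally show False using insert by simp
    qed
    then obtain j0 where j0: "\<exists>j\<in>J. res (\<lambda>j. of_bool (j = j0)) j \<noteq> 0" by blast
    define w where "w = res (\<lambda>j. of_bool (j = j0))"
    define N where "N = ip w w"
    have N: "N > 0"
      using j0 J unfolding N_def ip_def w_def
      by (metis (no_types, lifting) less_eq_real_def mult_eq_0_iff sum_nonneg sum_nonneg_eq_0_iff zero_le_square)
    define v where "v j = w j / sqrt N" for j
    have "ip v (b i) = ip w (b i) / sqrt N" for i by (simp add: ip_def v_def sum_divide_distrib)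
    hence "\<forall>i\<in>I. ip v (b i) = 0" using res_orth by (simp add: w_def)
    moreover have "ip v v = N / (sqrt N * sqrt N)" by (simp add: N_def ip_def v_def sum_divide_distrib)
    hence "ip v v = 1" using N by simp
    moreover have "\<forall>j\<in>J. res (e a) j = 0 * v j" using True by simp
    ultimately show ?thesis by blast
  qed
  then obtain v s where v: "\<forall>i\<in>I. ip v (b i) = 0" "ip v v = 1" "\<forall>j\<in>J. res (e a) j = s * v j" by blast
  define b' where "b' = b(a := v)"
  have b'I: "b' k = b k" if "k \<in> I" for k using that insert.hyps by (auto simp: b'_def)
  have "(\<Sum>j\<in>J. b' i j * b' k j) = of_bool (i = k)" if "i \<in> insert a I" "k \<in> insert a I" for i k
    using that v(1,2) b(1) insert.hyps unfolding ip_def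
    by (cases "i = a"; cases "k = a") (auto simp: b'_def mult.commute)
  moreover have "\<exists>c. \<forall>j\<in>J. e i j = (\<Sum>k\<in>insert a I. c k * b' k j)" if i: "i \<in> insert a I" for i
  proof (cases "i = a")
    case True
    have "\<forall>j\<in>J. e i j = (\<Sum>k\<in>insert a I. (if k = a then s else ip (e a) (b k)) * b' k j)"
    proof
      fix j assume j: "j \<in> J"
      have "(\<Sum>k\<in>I. (if k = a then s else ip (e a) (b k)) * b' k j) = (\<Sum>k\<in>I. ip (e a) (b k) * b k j)"
        using insert.hyps by (intro sum.cong) (auto simp: b'_def)
      moreover have "e a j = s * v j + (\<Sum>k\<in>I. ip (e a) (b k) * b k j)"
        using v(3) j by (simp add: res_def algebra_simps)
      ultimately show "e i j = (\<Sum>k\<in>insert a I. (if k = a then s else ip (e a) (b k)) * b' k j)"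
        using insert.hyps True by (simp add: b'_def)
    qed
    thus ?thesis by (intro exI[of _ "\<lambda>k. if k = a then s else ip (e a) (b k)"])
  next
    case False
    then obtain c where c: "\<forall>j\<in>J. e i j = (\<Sum>k\<in>I. c k * b k j)" using b(2) i by blast
    have "\<forall>j\<in>J. e i j = (\<Sum>k\<in>insert a I. (if k = a then 0 else c k) * b' k j)"
    proof
      fix j assume j: "j \<in> J"
      have "(\<Sum>k\<in>I. (if k = a then 0 else c k) * b' k j) = (\<Sum>k\<in>I. c k * b k j)"
        using insert.hyps by (intro sum.cong) (auto simp: b'_def)
      thus "e i j = (\<Sum>k\<in>insert a I. (if k = a then 0 else c k) * b' k j)"
        using c j insert.hyps by simp
    qed
    thus ?thesis by (intro exI[of _ "\<lambda>k. if k = a then 0 else c k"])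
  qed
  ultimately show ?case by blast
qed simp

text \<open>Guarantees that the choice in \<open>flat_volume\<close> yields a genuine chart for
  every configuration of vertices, degenerate ones included.\<close>

lemma exists_isometric_chart:
  assumes n: "CARD('r) \<le> n"
  shows "\<exists>f :: real^'r::finite \<Rightarrow> nat \<Rightarrow> real. isometric_chart n f \<and> simplex_hull n CARD('r) x \<subseteq> range f"
proof -
  obtain \<tau> :: "'r \<Rightarrow> nat" where \<tau>: "bij_betw \<tau> UNIV {1..CARD('r)}"
    using finite_same_card_bij[of "UNIV :: 'r set" "{1..CARD('r)}"] by auto
  have "\<exists>b. (\<forall>i\<in>UNIV :: 'r set. \<forall>k\<in>UNIV. (\<Sum>j<n. b i j * b k j) = of_bool (i = k)) \<and>
     (\<forall>i\<in>UNIV. \<exists>c. \<forall>j\<in>{..<n}. x (\<tau> i) j - x 0 j = (\<Sum>k\<in>UNIV. c k * b k j))"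
    by (rule orthonormal_basis_containing_span) (use n in simp_all)
  then obtain b where b0: "\<forall>i\<in>UNIV :: 'r set. \<forall>k\<in>UNIV. (\<Sum>j<n. b i j * b k j) = of_bool (i = k)"
    "\<forall>i\<in>UNIV :: 'r set. \<exists>c. \<forall>j\<in>{..<n}. x (\<tau> i) j - x 0 j = (\<Sum>k\<in>UNIV. c k * b k j)" by blast
  have b: "(\<Sum>j<n. b i j * b k j) = of_bool (i = k)" "\<exists>c. \<forall>j<n. x (\<tau> i) j - x 0 j = (\<Sum>k\<in>UNIV. c k * b k j)" for i k
    using b0 by (simp_all add: Ball_def)
  then obtain c where c: "\<And>i j. j < n \<Longrightarrow> x (\<tau> i) j - x 0 j = (\<Sum>k\<in>UNIV. c i k * b k j)" by metis
  define f where "f p = (\<lambda>j\<in>{..<n}. x 0 j + (\<Sum>k\<in>UNIV. p $ k * b k j))" for p :: "real^'r"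
  have "isometric_chart n f"
    unfolding isometric_chart_def
  proof (intro conjI allI)
    show "range f \<subseteq> extensional {..<n}" by (auto simp: f_def)
    fix p q
    have "(\<Sum>j<n. (f p j - f q j)\<^sup>2) = (\<Sum>j<n. (\<Sum>k\<in>UNIV. (p $ k - q $ k) * b k j)\<^sup>2)"
      by (intro sum.cong refl) (simp add: f_def sum_subtractf left_diff_distrib)
    also have "\<dots> = (\<Sum>j<n. \<Sum>k\<in>UNIV. \<Sum>l\<in>UNIV. (p $ k - q $ k) * (p $ l - q $ l) * (b k j * b l j))"
      by (simp add: power2_eq_square sum_product mult_ac)
    also have "\<dots> = (\<Sum>k\<in>UNIV. \<Sum>l\<in>UNIV. (p $ k - q $ k) * (p $ l - q $ l) * (\<Sum>j<n. b k j * b l j))"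
      by (subst sum.swap, intro sum.cong refl, subst sum.swap) (simp add: sum_distrib_left)
    also have "\<dots> = (\<Sum>k\<in>UNIV. (p $ k - q $ k)\<^sup>2)"
      by (simp add: b(1) of_bool_def if_distrib[of "\<lambda>u. _ * u"] sum.delta power2_eq_square cong: if_cong)
    finally show "L2_set (\<lambda>j. f p j - f q j) {..<n} = dist p q"
      unfolding L2_set_def dist_vec_power2[symmetric] by simp
  qed
  moreover have "simplex_hull n CARD('r) x \<subseteq> range f"
  proof
    fix y assume "y \<in> simplex_hull n CARD('r) x"
    then obtain u where y: "y = (\<lambda>j\<in>{..<n}. \<Sum>i\<le>CARD('r). u i * x i j)" and u: "(\<Sum>i\<le>CARD('r). u i) = 1"
      by (auto simp: simplex_hull_def)
    define p :: "real^'r" where "p = (\<chi> k. \<Sum>i\<in>UNIV. u (\<tau> i) * c i k)"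
    have "(\<Sum>i\<le>CARD('r). u i * x i j) = x 0 j + (\<Sum>k\<in>UNIV. p $ k * b k j)" if j: "j < n" for j
    proof -
      have "(\<Sum>i\<le>CARD('r). u i * x i j) = (\<Sum>i\<le>CARD('r). u i) * x 0 j + (\<Sum>i\<le>CARD('r). u i * (x i j - x 0 j))"
        unfolding sum_distrib_right sum.distrib[symmetric] by (intro sum.cong refl) (simp add: algebra_simps)
      also have "(\<Sum>i\<le>CARD('r). u i * (x i j - x 0 j)) = (\<Sum>i\<in>{1..CARD('r)}. u i * (x i j - x 0 j))"
        by (intro sum.mono_neutral_right) (auto simp: not_less_eq_eq)
      also have "\<dots> = (\<Sum>i\<in>UNIV. u (\<tau> i) * (x (\<tau> i) j - x 0 j))"
        by (rule sum.reindex_bij_betw[OF \<tau>, symmetric])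
      also have "\<dots> = (\<Sum>i\<in>UNIV. \<Sum>k\<in>UNIV. u (\<tau> i) * c i k * b k j)"
        by (simp add: c[OF j] sum_distrib_left mult_ac)
      also have "\<dots> = (\<Sum>k\<in>UNIV. p $ k * b k j)"
        by (subst sum.swap) (simp add: p_def sum_distrib_right)
      finally show ?thesis using u by simp
    qed
    hence "y = f p" by (auto simp: y f_def fun_eq_iff)
    thus "y \<in> range f" by blast
  qed
  ultimately show ?thesis by blast
qed

text \<open>The chosen chart is known only to be isometric and to cover the simplex. That suffices:
  vertices have preimages, the simplex pulls back to their convex hull, and polarization identifies
  the Gram matrix of the edges with that of the pulled-back edges, whose determinant is a square. A
  degenerate simplex needs no separate treatment, as both arguments of \<open>ln\<close> are then
  0.\<close>

theorem log_volume_eq: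
  fixes x :: "nat \<Rightarrow> nat \<Rightarrow> real" and \<sigma> :: "'r::finite well_ordered \<Rightarrow> nat"
  assumes n: "CARD('r) \<le> n" and x: "\<And>i. i \<le> CARD('r) \<Longrightarrow> x i \<in> extensional {..<n}"
    and \<sigma>: "bij_betw \<sigma> UNIV {1..CARD('r)}"
  defines "D \<equiv> gdet UNIV (gram {..<n} (\<lambda>i j. x (\<sigma> i) j - x 0 j))"
  shows "D \<ge> 0" and "log_volume TYPE('r) n x = ln (sqrt D)"
proof -
  define r where "r = CARD('r)"
  define S where "S = simplex_hull n r x"
  define f :: "real^'r \<Rightarrow> nat \<Rightarrow> real" where "f = (SOME f. isometric_chart n f \<and> S \<subseteq> range f)"
  have "isometric_chart n f \<and> S \<subseteq> range f"
    unfolding f_def S_def r_def by (rule someI_ex[OF exists_isometric_chart[OF n]])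
  hence f: "isometric_chart n f" "S \<subseteq> range f" by auto
  have xS: "x i \<in> S" if i: "i \<le> r" for i
  proof -
    have A: "x i = (\<lambda>j\<in>{..<n}. \<Sum>k\<le>r. of_bool (k = i) * x k j)"
      using i x[of i] by (auto simp: r_def fun_eq_iff extensional_def of_bool_def if_distrib[of "\<lambda>u. u * _"] sum.delta cong: if_cong)
    have B: "(\<Sum>k\<le>r. of_bool (k = i) :: real) = 1"
      using i by (simp add: of_bool_def sum.delta)
    show ?thesis unfolding S_def simplex_hull_def
      by (intro CollectI exI[of _ "\<lambda>k. of_bool (k = i)"] conjI A B) simp
  qed
  \<comment> \<open>Precomposition moves the chart to the well-ordered copy of the index type, where
    the determinant formula for simplex volumes is available.\<close>
  define g where "g = f \<circ> unindex_vec"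
  have g: "isometric_chart n g"
    using f(1) unfolding isometric_chart_def g_def by (auto simp: dist_unindex_vec)
  have "\<exists>q. g q = x i" if i: "i \<le> r" for i
  proof -
    obtain q where "f q = x i" using f(2) xS[OF i] by (metis imageE subsetD)
    hence "g (reindex_vec q) = x i" by (simp add: g_def)
    thus ?thesis by blast
  qed
  then obtain p where p: "\<And>i. i \<le> r \<Longrightarrow> g (p i) = x i" by metis
  have hull: "g -` S = convex hull (p ` {..r})"
    unfolding S_def by (rule vimage_simplex_hull[OF g p])
  define e where "e i = p (\<sigma> i) - p 0" for i
  have \<sigma>r: "\<sigma> i \<le> r" for i using bij_betwE[OF \<sigma>, rule_format, of i] by (simp add: r_def)
  have "p ` {..r} = insert (p 0) (range (\<lambda>i. p 0 + e i))"
  proof -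
    have "{..r} = insert 0 (range \<sigma>)" using \<sigma> by (auto simp: bij_betw_def r_def)
    thus ?thesis by (auto simp: e_def)
  qed
  hence vol: "measure lebesgue (g -` S) = \<bar>det (\<chi> i. e i)\<bar> / fact r"
    unfolding hull using measure_convex_hull_simplex[of "p 0" e] by (simp add: card_well_ordered r_def)
  have "D = det (\<chi> i. e i) * det (\<chi> i. e i)"
  proof -
    have "gram {..<n} (\<lambda>i j. x (\<sigma> i) j - x 0 j) i k = ((\<chi> i. e i) ** transpose (\<chi> i. e i)) $ i $ k" for i k
      using isometric_chart_inner[OF g, of "p (\<sigma> i)" "p 0" "p (\<sigma> k)"]
      by (simp add: gram_def p \<sigma>r matrix_matrix_mult_def transpose_def e_def)
    hence "(\<chi> i k. gram {..<n} (\<lambda>i j. x (\<sigma> i) j - x 0 j) i k) = (\<chi> i. e i) ** transpose (\<chi> i. e i)"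
      by (simp add: vec_eq_iff)
    thus ?thesis unfolding D_def gdet_def by (simp add: det_mul det_transpose)
  qed
  hence D: "sqrt D = \<bar>det (\<chi> i. e i)\<bar>" and "D \<ge> 0" by simp_all
  thus "D \<ge> 0" by simp
  \<comment> \<open>The pulled-back simplex is a convex hull of finitely many points, hence compact,
    so its measure survives the change of index type.\<close>
  have "compact (unindex_vec -` (f -` S))"
    using finite_imp_compact_convex_hull[of "p ` {..r}"] hull by (simp add: g_def vimage_comp)
  hence "measure lebesgue (f -` S) = measure lebesgue (g -` S)"
    by (subst measure_unindex_vec_vimage) (simp_all add: g_def vimage_comp)
  hence "flat_volume TYPE('r) n S = \<bar>det (\<chi> i. e i)\<bar> / fact r"
    unfolding flat_volume_def Let_def f_def[symmetric] using vol by simp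
  thus "log_volume TYPE('r) n x = ln (sqrt D)"
    unfolding log_volume_def r_def[symmetric] S_def[symmetric] D by simp
qed


subsection \<open>The moment generating function of the log-volume\<close>

text \<open>The density vanishes at 0 as well, since \<open>0 powr (p - 1) = 0\<close> for every
  exponent.\<close>

lemma AE_gamma_law_pos: "AE x in gamma_law p. x > 0"
proof -
  have "AE x in lborel. 0 < ennreal (indicator {0..} x * x powr (p - 1) / exp x / Gamma p) \<longrightarrow> 0 < (x::real)"
    by (intro AE_I2) (auto simp: indicator_def not_less order.order_iff_strict split: if_splits)
  thus ?thesis unfolding gamma_law_def by (subst AE_density) auto
qed

lemma nn_integral_gamma_law_power:
  assumes p: "p > 0" and s: "s > - p"
  shows "(\<integral>\<^sup>+x. ennreal (exp (s * ln x)) \<partial>gamma_law p) = ennreal (Gamma (p + s) / Gamma p)"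
proof -
  have G: "Gamma p > 0" "Gamma (p + s) > 0" using p s by simp_all
  have "(\<integral>\<^sup>+x. ennreal (exp (s * ln x)) \<partial>gamma_law p) =
    (\<integral>\<^sup>+x. ennreal (indicator {0..} x * x powr (p - 1) / exp x / Gamma p) * ennreal (exp (s * ln x)) \<partial>lborel)"
    by (rule nn_integral_gamma_law) simp
  also have "\<dots> = (\<integral>\<^sup>+x. ennreal (1 / Gamma p) * ennreal (indicator {0..} x * x powr (p + s - 1) / exp x) \<partial>lborel)"
  proof (rule nn_integral_cong)
    fix x :: real
    show "ennreal (indicator {0..} x * x powr (p - 1) / exp x / Gamma p) * ennreal (exp (s * ln x)) =
      ennreal (1 / Gamma p) * ennreal (indicator {0..} x * x powr (p + s - 1) / exp x)"
    proof (cases "x > 0")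
      case True
      have "x powr (p - 1) * exp (s * ln x) = x powr (p + s - 1)"
        using True by (simp add: powr_def exp_add[symmetric] algebra_simps)
      hence "indicator {0..} x * x powr (p - 1) / exp x / Gamma p * exp (s * ln x) =
         1 / Gamma p * (indicator {0..} x * x powr (p + s - 1) / exp x)"
        using True by (simp add: field_simps)
      thus ?thesis using G by (simp add: ennreal_mult'[symmetric] ennreal_mult''[symmetric])
    next
      case False
      thus ?thesis by (cases "x = 0") auto
    qed
  qed
  also have "\<dots> = ennreal (1 / Gamma p) * (\<integral>\<^sup>+x. ennreal (indicator {0..} x * x powr (p + s - 1) / exp x) \<partial>lborel)"
    by (rule nn_integral_cmult) simp
  also have "(\<integral>\<^sup>+x. ennreal (indicator {0..} x * x powr (p + s - 1) / exp x) \<partial>lborel) = ennreal (Gamma (p + s))"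
    using s by (subst Gamma_conv_nn_integral_real) auto
  also have "ennreal (1 / Gamma p) * ennreal (Gamma (p + s)) = ennreal (Gamma (p + s) / Gamma p)"
    using G by (simp add: ennreal_mult'[symmetric])
  finally show ?thesis .
qed

text \<open>Below the critical exponent finiteness would bound the moments of the exponents just above it,
  which grow like the simple pole of \<open>Gamma\<close> at 0.\<close>

lemma nn_integral_gamma_law_power_infinite:
  assumes p: "p > 0" and s: "s \<le> - p"
  shows "(\<integral>\<^sup>+x. ennreal (exp (s * ln x)) \<partial>gamma_law p) = \<infinity>"
proof (rule ccontr)
  have G: "Gamma p > 0" using p by simp
  assume "\<not> ?thesis"
  then obtain C where C: "C \<ge> 0" "(\<integral>\<^sup>+x. ennreal (exp (s * ln x)) \<partial>gamma_law p) = ennreal C"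
    by (cases "\<integral>\<^sup>+x. ennreal (exp (s * ln x)) \<partial>gamma_law p") auto
  \<comment> \<open>For 0 < e \<le> 1 the exponent \<open>e - p\<close> lies between
    \<open>s\<close> and 1, so the corresponding power is at most the sum of the powers with
    exponents \<open>s\<close> and 1.\<close>
  define B where "B = C + Gamma (p + 1) / Gamma p"
  have bound: "Gamma e / Gamma p \<le> B" if e: "e > 0" "e \<le> 1" for e
  proof -
    have "ennreal (Gamma e / Gamma p) = (\<integral>\<^sup>+x. ennreal (exp ((e - p) * ln x)) \<partial>gamma_law p)"
      using nn_integral_gamma_law_power[OF p, of "e - p"] e by simp
    also have "\<dots> \<le> (\<integral>\<^sup>+x. ennreal (exp (s * ln x)) + ennreal (exp (1 * ln x)) \<partial>gamma_law p)"
    proof (rule nn_integral_mono)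
      fix x :: real
      have "exp ((e - p) * ln x) \<le> exp (s * ln x) + exp (1 * ln x)"
      proof (cases "ln x \<ge> 0")
        case True
        hence "(e - p) * ln x \<le> 1 * ln x" using e p by (intro mult_right_mono) auto
        hence "exp ((e - p) * ln x) \<le> exp (1 * ln x)" by simp
        thus ?thesis by (simp add: add_increasing)
      next
        case False
        hence "(e - p) * ln x \<le> s * ln x" using e s by (intro mult_right_mono_neg) auto
        hence "exp ((e - p) * ln x) \<le> exp (s * ln x)" by simp
        thus ?thesis by (simp add: add_increasing2)
      qed
      thus "ennreal (exp ((e - p) * ln x)) \<le> ennreal (exp (s * ln x)) + ennreal (exp (1 * ln x))"
        by (simp add: ennreal_plus[symmetric] ennreal_leI del: ennreal_plus)
    qed
    also have "\<dots> = ennreal C + ennreal (Gamma (p + 1) / Gamma p)"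
    proof -
      have "(\<integral>\<^sup>+x. ennreal (exp (1 * ln x)) \<partial>gamma_law p) = ennreal (Gamma (p + 1) / Gamma p)"
        by (rule nn_integral_gamma_law_power[OF p]) (use p in simp)
      moreover have "(\<integral>\<^sup>+x. ennreal (exp (s * ln x)) + ennreal (exp (1 * ln x)) \<partial>gamma_law p) =
         (\<integral>\<^sup>+x. ennreal (exp (s * ln x)) \<partial>gamma_law p) + (\<integral>\<^sup>+x. ennreal (exp (1 * ln x)) \<partial>gamma_law p)"
        by (rule nn_integral_add) simp_all
      ultimately show ?thesis by (simp only: C(2))
    qed
    also have "\<dots> = ennreal B"
      using C p by (simp add: B_def ennreal_plus[symmetric] del: ennreal_plus)
    finally show ?thesis using C p by (subst (asm) ennreal_le_iff) (auto simp: B_def)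
  qed
  \<comment> \<open>A bound on \<open>Gamma e\<close> makes
    \<open>Gamma (e + 1) = e * Gamma e\<close> tend to 0 with \<open>e\<close>, whereas its limit is
    \<open>Gamma 1 = 1\<close>.\<close>
  have "((\<lambda>e. Gamma (e + 1) :: real) \<longlongrightarrow> Gamma (0 + 1)) (at_right 0)"
    by (intro tendsto_intros) auto
  moreover have "((\<lambda>e. e * (B * Gamma p)) \<longlongrightarrow> 0 * (B * Gamma p)) (at_right 0)"
    by (intro tendsto_intros)
  moreover have "\<forall>\<^sub>F e in at_right 0. Gamma (e + 1) \<le> e * (B * Gamma p)"
  proof -
    have "\<forall>\<^sub>F e in at_right (0::real). e \<in> {0<..<1}" by (rule eventually_at_right_real) simp
    thus ?thesis
    proof eventually_elim
      case (elim e)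
      have "e \<notin> \<int>\<^sub>\<le>\<^sub>0" using elim by (auto simp: nonpos_Ints_def)
      hence "Gamma (e + 1) = e * Gamma e" by (rule Gamma_plus1)
      also have "\<dots> \<le> e * (B * Gamma p)"
        using bound[of e] elim G by (intro mult_left_mono) (auto simp: field_simps)
      finally show ?case .
    qed
  qed
  ultimately have "Gamma (0 + 1 :: real) \<le> 0 * (B * Gamma p)"
    by (intro tendsto_le[of "at_right (0::real)"]) auto
  thus False by simp
qed

lemma gamma_law_complex_power:
  fixes s :: complex
  assumes p: "p > 0" and s: "Re s > - p"
  shows "integrable (gamma_law p) (\<lambda>x. exp (s * of_real (ln x))) \<and>
    (LINT x|gamma_law p. exp (s * of_real (ln x))) = Gamma (of_real p + s) / Gamma (of_real p)"
proof -
  interpret g: prob_space "gamma_law p" by (rule prob_space_gamma_law[OF p])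
  have lnm: "ln \<in> borel_measurable (gamma_law p)" by simp
  define A where "A = distr (gamma_law p) borel ln"
  have A: "real_distribution A"
    unfolding A_def real_distribution_def real_distribution_axioms_def
    using g.prob_space_distr[OF lnm] by simp
  have real: "integrable A (\<lambda>x. exp (t * x)) \<and> (LINT x|A. exp (t * x)) = Gamma (p + t) / Gamma p" if t: "t > - p" for t
  proof -
    have "(\<integral>\<^sup>+x. ennreal (exp (t * x)) \<partial>A) = ennreal (Gamma (p + t) / Gamma p)"
      unfolding A_def using nn_integral_gamma_law_power[OF p t] by (subst nn_integral_distr[OF lnm]) simp_all
    moreover have "Gamma (p + t) / Gamma p \<ge> 0" using p t by simp
    ultimately show ?thesis by (subst (asm) nn_integral_eq_integrable) (auto simp: A_def)
  qed
  have "integrable A (\<lambda>x. exp (s * of_real x)) \<and>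
     (LINT x|A. exp (s * of_real x)) = Gamma (of_real p + s) / Gamma (of_real p)"
  proof (rule mgf_eq_holomorphic[where c = "- p"])
    show "(\<lambda>t. Gamma (complex_of_real p + t) / Gamma (of_real p)) holomorphic_on {t. - p < Re t}"
    proof (intro holomorphic_intros)
      show "\<And>z. z \<in> {t. - p < Re t} \<Longrightarrow> of_real p + z \<notin> \<int>\<^sub>\<le>\<^sub>0"
        by (auto elim!: nonpos_Ints_cases simp: complex_eq_iff)
      have "Gamma p > 0" using p by simp
      thus "Gamma (complex_of_real p) \<noteq> 0" by (simp add: Gamma_complex_of_real)
    qed
    fix t :: real assume "t > - p"
    thus "complex_of_real (LINT x|A. exp (t * x)) = Gamma (of_real p + of_real t) / Gamma (of_real p)"
      using real by (simp add: Gamma_complex_of_real[symmetric])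
  qed (use A real s in auto)
  thus ?thesis unfolding A_def by (simp add: integrable_distr_eq[OF lnm] integral_distr[OF lnm])
qed

text \<open>The exact domain of integrability matters: a continuation has to agree with the
  expectation at every \<open>s\<close> where the latter converges, so convergence beyond the half
  plane of the Gamma formula must be ruled out.\<close>

lemma gamma_law_product_power:
  fixes s :: complex and p :: "nat \<Rightarrow> real" and c :: real and r :: nat
  assumes p: "\<And>j. p j > 0"
  defines "P \<equiv> PiM {..<r} (\<lambda>j. gamma_law (p j))"
  shows "integrable P (\<lambda>g. \<Prod>j<r. exp (s * of_real (c + ln (g j)))) \<longleftrightarrow> (\<forall>j<r. Re s > - p j)"
    and "(\<forall>j<r. Re s > - p j) \<Longrightarrow> (LINT g|P. (\<Prod>j<r. exp (s * of_real (c + ln (g j))))) =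
       (\<Prod>j<r. exp (s * of_real c) * (Gamma (of_real (p j) + s) / Gamma (of_real (p j))))"
proof -
  define h where "h = (\<lambda>x::real. exp (s * complex_of_real (c + ln x)))"
  have hm: "h \<in> borel_measurable (gamma_law (p j))" for j
  proof -
    have "h \<in> borel_measurable borel" unfolding h_def by measurable
    thus ?thesis by (simp only: measurable_cong_sets[OF sets_gamma_law refl])
  qed
  have h_eq: "h = (\<lambda>x. exp (s * of_real c) * exp (s * of_real (ln x)))"
    by (simp add: h_def fun_eq_iff exp_add[symmetric] algebra_simps)
  interpret g: prob_space "gamma_law (p j)" for j by (rule prob_space_gamma_law[OF p])
  interpret gp: product_prob_space "\<lambda>j. gamma_law (p j)" "{..<r}" by standard
  have int: "integrable (gamma_law (p j)) h" "(LINT x|gamma_law (p j). h x) = exp (s * of_real c) * (Gamma (of_real (p j) + s) / Gamma (of_real (p j)))"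
    if "Re s > - p j" for j
    using gamma_law_complex_power[OF p that] unfolding h_eq by simp_all
  \<comment> \<open>A single infinite factor makes the product of the norm integrals infinite only
    if no other factor is 0, since 0 times \<infinity> is 0.\<close>
  have nn: "(\<integral>\<^sup>+x. ennreal (norm (h x)) \<partial>gamma_law (p j)) \<noteq> 0"
    "Re s \<le> - p j \<Longrightarrow> (\<integral>\<^sup>+x. ennreal (norm (h x)) \<partial>gamma_law (p j)) = \<infinity>" for j
  proof -
    have n: "norm (h x) = exp (Re s * c) * exp (Re s * ln x)" for x
      by (simp add: h_def exp_add[symmetric] algebra_simps)
    show "(\<integral>\<^sup>+x. ennreal (norm (h x)) \<partial>gamma_law (p j)) \<noteq> 0"
    proof
      assume "(\<integral>\<^sup>+x. ennreal (norm (h x)) \<partial>gamma_law (p j)) = 0"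
      hence "AE x in gamma_law (p j). ennreal (norm (h x)) = 0"
        using hm[of j] by (subst (asm) nn_integral_0_iff_AE) auto
      hence "AE x in gamma_law (p j). False" by (simp add: h_def)
      thus False by simp
    qed
    assume "Re s \<le> - p j"
    have "(\<integral>\<^sup>+x. ennreal (norm (h x)) \<partial>gamma_law (p j)) = (\<integral>\<^sup>+x. ennreal (exp (Re s * c)) * ennreal (exp (Re s * ln x)) \<partial>gamma_law (p j))"
      unfolding n by (simp add: ennreal_mult)
    also have "\<dots> = ennreal (exp (Re s * c)) * (\<integral>\<^sup>+x. ennreal (exp (Re s * ln x)) \<partial>gamma_law (p j))"
      by (rule nn_integral_cmult) simp
    finally show "(\<integral>\<^sup>+x. ennreal (norm (h x)) \<partial>gamma_law (p j)) = \<infinity>"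
      using nn_integral_gamma_law_power_infinite[OF p \<open>Re s \<le> - p j\<close>] by (simp add: ennreal_mult_top)
  qed
  show "integrable P (\<lambda>g. \<Prod>j<r. exp (s * of_real (c + ln (g j)))) \<longleftrightarrow> (\<forall>j<r. Re s > - p j)"
  proof
    assume "\<forall>j<r. Re s > - p j"
    hence "integrable P (\<lambda>g. \<Prod>j<r. h (g j))"
      unfolding P_def using int by (intro gp.product_integrable_prod) auto
    thus "integrable P (\<lambda>g. \<Prod>j<r. exp (s * of_real (c + ln (g j))))" by (simp only: h_def)
  next
    assume i: "integrable P (\<lambda>g. \<Prod>j<r. exp (s * of_real (c + ln (g j))))"
    have "(\<Prod>j<r. \<integral>\<^sup>+x. ennreal (norm (h x)) \<partial>gamma_law (p j)) = (\<integral>\<^sup>+g. (\<Prod>j<r. ennreal (norm (h (g j)))) \<partial>P)"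
      unfolding P_def using hm by (intro gp.product_nn_integral_prod[symmetric]) auto
    also have "\<dots> = (\<integral>\<^sup>+g. ennreal (norm (\<Prod>j<r. h (g j))) \<partial>P)"
      by (simp add: prod_ennreal prod_norm)
    also have "\<dots> < \<infinity>" using i by (simp only: integrable_iff_bounded h_def)
    finally have "(\<Prod>j<r. \<integral>\<^sup>+x. ennreal (norm (h x)) \<partial>gamma_law (p j)) \<noteq> \<infinity>" by simp
    thus "\<forall>j<r. Re s > - p j"
      using nn by (auto simp: ennreal_prod_eq_top not_less[symmetric])
  qed
  assume "\<forall>j<r. Re s > - p j"
  thus "(LINT g|P. (\<Prod>j<r. exp (s * of_real (c + ln (g j))))) =
       (\<Prod>j<r. exp (s * of_real c) * (Gamma (of_real (p j) + s) / Gamma (of_real (p j))))"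
    unfolding P_def using int gp.product_integral_prod[of "{..<r}" "\<lambda>_. h"] by (simp add: h_def)
qed

text \<open>The difference, with removable singularities filled in, vanishes on \<open>A\<close> and
  hence everywhere, so \<open>F\<close> and \<open>G\<close> agree on punctured neighbourhoods. The
  conventions for nice meromorphy then fix the value at the centre: 0 at a pole, the limit
  elsewhere.\<close>

lemma nicely_meromorphic_eqI:
  assumes F: "F nicely_meromorphic_on UNIV" and G: "G nicely_meromorphic_on UNIV"
    and A: "open A" "A \<noteq> {}" and eq: "\<And>z. z \<in> A \<Longrightarrow> F z = G z"
  shows "F = G"
proof
  fix z :: complex
  define H where "H = (\<lambda>z. F z - G z)"
  have H: "H meromorphic_on UNIV"
    unfolding H_def using F G by (intro meromorphic_intros) (auto simp: nicely_meromorphic_on_def)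
  have R: "remove_sings H nicely_meromorphic_on UNIV" by (rule remove_sings_nicely_meromorphic[OF H])
  have 0: "remove_sings H w = 0" if w: "w \<in> A" for w
  proof -
    have "\<forall>\<^sub>F x in at w. H x = 0"
      using eventually_at_in_open'[OF A(1) w] by eventually_elim (simp add: H_def eq)
    hence "H \<midarrow>w\<rightarrow> 0" by (rule tendsto_eventually)
    thus ?thesis by (rule remove_sings_eqI)
  qed
  have "remove_sings H constant_on UNIV"
    by (rule constant_on_extend_nicely_meromorphic_on[OF R, of A]) (use A 0 in \<open>auto simp: constant_on_def\<close>)
  hence R0: "remove_sings H w = 0" for w using 0 A(2) by (auto simp: constant_on_def)
  have "isolated_singularity_at H z"
    using H by (metis UNIV_I meromorphic_on_isolated_singularity meromorphic_on_subset subset_UNIV)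
  hence "\<forall>\<^sub>F w in at z. remove_sings H w = H w" by (rule eventually_remove_sings_eq_at)
  hence ev: "\<forall>\<^sub>F w in at z. F w = G w"
  proof eventually_elim
    case (elim w)
    hence "H w = 0" using R0[of w] by simp
    thus ?case by (simp add: H_def)
  qed
  have "is_pole F z \<and> F z = 0 \<or> F \<midarrow>z\<rightarrow> F z" "is_pole G z \<and> G z = 0 \<or> G \<midarrow>z\<rightarrow> G z"
    using F G by (auto simp: nicely_meromorphic_on_def)
  moreover have "is_pole F z \<longleftrightarrow> is_pole G z" by (rule is_pole_cong[OF ev refl])
  moreover have "F \<midarrow>z\<rightarrow> c \<longleftrightarrow> G \<midarrow>z\<rightarrow> c" for c by (rule tendsto_cong[OF ev])
  moreover have "\<not> (is_pole F z \<and> F \<midarrow>z\<rightarrow> c)" for c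
    by (metis at_neq_bot is_pole_def not_tendsto_and_filterlim_at_infinity)
  ultimately show "F z = G z" by (metis LIM_unique)
qed

text \<open>The \<open>j\<close>-th factor belongs to a chi-square variable with \<open>n - r + 1 + j\<close> degrees of freedom.\<close>

definition simplex_mgf :: "nat \<Rightarrow> nat \<Rightarrow> complex \<Rightarrow> complex" where
  "simplex_mgf r n t = (\<Prod>j<r. exp (t * of_nat n / 2 * of_real (ln (2 / real n))) *
     (Gamma (of_real (real (n - r + Suc j) / 2) + t * of_nat n / 2) / Gamma (of_real (real (n - r + Suc j) / 2))))"

text \<open>Its reciprocal is an entire function built from \<open>rGamma\<close>. Because
  \<open>inverse 0 = 0\<close>, inverting that function already gives the prescribed value 0 at the
  poles.\<close>

lemma simplex_mgf_nicely_meromorphic: "simplex_mgf r n nicely_meromorphic_on UNIV"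
proof -
  define E where "E t = (\<Prod>j<r. exp (- (t * of_nat n / 2 * of_real (ln (2 / real n)))) *
     (rGamma (of_real (real (n - r + Suc j) / 2) + t * of_nat n / 2) * Gamma (of_real (real (n - r + Suc j) / 2))))" for t :: complex
  have "E holomorphic_on UNIV" unfolding E_def by (intro holomorphic_intros) auto
  hence "E analytic_on UNIV" by (simp add: analytic_on_open)
  hence "(\<lambda>t. inverse (E t)) nicely_meromorphic_on UNIV"
    by (intro nicely_meromorphic_on_inverse analytic_on_imp_nicely_meromorphic_on)
  moreover have "inverse (E t) = simplex_mgf r n t" for t
    unfolding E_def simplex_mgf_def prod_inversef[symmetric] o_def
    by (intro prod.cong refl) (simp add: exp_minus Gamma_def field_simps)
  ultimately show ?thesis by simp
qed

lemma mgf_continuation_unique: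
  assumes F: "mgf_continuation M Y F"
    and i: "\<And>t. Re t > c \<Longrightarrow> integrable M (\<lambda>\<omega>. exp (t * complex_of_real (Y \<omega>)))"
  shows "\<exists>!F. mgf_continuation M Y F" and "mgf M Y t = F t"
proof -
  have u: "F' = F" if F': "mgf_continuation M Y F'" for F'
  proof (rule nicely_meromorphic_eqI)
    show "open {t. Re t > c}" by (intro open_halfspace_Re_gt)
    have "of_real (c + 1) \<in> {t. Re t > c}" by simp
    thus "{t. Re t > c} \<noteq> {}" by blast
    show "F' t = F t" if "t \<in> {t. Re t > c}" for t
      using F F' i[of t] that by (simp add: mgf_continuation_def)
  qed (use F F' in \<open>auto simp: mgf_continuation_def\<close>)
  show "\<exists>!F. mgf_continuation M Y F" using F u by blast
  have "(THE F. mgf_continuation M Y F) = F" using F u by (rule the_equality)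
  thus "mgf M Y t = F t" using F by (auto simp: mgf_def mgf_continuation_def)
qed

text \<open>The log-volume is a function of the Gram determinant of the edges, whose law is that of
  a product of Gamma variables. The expectation thus factors wherever it converges, and the product
  of Gamma quotients is its unique continuation.\<close>

theorem Gaussian_simplex_mgf:
  fixes X :: "nat \<Rightarrow> 'a \<Rightarrow> nat \<Rightarrow> real"
  assumes M: "prob_space M" and n: "CARD('r::finite) \<le> n"
    and indep: "prob_space.indep_vars M (\<lambda>_. std_gaussian n) X {..CARD('r)}"
    and gaussian: "\<And>i. i \<le> CARD('r) \<Longrightarrow> distr M (std_gaussian n) (X i) = std_gaussian n"
  defines "Y \<equiv> \<lambda>\<omega>. real n * (log_volume TYPE('r) n (\<lambda>i. X i \<omega>)
     - real CARD('r) / 2 * ln (real n) - 1 / 2 * ln (real (CARD('r) + 1)))"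
  shows "Y \<in> borel_measurable M" and "mgf_continuation M Y (simplex_mgf CARD('r) n)"
    and "\<exists>!F. mgf_continuation M Y F" and "mgf M Y t = simplex_mgf CARD('r) n t"
proof -
  interpret M: prob_space M by fact
  define r where "r = CARD('r)"
  define d where "d = n - r"
  have r: "r > 0" by (simp add: r_def)
  have n0: "n > 0" using n r unfolding r_def by linarith
  have nd: "n = r + d" using n by (simp add: r_def d_def)
  define J where "J = {..<n}"
  have sg: "std_gaussian n = gauss J" by (simp add: std_gaussian_def gauss_def J_def)
  obtain \<sigma> :: "'r well_ordered \<Rightarrow> nat" where \<sigma>: "bij_betw \<sigma> UNIV {1..CARD('r)}"
    using finite_same_card_bij[of "UNIV :: 'r well_ordered set" "{1..CARD('r)}"] by (auto simp: card_well_ordered)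
  have \<sigma>r: "\<sigma> i \<le> r" for i using bij_betwE[OF \<sigma>, rule_format, of i] by (simp add: r_def)
  have Xm: "X i \<in> M \<rightarrow>\<^sub>M gauss J" if "i \<le> r" for i
    using indep that unfolding M.indep_vars_def sg r_def by auto
  define V where "V \<omega> = (\<lambda>i\<in>{..r}. X i \<omega>)" for \<omega>
  have Vm: "V \<in> M \<rightarrow>\<^sub>M PiM {..r} (\<lambda>_. gauss J)"
    unfolding V_def by (rule measurable_restrict) (use Xm in auto)
  have Vd: "distr M (PiM {..r} (\<lambda>_. gauss J)) V = PiM {..r} (\<lambda>_. gauss J)"
  proof -
    have "distr M (PiM {..r} (\<lambda>_. gauss J)) (\<lambda>\<omega>. \<lambda>i\<in>{..r}. X i \<omega>) = PiM {..r} (\<lambda>i. distr M (gauss J) (X i))"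
      by (rule M.indep_vars_iff_distr_eq_PiM'[THEN iffD1]) (use Xm indep in \<open>auto simp: sg r_def\<close>)
    also have "\<dots> = PiM {..r} (\<lambda>_. gauss J)"
      using gaussian by (intro PiM_cong refl) (auto simp: sg r_def)
    finally show ?thesis by (simp only: V_def[abs_def])
  qed
  define dt where "dt x = gdet UNIV (gram J (\<lambda>i j. x (\<sigma> i) j - x 0 j))" for x :: "nat \<Rightarrow> nat \<Rightarrow> real"
  have dtm: "dt \<in> borel_measurable (PiM {..r} (\<lambda>_. gauss J))"
    unfolding dt_def
  proof (rule measurable_gdet_gram)
    fix i j assume j: "j \<in> J"
    show "(\<lambda>x. x (\<sigma> i) j - x 0 j) \<in> borel_measurable (PiM {..r} (\<lambda>_. gauss J))"
      by (intro borel_measurable_diff measurable_PiM_gauss_entry) (use j \<sigma>r in auto)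
  qed
  define y where "y u = real n * (1 / 2 * ln u - real r / 2 * ln (real n) - 1 / 2 * ln (real (r + 1)))" for u
  have ym: "y \<in> borel_measurable borel" unfolding y_def by measurable
  have Yy: "Y \<omega> = y (dt (V \<omega>))" if \<omega>: "\<omega> \<in> space M" for \<omega>
  proof -
    define D where "D = gdet UNIV (gram {..<n} (\<lambda>i j. X (\<sigma> i) \<omega> j - X 0 \<omega> j))"
    have ext: "X i \<omega> \<in> extensional {..<n}" if "i \<le> CARD('r)" for i
      using measurable_space[OF Xm \<omega>, of i] that by (simp add: r_def space_gauss J_def)
    have D: "D \<ge> 0" "log_volume TYPE('r) n (\<lambda>i. X i \<omega>) = ln (sqrt D)"
      unfolding D_def by (rule log_volume_eq[OF n ext \<sigma>]; assumption)+
    have "dt (V \<omega>) = D"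
      unfolding dt_def D_def J_def by (rule gdet_cong) (simp add: gram_def V_def \<sigma>r)
    \<comment> \<open>For \<open>D = 0\<close> this uses the default \<open>ln 0 = 0\<close>, so no
      nondegenerate event has to be singled out.\<close>
    moreover have "ln (sqrt D) = 1 / 2 * ln D" using D(1) by (cases "D = 0") (auto simp: ln_sqrt)
    ultimately show ?thesis by (simp add: Y_def y_def D(2) r_def)
  qed
  have Dm: "(\<lambda>\<omega>. dt (V \<omega>)) \<in> borel_measurable M" by (rule measurable_compose[OF Vm dtm])
  show "Y \<in> borel_measurable M"
    using measurable_compose[OF Dm ym] by (subst measurable_cong[OF Yy]) auto
  define p where "p j = real (d + Suc j) / 2" for j
  have p: "p j > 0" for j by (simp add: p_def)
  define P where "P = PiM {..<r} (\<lambda>j. gamma_law (p j))"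
  define W where "W g = real (r + 1) * (\<Prod>j<r. 2 * g j)" for g :: "nat \<Rightarrow> real"
  have gm: "(\<lambda>g. g j) \<in> borel_measurable P" if "j < r" for j
    using measurable_component_singleton[of j "{..<r}" "\<lambda>j. gamma_law (p j)"] that
    unfolding P_def measurable_cong_sets[OF refl sets_gamma_law] by simp
  have Wm: "W \<in> borel_measurable P"
    unfolding W_def by (intro borel_measurable_times borel_measurable_const borel_measurable_prod gm) auto
  have law: "distr M borel (\<lambda>\<omega>. dt (V \<omega>)) = distr P borel W"
  proof (rule measure_eqI)
    fix A assume "A \<in> sets (distr M borel (\<lambda>\<omega>. dt (V \<omega>)))"
    hence A: "A \<in> sets borel" by simp
    have ia: "(indicator A :: real \<Rightarrow> ennreal) \<in> borel_measurable borel" using A by simp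
    have cw: "CARD('r well_ordered) = r" by (simp add: card_well_ordered r_def)
    have "emeasure (distr M borel (\<lambda>\<omega>. dt (V \<omega>))) A = (\<integral>\<^sup>+\<omega>. indicator A (dt (V \<omega>)) \<partial>M)"
      using A by (subst nn_integral_distr[OF Dm, symmetric]) simp_all
    also have "\<dots> = (\<integral>\<^sup>+x. indicator A (dt x) \<partial>distr M (PiM {..r} (\<lambda>_. gauss J)) V)"
      by (rule nn_integral_distr[OF Vm, symmetric]) (simp only: measurable_distr_eq1 measurable_compose[OF dtm ia])
    also have "\<dots> = (\<integral>\<^sup>+x. indicator A (dt x) \<partial>PiM {..r} (\<lambda>_. gauss J))" unfolding Vd ..
    also have "\<dots> = (\<integral>\<^sup>+g. indicator A (W g) \<partial>P)"
      using nn_integral_gdet_edges[of \<sigma> J d "indicator A"] \<sigma> ia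
      unfolding dt_def W_def P_def p_def cw by (simp add: card_well_ordered J_def nd r_def)
    also have "\<dots> = emeasure (distr P borel W) A"
      using A by (subst nn_integral_distr[OF Wm, symmetric]) simp_all
    finally show "emeasure (distr M borel (\<lambda>\<omega>. dt (V \<omega>))) A = emeasure (distr P borel W) A" .
  qed simp
  \<comment> \<open>The factor 2 of the chi-square variable and the share \<open>ln n\<close> of the
    centring, distributed evenly over the \<open>r\<close> factors; the term
    \<open>ln (r + 1)\<close> of the centring cancels against the factor \<open>r + 1\<close> of the
    determinant.\<close>
  define c where "c = ln (2 / real n)"
  \<comment> \<open>The logarithm of the product splits only at positive factors, so the factorized
    integrand equals the original one almost everywhere.\<close>
  have pos: "AE g in P. \<forall>j<r. g j > 0"
  proof -
    have "AE g in P. g j > 0" if j: "j < r" for j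
    proof -
      have "distr P (gamma_law (p j)) (\<lambda>g. g j) = gamma_law (p j)"
        unfolding P_def using distr_PiM_component[of "{..<r}" "\<lambda>j. gamma_law (p j)" j] prob_space_gamma_law[OF p] j by simp
      hence "AE x in distr P (gamma_law (p j)) (\<lambda>g. g j). x > 0" using AE_gamma_law_pos[of "p j"] by (simp only:)
      thus ?thesis
        by (subst (asm) AE_distr_iff) (use gm[OF j] in \<open>auto simp: measurable_cong_sets[OF refl sets_gamma_law]\<close>)
    qed
    hence "AE g in P. \<forall>j\<in>{..<r}. g j > 0" by (intro AE_finite_allI) auto
    thus ?thesis by (simp add: Ball_def)
  qed
  have key: "exp (t * of_real (y (W g))) = (\<Prod>j<r. exp (t * of_nat n / 2 * of_real (c + ln (g j))))"
    if g: "\<forall>j<r. g j > 0" for g and t :: complex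
  proof -
    have "ln (W g) = ln (real (r + 1)) + (\<Sum>j<r. ln (2 * g j))"
    proof -
      have "(\<Prod>j<r. 2 * g j) > 0" using g by (intro prod_pos) auto
      hence "ln (W g) = ln (real (r + 1)) + ln (\<Prod>j<r. 2 * g j)" unfolding W_def by (intro ln_mult_pos) auto
      also have "ln (\<Prod>j<r. 2 * g j) = (\<Sum>j<r. ln (2 * g j))" using g by (intro ln_prod) auto
      finally show ?thesis .
    qed
    moreover have "(\<Sum>j<r. ln (2 * g j)) - real r * ln (real n) = (\<Sum>j<r. c + ln (g j))"
    proof -
      have "c + ln (g j) = ln (2 * g j) - ln (real n)" if "j < r" for j
        using g n0 that by (simp add: c_def ln_mult_pos ln_div)
      thus ?thesis by (simp add: sum_subtractf)
    qed
    ultimately have "y (W g) = real n / 2 * (\<Sum>j<r. c + ln (g j))"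
      by (simp add: y_def algebra_simps)
    hence "t * of_real (y (W g)) = (\<Sum>j<r. t * of_nat n / 2 * of_real (c + ln (g j)))"
      by (simp add: sum_distrib_left mult_ac)
    thus ?thesis by (simp only: exp_sum[OF finite_lessThan])
  qed
  define \<Phi> where "\<Phi> t = (\<lambda>g. \<Prod>j<r. exp (t * of_nat n / 2 * of_real (c + ln (g j))))" for t :: complex and g :: "nat \<Rightarrow> real"
  have em: "(\<lambda>u. exp (t * complex_of_real (y u))) \<in> borel_measurable borel" for t
    using ym by measurable
  have AEeq: "AE g in P. exp (t * of_real (y (W g))) = \<Phi> t g" for t
    using pos by eventually_elim (simp add: key \<Phi>_def)
  have \<Phi>m: "\<Phi> t \<in> borel_measurable P" for t
  proof -
    have "(\<lambda>x::real. exp (t * of_nat n / 2 * complex_of_real (c + ln x))) \<in> borel_measurable borel" by measurable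
    from measurable_compose[OF gm this] show ?thesis
      unfolding \<Phi>_def by (intro borel_measurable_prod) auto
  qed
  have eWm: "(\<lambda>g. exp (t * complex_of_real (y (W g)))) \<in> borel_measurable P" for t
    by (rule measurable_compose[OF Wm em])
  have int_iff: "integrable M (\<lambda>\<omega>. exp (t * complex_of_real (Y \<omega>))) \<longleftrightarrow> integrable P (\<Phi> t)" for t
  proof -
    have "integrable M (\<lambda>\<omega>. exp (t * complex_of_real (Y \<omega>))) \<longleftrightarrow> integrable M (\<lambda>\<omega>. exp (t * complex_of_real (y (dt (V \<omega>)))))"
      by (rule Bochner_Integration.integrable_cong) (auto simp: Yy)
    also have "\<dots> \<longleftrightarrow> integrable (distr P borel W) (\<lambda>u. exp (t * complex_of_real (y u)))"
      unfolding law[symmetric] by (rule integrable_distr_eq[OF Dm em, symmetric])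
    also have "\<dots> \<longleftrightarrow> integrable P (\<lambda>g. exp (t * complex_of_real (y (W g))))"
      by (rule integrable_distr_eq[OF Wm em])
    also have "\<dots> \<longleftrightarrow> integrable P (\<Phi> t)"
      by (rule integrable_cong_AE[OF eWm \<Phi>m AEeq])
    finally show ?thesis .
  qed
  have int_eq: "(LINT \<omega>|M. exp (t * complex_of_real (Y \<omega>))) = (LINT g|P. \<Phi> t g)" for t
  proof -
    have "(LINT \<omega>|M. exp (t * complex_of_real (Y \<omega>))) = (LINT \<omega>|M. exp (t * complex_of_real (y (dt (V \<omega>)))))"
      by (rule Bochner_Integration.integral_cong) (auto simp: Yy)
    also have "\<dots> = (LINT u|distr P borel W. exp (t * complex_of_real (y u)))"
      unfolding law[symmetric] by (rule integral_distr[OF Dm em, symmetric])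
    also have "\<dots> = (LINT g|P. exp (t * complex_of_real (y (W g))))"
      by (rule integral_distr[OF Wm em])
    also have "\<dots> = (LINT g|P. \<Phi> t g)"
      by (rule integral_cong_AE[OF eWm \<Phi>m AEeq])
    finally show ?thesis .
  qed
  have int_iff': "integrable M (\<lambda>\<omega>. exp (t * complex_of_real (Y \<omega>))) \<longleftrightarrow> (\<forall>j<r. Re (t * of_nat n / 2) > - p j)" for t
    unfolding int_iff \<Phi>_def P_def by (rule gamma_law_product_power(1)[OF p])
  show cont: "mgf_continuation M Y (simplex_mgf CARD('r) n)"
    unfolding mgf_continuation_def
  proof (intro conjI allI impI simplex_mgf_nicely_meromorphic)
    fix t assume "integrable M (\<lambda>\<omega>. exp (t * complex_of_real (Y \<omega>)))"
    hence "\<forall>j<r. Re (t * of_nat n / 2) > - p j" unfolding int_iff' .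
    from gamma_law_product_power(2)[OF p this]
    have "(LINT g|P. \<Phi> t g) = simplex_mgf r n t"
      unfolding P_def \<Phi>_def simplex_mgf_def c_def p_def d_def .
    thus "simplex_mgf CARD('r) n t = (LINT \<omega>|M. exp (t * complex_of_real (Y \<omega>)))"
      by (simp add: int_eq r_def)
  qed
  have int: "integrable M (\<lambda>\<omega>. exp (t * complex_of_real (Y \<omega>)))" if t: "Re t > 0" for t
    unfolding int_iff'
  proof (intro allI impI)
    fix j
    have "Re (t * of_nat n / 2) \<ge> 0" using t by simp
    thus "Re (t * of_nat n / 2) > - p j" using p[of j] by linarith
  qed
  show "\<exists>!F. mgf_continuation M Y F"
    by (rule mgf_continuation_unique(1)[OF cont int])
  show "mgf M Y t = simplex_mgf CARD('r) n t"
    by (rule mgf_continuation_unique(2)[OF cont int])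
qed


subsection \<open>The limit theorem\<close>

text \<open>A limit along \<open>sequentially\<close> times \<open>nhds t\<close> gives a threshold
  valid on a whole neighbourhood of \<open>t\<close>; finitely many neighbourhoods cover
  \<open>K\<close>, and the largest threshold serves.\<close>

lemma uniform_limit_compactI:
  fixes f :: "nat \<Rightarrow> 'a::t2_space \<Rightarrow> 'b::metric_space"
  assumes K: "compact K" and l: "\<And>t. t \<in> K \<Longrightarrow> isCont l t"
    and lim: "\<And>t. t \<in> K \<Longrightarrow> ((\<lambda>(n, s). f n s) \<longlongrightarrow> l t) (sequentially \<times>\<^sub>F nhds t)"
  shows "uniform_limit K f l sequentially"
proof (rule uniform_limitI)
  fix e :: real assume e: "e > 0"
  have "\<exists>N U. open U \<and> t \<in> U \<and> (\<forall>n\<ge>N. \<forall>s\<in>U. dist (f n s) (l s) < e)" if t: "t \<in> K" for t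
  proof -
    have "\<forall>\<^sub>F p in sequentially \<times>\<^sub>F nhds t. dist (case p of (n, s) \<Rightarrow> f n s) (l t) < e / 2"
      using lim[OF t] e by (intro tendstoD) auto
    then obtain P Q where P: "eventually P sequentially" and Q: "eventually Q (nhds t)"
      and PQ: "\<And>n s. P n \<Longrightarrow> Q s \<Longrightarrow> dist (f n s) (l t) < e / 2"
      unfolding eventually_prod_filter by auto
    have "(l \<longlongrightarrow> l t) (nhds t)" using l[OF t] by (simp add: isCont_def tendsto_nhds_iff)
    hence "\<forall>\<^sub>F s in nhds t. dist (l s) (l t) < e / 2" using e by (intro tendstoD) auto
    with Q have "\<forall>\<^sub>F s in nhds t. Q s \<and> dist (l s) (l t) < e / 2" by (rule eventually_conj)
    then obtain U where U: "open U" "t \<in> U" "\<And>s. s \<in> U \<Longrightarrow> Q s \<and> dist (l s) (l t) < e / 2"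
      unfolding eventually_nhds by blast
    obtain N where N: "\<And>n. n \<ge> N \<Longrightarrow> P n" using P unfolding eventually_sequentially by blast
    have "dist (f n s) (l s) < e" if "n \<ge> N" "s \<in> U" for n s
      using PQ[OF N[OF that(1)], of s] U(3)[OF that(2)] by (metis dist_triangle_half_l dist_commute)
    thus ?thesis using U by blast
  qed
  then obtain N U where NU: "\<And>t. t \<in> K \<Longrightarrow> open (U t) \<and> t \<in> U t \<and> (\<forall>n\<ge>N t. \<forall>s\<in>U t. dist (f n s) (l s) < e)"
    by metis
  obtain T where T: "T \<subseteq> K" "finite T" "K \<subseteq> (\<Union>t\<in>T. U t)"
    by (rule compactE_image[OF K, of K U]) (use NU in auto)
  have "\<forall>n\<ge>Max (insert 0 (N ` T)). \<forall>s\<in>K. dist (f n s) (l s) < e"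
  proof (intro allI impI ballI)
    fix n s assume n: "n \<ge> Max (insert 0 (N ` T))" and s: "s \<in> K"
    obtain t where t: "t \<in> T" "s \<in> U t" using T(3) s by blast
    have "N t \<le> Max (insert 0 (N ` T))" using T(2) t by (intro Max_ge) auto
    thus "dist (f n s) (l s) < e" using NU[of t] T(1) t n by auto
  qed
  thus "\<forall>\<^sub>F n in sequentially. \<forall>s\<in>K. dist (f n s) (l s) < e"
    unfolding eventually_sequentially by blast
qed

text \<open>The factors are the quotients of \<open>Gamma_ratio_tendsto\<close> at
  \<open>a = n / 2\<close> and \<open>w = t + 1\<close>; the exponential of
  \<open>ln (2 / n) = - ln a\<close> is exactly the normalization there, and
  \<open>exp (n / 2 * (w * Ln w - w + 1))\<close> is one of the \<open>r\<close> equal factors of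
  the denominator.\<close>

lemma simplex_mgf_tendsto:
  fixes t0 :: complex
  assumes t0: "t0 + 1 \<notin> \<real>\<^sub>\<le>\<^sub>0"
  shows "((\<lambda>(n, t). simplex_mgf r n t / exp (complex_of_real (real (r * n)) * (1 / 2 * ((t + 1) * Ln (t + 1) - t))))
     \<longlongrightarrow> (t0 + 1) powr (- (of_nat (r * (r + 1)) / 4))) (sequentially \<times>\<^sub>F nhds t0)"
proof -
  define b where "b j = (real (Suc j) - real r) / 2" for j
  define G where "G j = (\<lambda>(a::real, w::complex). Gamma (of_real a * w + of_real (b j)) / Gamma (of_real a + of_real (b j)) *
            exp (- (of_real a * (w - 1) * of_real (ln a))) *
            exp (- (of_real a * (w * Ln w - w + 1))))" for j
  define \<kappa> where "\<kappa> = (\<lambda>p::nat \<times> complex. (real (fst p) / 2, snd p + 1))"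
  have "filterlim \<kappa> (at_top \<times>\<^sub>F nhds (t0 + 1)) (sequentially \<times>\<^sub>F nhds t0)"
    unfolding \<kappa>_def
  proof (rule filterlim_Pair)
    have "filterlim (\<lambda>n. real n / 2) at_top sequentially" by real_asymp
    thus "filterlim (\<lambda>p. real (fst p) / 2) at_top (sequentially \<times>\<^sub>F nhds t0)"
      by (rule filterlim_compose) (rule filterlim_fst)
    have "(snd \<longlongrightarrow> t0) (sequentially \<times>\<^sub>F nhds t0)" by (rule filterlim_snd)
    thus "((\<lambda>p. snd p + 1) \<longlongrightarrow> t0 + 1) (sequentially \<times>\<^sub>F nhds t0)" by (intro tendsto_intros)
  qed
  hence lim: "((\<lambda>p. \<Prod>j<r. G j (\<kappa> p)) \<longlongrightarrow> (\<Prod>j<r. exp ((of_real (b j) - 1 / 2) * Ln (t0 + 1)))) (sequentially \<times>\<^sub>F nhds t0)"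
    unfolding G_def by (intro tendsto_prod filterlim_compose[OF Gamma_ratio_tendsto[OF t0]])
  have "(\<Prod>j<r. exp ((of_real (b j) - 1 / 2) * Ln (t0 + 1))) = exp ((\<Sum>j<r. (of_real (b j) - 1 / 2) * Ln (t0 + 1)))"
    by (rule exp_sum[symmetric]) simp
  also have "(\<Sum>j<r. (of_real (b j) - 1 / 2) * Ln (t0 + 1)) = of_real (\<Sum>j<r. b j - 1 / 2) * Ln (t0 + 1)"
    by (simp add: sum_distrib_right)
  also have "(\<Sum>j<r. b j - 1 / 2) = - (real (r * (r + 1)) / 4)"
  proof -
    \<comment> \<open>The upper limit \<open>m\<close> is separated from the \<open>r\<close> inside
      \<open>b\<close>, so that induction is possible. The summands are (j - r) / 2.\<close>
    have S: "(\<Sum>j<m. b j - 1 / 2) = real m * (real m - 1) / 4 - real m * real r / 2" for m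
      by (induction m) (simp_all add: b_def field_simps)
    show ?thesis unfolding S[of r] by (simp add: field_simps)
  qed
  finally have val: "(\<Prod>j<r. exp ((of_real (b j) - 1 / 2) * Ln (t0 + 1))) = (t0 + 1) powr (- (of_nat (r * (r + 1)) / 4))"
    using t0 by (auto simp: powr_def)
  \<comment> \<open>From \<open>n \<ge> r\<close> on the natural subtraction \<open>n - r\<close> is
    exact, and \<open>n > 0\<close> is needed for the logarithm of \<open>2 / n\<close>.\<close>
  have ev: "\<forall>\<^sub>F p in sequentially \<times>\<^sub>F nhds t0. fst p \<ge> max 1 r"
    by (rule eventually_compose_filterlim[OF eventually_ge_at_top filterlim_fst])
  have "\<forall>\<^sub>F p in sequentially \<times>\<^sub>F nhds t0. (\<Prod>j<r. G j (\<kappa> p)) =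
      (case p of (n, t) \<Rightarrow> simplex_mgf r n t / exp (complex_of_real (real (r * n)) * (1 / 2 * ((t + 1) * Ln (t + 1) - t))))"
    using ev
  proof eventually_elim
    case (elim p)
    obtain n t where p: "p = (n, t)" by force
    have n: "n \<ge> r" "n > 0" using elim by (auto simp: p)
    have E: "exp (complex_of_real (real (r * n)) * (1 / 2 * ((t + 1) * Ln (t + 1) - t))) =
      (\<Prod>j<r. exp (of_nat n / 2 * ((t + 1) * Ln (t + 1) - t)))"
      by (simp add: exp_of_nat_mult[symmetric] mult_ac)
    have b: "complex_of_real (real (n - r + Suc j) / 2) = of_nat n / 2 + of_real (b j)" for j
      using n by (simp add: b_def of_nat_diff field_simps)
    have ln: "ln (2 / real n) = - ln (real n / 2)" using n by (simp add: ln_div)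
    have "G j (\<kappa> p) = exp (t * of_nat n / 2 * of_real (ln (2 / real n))) *
     (Gamma (of_real (real (n - r + Suc j) / 2) + t * of_nat n / 2) / Gamma (of_real (real (n - r + Suc j) / 2))) /
       exp (of_nat n / 2 * ((t + 1) * Ln (t + 1) - t))" for j
    proof -
      have e1: "- (of_real (real n / 2) * ((t + 1) - 1) * of_real (ln (real n / 2))) = t * of_nat n / 2 * complex_of_real (ln (2 / real n))"
        unfolding ln by simp
      have e2: "- (of_real (real n / 2) * ((t + 1) * Ln (t + 1) - (t + 1) + 1)) = - (of_nat n / 2 * ((t + 1) * Ln (t + 1) - t))"
        by simp
      have e3: "complex_of_real (real n / 2) * (t + 1) + of_real (b j) = of_nat n / 2 + of_real (b j) + t * of_nat n / 2"
        by (simp add: field_simps)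
      have e4: "complex_of_real (real n / 2) + of_real (b j) = of_nat n / 2 + of_real (b j)" by simp
      show ?thesis
        unfolding G_def \<kappa>_def p fst_conv snd_conv case_prod_conv e1 e2 e3 e4 b
        by (simp only: exp_minus divide_inverse mult_ac)
    qed
    thus ?case unfolding p case_prod_conv simplex_mgf_def E prod_dividef[symmetric] by simp
  qed
  from Lim_transform_eventually[OF lim this] show ?thesis unfolding val .
qed

lemma compact_uniform_limit_simplex_mgf:
  assumes K: "compact K" "K \<subseteq> - (complex_of_real ` {..-1})"
  shows "uniform_limit K (\<lambda>n t. simplex_mgf r n t / exp (complex_of_real (real (r * n)) * (1 / 2 * ((t + 1) * Ln (t + 1) - t))))
     (\<lambda>t. (t + 1) powr (- (of_nat (r * (r + 1)) / 4))) sequentially"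
proof (rule uniform_limit_compactI[OF K(1)])
  fix t :: complex assume "t \<in> K"
  hence t: "t \<notin> complex_of_real ` {..-1}" using K(2) by auto
  have t1: "t + 1 \<notin> \<real>\<^sub>\<le>\<^sub>0"
  proof
    assume "t + 1 \<in> \<real>\<^sub>\<le>\<^sub>0"
    then obtain x where x: "x \<le> 0" "t + 1 = of_real x" by (auto elim: nonpos_Reals_cases)
    hence "t = of_real (x - 1)" by (simp add: algebra_simps)
    hence "t \<in> complex_of_real ` {..-1}" using x(1) by (intro image_eqI[of _ _ "x - 1"]) auto
    thus False using t by contradiction
  qed
  show "isCont (\<lambda>t. (t + 1) powr (- (of_nat (r * (r + 1)) / 4))) t"
    using t1 by (intro continuous_intros) auto
  show "((\<lambda>(n, s). simplex_mgf r n s / exp (complex_of_real (real (r * n)) * (1 / 2 * ((s + 1) * Ln (s + 1) - s))))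
     \<longlongrightarrow> (t + 1) powr (- (of_nat (r * (r + 1)) / 4))) (sequentially \<times>\<^sub>F nhds t)"
    by (rule simplex_mgf_tendsto[OF t1])
qed

theorem proposition4p2:
  fixes r :: nat
    and M :: "nat \<Rightarrow> 'a measure"
    and X :: "nat \<Rightarrow> nat \<Rightarrow> 'a \<Rightarrow> nat \<Rightarrow> real"
    and Y :: "nat \<Rightarrow> 'a \<Rightarrow> real"
    and \<eta> \<psi> :: "complex \<Rightarrow> complex"
  assumes r: "r = CARD('r::finite)"
    and prob: "\<And>n. n \<ge> r \<Longrightarrow> prob_space (M n)"
    and indep: "\<And>n. n \<ge> r \<Longrightarrow>
          prob_space.indep_vars (M n) (\<lambda>_. std_gaussian n) (X n) {..r}"
    and gaussian: "\<And>n i. n \<ge> r \<Longrightarrow> i \<le> r \<Longrightarrow>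
          distr (M n) (std_gaussian n) (X n i) = std_gaussian n"
  defines "Y \<equiv> \<lambda>n \<omega>. real n *
            (log_volume TYPE('r) n (\<lambda>i. X n i \<omega>) - real r / 2 * ln (real n) - 1 / 2 * ln (real (r + 1)))"
    and "\<eta> \<equiv> \<lambda>t. 1 / 2 * ((t + 1) * ln (t + 1) - t)"
    and "\<psi> \<equiv> \<lambda>t. (t + 1) powr (- (of_nat (r * (r + 1)) / 4))"
  shows "(\<forall>n\<ge>r. \<exists>!F. mgf_continuation (M n) (Y n) F) \<and>
         mod_phi_convergent M Y \<eta> (\<lambda>n. real (r * n)) (-1) \<infinity> \<psi> \<and>
         (\<forall>K. compact K \<and> K \<subseteq> - (complex_of_real ` {..-1}) \<longrightarrow>
            uniform_limit K
              (\<lambda>n t. mgf (M n) (Y n) t / exp (complex_of_real (real (r * n)) * \<eta> t))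
              \<psi> sequentially)"
proof -
  note G = Gaussian_simplex_mgf[where 'r = 'r, folded r, OF prob _ indep gaussian, folded Y_def]
  have r0: "r > 0" by (simp add: r)
  have A: "\<forall>n\<ge>r. \<exists>!F. mgf_continuation (M n) (Y n) F"
    using G(3) unfolding Y_def by blast
  have mgf_eq: "mgf (M n) (Y n) t = simplex_mgf r n t" if "n \<ge> r" for n t
    using G(4) that unfolding Y_def by blast
  have C: "uniform_limit K (\<lambda>n t. mgf (M n) (Y n) t / exp (complex_of_real (real (r * n)) * \<eta> t)) \<psi> sequentially"
    if "compact K" "K \<subseteq> - (complex_of_real ` {..-1})" for K
  proof -
    have "\<forall>\<^sub>F n in sequentially. \<forall>t\<in>K. mgf (M n) (Y n) t / exp (complex_of_real (real (r * n)) * \<eta> t) =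
       simplex_mgf r n t / exp (complex_of_real (real (r * n)) * (1 / 2 * ((t + 1) * Ln (t + 1) - t)))"
      using eventually_ge_at_top[of r] by eventually_elim (simp add: mgf_eq \<eta>_def)
    thus ?thesis
      using compact_uniform_limit_simplex_mgf[OF that, of r] unfolding \<psi>_def
      by (subst uniform_limit_cong) auto
  qed
  have strip: "open_strip (-1) \<infinity> = {t. Re t > -1}"
    by (auto simp: open_strip_def one_ereal_def)
  have strip_sub: "{t. Re t > -1} \<subseteq> - (complex_of_real ` {..-1})" by auto
  have "mod_phi_convergent M Y \<eta> (\<lambda>n. real (r * n)) (-1) \<infinity> \<psi>"
    unfolding mod_phi_convergent_def strip
  proof (intro conjI ballI)
    show "\<forall>\<^sub>F n in sequentially. prob_space (M n) \<and> Y n \<in> borel_measurable (M n)"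
      using eventually_ge_at_top[of r]
      by eventually_elim (use prob G(1) in \<open>auto simp: Y_def\<close>)
    show "filterlim (\<lambda>n. real (r * n)) at_top sequentially"
      using r0 by real_asymp
    show "- 1 < (\<infinity> :: ereal)" by (simp add: one_ereal_def)
    show "\<exists>\<phi>. infinitely_divisible \<phi> \<and> (\<forall>t\<in>{t. - 1 < Re t}.
        integrable \<phi> (\<lambda>x. exp (t * complex_of_real x)) \<and>
        (LINT x|\<phi>. exp (t * complex_of_real x)) = exp (\<eta> t))"
      using exists_infinitely_divisible_stable_type_law unfolding \<eta>_def by simp
    show "\<psi> analytic_on {t. - 1 < Re t}"
      unfolding \<psi>_def by (intro analytic_intros) (auto simp: complex_nonpos_Reals_iff)
    fix t assume t: "t \<in> {t. - 1 < Re t}"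
    \<comment> \<open>A closed disc inside the strip is compact and avoids the cut, so the uniform
      limit on compact sets applies to it; the open disc is the required neighbourhood.\<close>
    have "open {t. - 1 < Re t}" by (rule open_halfspace_Re_gt)
    then obtain e where e: "e > 0" "cball t e \<subseteq> {t. - 1 < Re t}"
      using t open_contains_cball by blast
    have "uniform_limit (ball t e) (\<lambda>n s. mgf (M n) (Y n) s / exp (complex_of_real (real (r * n)) * \<eta> s)) \<psi> sequentially"
      by (rule uniform_limit_on_subset[OF C[of "cball t e"]]) (use e strip_sub in auto)
    moreover have "ball t e \<subseteq> {t. - 1 < Re t}" using e(2) ball_subset_cball by blast
    ultimately show "\<exists>U. open U \<and> t \<in> U \<and> U \<subseteq> {t. - 1 < Re t} \<and>
        uniform_limit U (\<lambda>n s. mgf (M n) (Y n) s / exp (complex_of_real (real (r * n)) * \<eta> s)) \<psi> sequentially"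
      using e(1) by (intro exI[of _ "ball t e"] conjI) auto
  qed
  thus ?thesis using A C by blast
qed

end
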